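(* Let $X$ be a symmetrically self-similar graph with bounded geometry and origin vertex $o$. If $X$ is not bipartite, then, as $n\to\infty$, $$p^{(n)}(o,o)=n^{-\frac{d_s}{2}}\biggl(\sigma\biggl(\frac{\log(n)}{\log(\tau)}\biggr)+\mathcal O(n^{-1})\biggr),$$ where $\sigma:S(\tau^2)\to\mathbb C$ is a $1$-periodic, holomorphic function given by its Fourier series $$\sigma(z)=\sum_{k=-\infty}^{\infty}\frac{\hat\omega(-k)}{\Gamma\bigl(1-\frac{\log(\mu)-2k\pi i}{\log(\tau)}\bigr)}\cdot e^{2k\pi i z}.$$ If $X$ is bipartite, then $p^{(2n+1)}(o,o)=0$ and, with $\sigma$ given by the same Fourier series, $$p^{(2n)}(o,o)=2(2n)^{-\frac{d_s}{2}}\biggl(\sigma\biggl(\frac{\log(2n)}{\log(\tau)}\biggr)+\mathcal O(n^{-1})\biggr).$$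
   Context: Graphs $X=(VX,EX)$ are undirected, without loops or multiple edges. The boundary $\theta C$ of $C\subset VX$ is the set of vertices in $VX\setminus C$ which are adjacent to some vertex in $C$, and $\hat C$ denotes the subgraph of $X$ spanned by $C\cup\theta C$, with vertex set $V\hat C$. For $F\subset VX$ let $\mathcal C_X(F)$ be the set of connected components of $VX\setminus F$. The reduced graph $X_F$ has vertex set $VX_F=F$, and two vertices $x,y\in F$ are joined by an edge of $X_F$ if and only if there is a $C\in\mathcal C_X(F)$ with $x,y\in\theta C$. A connected infinite graph $X$ is self-similar with respect to $F\subset VX$ and $\psi:VX\to VX_F$ if (F1) no vertices in $F$ are adjacent in $X$; (F2) the intersection of the boundaries of two different components in $\mathcal C_X(F)$ contains not more than one vertex; (F3) $\psi$ is an isomorphism between $X$ and $X_F$. The components in $\mathcal C_X(F)$ are called cells (1-cells), and $\hat C$ is the cell graph of a cell $C$. The 2-cells are the connected components of $VX\setminus\psi(F)$. An origin vertex is a fixed point of $\psi$. A self-similar graph $X$ is symmetrically self-similar if it is locally finite and: (S1) all cells are finite and for any pair of cells $C,D$ there exists an isomorphism $\alpha$ of $\hat C$ and $\hat D$ such that $\alpha(\theta C)=\theta D$; (S2) the automorphism group $\mathrm{Aut}(\hat C)$ acts transitively on $\{(x,y)\mid x,y\in\theta C,\ x\ne y\}$. A graph has bounded geometry if its set of vertex degrees is bounded. The mass scaling factor $\mu$ is the number of 1-cells contained in a 2-cell (independent of the 2-cell). For a cell $C$ and nonempty $B\subset\theta C$, let $Q_B=(q_B(x,y))_{x,y\in V\hat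 C}$ with $q_B(x,y)=1/\deg_{\hat C}(x)$ if $x\in V\hat C\setminus B$ is adjacent to $y$ in $\hat C$, and $q_B(x,y)=0$ otherwise; let $Q_B^*(z)=(I-zQ_B)^{-1}$. For $v\in\theta C$ the transition function is the rational function $d(z)=\sum_{w\in\theta C\setminus\{v\}}(Q^*_{\theta C\setminus\{v\}}(z))_{v,w}$, independent of $v$ and $C$. The time scaling factor is $\tau=d'(1)$, and the spectral dimension is $d_s=2\log(\mu)/\log(\tau)$. $p^{(n)}(x,y)$ denotes the $n$-step transition probability of the simple random walk on $X$. The Green function is $G(z)=\sum_{n\ge0}p^{(n)}(o,o)z^n$ for $|z|<1$; it is understood with its holomorphic continuation, which exists at least on $(\mathbb C\setminus\mathbb R)\cup(-1,1)$. For $z_0\in\mathbb C$, $r>0$, $0<\delta\le\pi$: $U_\delta(z_0,r)$ is the set of all $z\in\mathbb C\setminus\{z_0\}$ with $|z-z_0|<r$ and $|\arg(z_0-z)|<\delta$. For $b>1$: $S(b)=\{z\in\mathbb C\mid|\mathrm{Im}(z)|<\pi/\log(b)\}$. The function $\omega$ is the $1$-periodic holomorphic function on $S(\tau)$ for which there is $r>0$ with $$G(z)=(1-z)^{\frac{d_s}{2}-1}\Bigl(\omega\Bigl(\frac{\log(1-z)}{\log(\tau)}\Bigr)+\mathcal O_\delta(|z-1|)\Bigr)\quad\text{for } z\in U_\delta(1,r),\ 0<\delta<\pi$$ (such a function exists), and $\hat\omega(k)$ is its $k$-th Fourier coefficient, $\omega(z)=\sum_{k\in\mathbb Z}\hat\omega(k)e^{2k\pi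 iz}$. *)

theory Defs
  imports "HOL-Complex_Analysis.Complex_Analysis" "HOL-Library.Landau_Symbols"
begin

record 'a graph =
  verts :: "'a set"
  edges :: "'a set set"

definition simple_graph :: "'a graph \<Rightarrow> bool" where
  "simple_graph X \<longleftrightarrow>
     (\<forall>e\<in>edges X. \<exists>x\<in>verts X. \<exists>y\<in>verts X. x \<noteq> y \<and> e = {x, y})"

definition adj :: "'a graph \<Rightarrow> 'a \<Rightarrow> 'a \<Rightarrow> bool" where
  "adj X x y \<longleftrightarrow> {x, y} \<in> edges X"

definition nbrs :: "'a graph \<Rightarrow> 'a \<Rightarrow> 'a set" where
  "nbrs X x = {y \<in> verts X. adj X x y}"

definition deg :: "'a graph \<Rightarrow> 'a \<Rightarrow> nat" where
  "deg X x = card (nbrs X x)"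

definition locally_finite :: "'a graph \<Rightarrow> bool" where
  "locally_finite X \<longleftrightarrow> (\<forall>x\<in>verts X. finite (nbrs X x))"

definition bounded_geometry :: "'a graph \<Rightarrow> bool" where
  "bounded_geometry X \<longleftrightarrow> (\<exists>k. \<forall>x\<in>verts X. finite (nbrs X x) \<and> deg X x \<le> k)"

definition bipartite :: "'a graph \<Rightarrow> bool" where
  "bipartite X \<longleftrightarrow> (\<exists>A\<subseteq>verts X. \<forall>x y. adj X x y \<longrightarrow> (x \<in> A \<longleftrightarrow> y \<notin> A))"

definition graph_connected :: "'a graph \<Rightarrow> bool" where
  "graph_connected X \<longleftrightarrow> (\<forall>x\<in>verts X. \<forall>y\<in>verts X. (adj X)\<^sup>*\<^sup>* x y)"

definition induced :: "'a graph \<Rightarrow> 'a set \<Rightarrow> 'a graph" where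
  "induced X S = \<lparr>verts = verts X \<inter> S, edges = {e \<in> edges X. e \<subseteq> S}\<rparr>"

definition graph_iso :: "'a graph \<Rightarrow> 'b graph \<Rightarrow> ('a \<Rightarrow> 'b) \<Rightarrow> bool" where
  "graph_iso X Y f \<longleftrightarrow> bij_betw f (verts X) (verts Y) \<and>
     (\<forall>x\<in>verts X. \<forall>y\<in>verts X. adj X x y \<longleftrightarrow> adj Y (f x) (f y))"

text \<open>\<open>cells X F\<close> is the set of connected components of the complement of \<open>F\<close>,
  each component given by its vertex set.\<close>

definition cells :: "'a graph \<Rightarrow> 'a set \<Rightarrow> 'a set set" where
  "cells X F = {{y \<in> verts X - F. (adj (induced X (verts X - F)))\<^sup>*\<^sup>* x y} | x. x \<in> verts X - F}"

definition vboundary :: "'a graph \<Rightarrow> 'a set \<Rightarrow> 'a set" where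
  "vboundary X C = {v \<in> verts X - C. \<exists>u\<in>C. adj X u v}"

definition cell_graph :: "'a graph \<Rightarrow> 'a set \<Rightarrow> 'a graph" where
  "cell_graph X C = induced X (C \<union> vboundary X C)"

definition reduced_graph :: "'a graph \<Rightarrow> 'a set \<Rightarrow> 'a graph" where
  "reduced_graph X F = \<lparr>verts = F,
     edges = {{x, y} | x y. x \<in> F \<and> y \<in> F \<and> x \<noteq> y \<and>
                (\<exists>C\<in>cells X F. x \<in> vboundary X C \<and> y \<in> vboundary X C)}\<rparr>"

definition self_similar :: "'a graph \<Rightarrow> 'a set \<Rightarrow> ('a \<Rightarrow> 'a) \<Rightarrow> bool" where
  "self_similar X F \<psi> \<longleftrightarrow>
     simple_graph X \<and> graph_connected X \<and> infinite (verts X) \<and> F \<subseteq> verts X \<and>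
     (\<forall>x\<in>F. \<forall>y\<in>F. \<not> adj X x y) \<and>
     (\<forall>C\<in>cells X F. \<forall>D\<in>cells X F. C \<noteq> D \<longrightarrow>
        (\<forall>x\<in>vboundary X C \<inter> vboundary X D. \<forall>y\<in>vboundary X C \<inter> vboundary X D. x = y)) \<and>
     graph_iso X (reduced_graph X F) \<psi>"

text \<open>An automorphism of a cell graph need not map the boundary of the cell to itself.
  Speaking of an action on ordered pairs of boundary vertices, and of a transition function
  that does not depend on the starting boundary vertex, requires automorphisms which do, so the
  last clause below uses the automorphisms stabilising the boundary.\<close>

definition symmetrically_self_similar :: "'a graph \<Rightarrow> 'a set \<Rightarrow> ('a \<Rightarrow> 'a) \<Rightarrow> bool" where
  "symmetrically_self_similar X F \<psi> \<longleftrightarrow>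
     self_similar X F \<psi> \<and> locally_finite X \<and>
     (\<forall>C\<in>cells X F. finite C) \<and>
     (\<forall>C\<in>cells X F. \<forall>D\<in>cells X F. \<exists>\<alpha>.
        graph_iso (cell_graph X C) (cell_graph X D) \<alpha> \<and>
        \<alpha> ` vboundary X C = vboundary X D) \<and>
     (\<forall>C\<in>cells X F.
        \<forall>x\<in>vboundary X C. \<forall>y\<in>vboundary X C. \<forall>x'\<in>vboundary X C. \<forall>y'\<in>vboundary X C.
          x \<noteq> y \<longrightarrow> x' \<noteq> y' \<longrightarrow>
          (\<exists>\<alpha>. graph_iso (cell_graph X C) (cell_graph X C) \<alpha> \<and>
               \<alpha> ` vboundary X C = vboundary X C \<and> \<alpha> x = x' \<and> \<alpha> y = y'))"

definition origin_vertex :: "'a graph \<Rightarrow> ('a \<Rightarrow> 'a) \<Rightarrow> 'a \<Rightarrow> bool" where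
  "origin_vertex X \<psi> v \<longleftrightarrow> v \<in> verts X \<and> \<psi> v = v"

text \<open>The cells of \<open>\<psi> ` F\<close> are the 2-cells. The number counted here is the same for all of them.\<close>

definition mass_scaling :: "'a graph \<Rightarrow> 'a set \<Rightarrow> ('a \<Rightarrow> 'a) \<Rightarrow> nat" where
  "mass_scaling X F \<psi> = (THE m. \<forall>D\<in>cells X (\<psi> ` F). card {C \<in> cells X F. C \<subseteq> D} = m)"

definition absorbed_matrix :: "'a graph \<Rightarrow> 'a set \<Rightarrow> 'a \<Rightarrow> 'a \<Rightarrow> complex" where
  "absorbed_matrix Y B x y =
     (if x \<in> verts Y - B \<and> y \<in> nbrs Y x then 1 / of_nat (deg Y x) else 0)"

text \<open>The inverse of a square matrix with rows and columns indexed by the finite set \<open>V\<close>;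
  unspecified if the matrix is singular.\<close>

definition inverse_on :: "'a set \<Rightarrow> ('a \<Rightarrow> 'a \<Rightarrow> complex) \<Rightarrow> 'a \<Rightarrow> 'a \<Rightarrow> complex" where
  "inverse_on V A = (THE M.
     (\<forall>x y. x \<notin> V \<or> y \<notin> V \<longrightarrow> M x y = 0) \<and>
     (\<forall>x\<in>V. \<forall>y\<in>V. (\<Sum>w\<in>V. A x w * M w y) = (if x = y then 1 else 0)) \<and>
     (\<forall>x\<in>V. \<forall>y\<in>V. (\<Sum>w\<in>V. M x w * A w y) = (if x = y then 1 else 0)))"

definition absorbed_green :: "'a graph \<Rightarrow> 'a set \<Rightarrow> complex \<Rightarrow> 'a \<Rightarrow> 'a \<Rightarrow> complex" where
  "absorbed_green Y B z =
     inverse_on (verts Y) (\<lambda>x y. (if x = y then 1 else 0) - z * absorbed_matrix Y B x y)"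

definition cell_transition :: "'a graph \<Rightarrow> 'a set \<Rightarrow> 'a \<Rightarrow> complex \<Rightarrow> complex" where
  "cell_transition X C v z =
     (\<Sum>w\<in>vboundary X C - {v}. absorbed_green (cell_graph X C) (vboundary X C - {v}) z v w)"

text \<open>The common value is taken for each \<open>z\<close> separately, so that the unspecified values of
  \<^const>\<open>cell_transition\<close> at the finitely many \<open>z\<close> where the matrix is singular do no harm.\<close>

definition transition_function :: "'a graph \<Rightarrow> 'a set \<Rightarrow> complex \<Rightarrow> complex" where
  "transition_function X F z =
     (THE c. \<forall>C\<in>cells X F. \<forall>v\<in>vboundary X C. cell_transition X C v z = c)"

text \<open>The derivative at 1 is real because the matrix entries are.\<close>

definition time_scaling :: "'a graph \<Rightarrow> 'a set \<Rightarrow> real" where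
  "time_scaling X F = Re (deriv (transition_function X F) 1)"

definition spectral_dim :: "'a graph \<Rightarrow> 'a set \<Rightarrow> ('a \<Rightarrow> 'a) \<Rightarrow> real" where
  "spectral_dim X F \<psi> = 2 * ln (real (mass_scaling X F \<psi>)) / ln (time_scaling X F)"

text \<open>\<open>walk_prob X n x y\<close> is the \<open>n\<close>-step transition probability of simple random walk.\<close>

primrec walk_prob :: "'a graph \<Rightarrow> nat \<Rightarrow> 'a \<Rightarrow> 'a \<Rightarrow> real" where
  "walk_prob X 0 x y = (if x = y then 1 else 0)"
| "walk_prob X (Suc n) x y = (\<Sum>w\<in>nbrs X x. 1 / real (deg X x) * walk_prob X n w y)"

definition green_domain :: "complex set" where
  "green_domain = (- \<real>) \<union> complex_of_real ` {-1<..<1}"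

text \<open>The holomorphic continuation to \<^const>\<open>green_domain\<close> is unique; values elsewhere are
  unspecified.\<close>

definition green_function :: "'a graph \<Rightarrow> 'a \<Rightarrow> complex \<Rightarrow> complex" where
  "green_function X v = (SOME g. g holomorphic_on green_domain \<and>
     (\<forall>z. norm z < 1 \<longrightarrow> (\<lambda>n. complex_of_real (walk_prob X n v v) * z ^ n) sums g z))"

definition sector :: "real \<Rightarrow> complex \<Rightarrow> real \<Rightarrow> complex set" where
  "sector \<delta> z0 r = {z. z \<noteq> z0 \<and> norm (z - z0) < r \<and> \<bar>Arg (z0 - z)\<bar> < \<delta>}"

definition strip :: "real \<Rightarrow> complex set" where
  "strip b = {z. \<bar>Im z\<bar> < pi / ln b}"

text \<open>\<open>green_periodic X F \<psi> v \<omega>\<close>: \<open>\<omega>\<close> is the (unique) periodic function in the leading term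
  of the Green function at \<open>z = 1\<close>. The radius \<open>r\<close> does not depend on \<open>\<delta>\<close>, the error
  constant \<open>K\<close> does. As \<open>r\<close> may be decreased, the values of the Green function outside
  \<^const>\<open>green_domain\<close> play no role.\<close>

definition green_periodic ::
  "'a graph \<Rightarrow> 'a set \<Rightarrow> ('a \<Rightarrow> 'a) \<Rightarrow> 'a \<Rightarrow> (complex \<Rightarrow> complex) \<Rightarrow> bool" where
  "green_periodic X F \<psi> v \<omega> \<longleftrightarrow>
     \<omega> holomorphic_on strip (time_scaling X F) \<and>
     (\<forall>z\<in>strip (time_scaling X F). \<omega> (z + 1) = \<omega> z) \<and>
     (\<exists>r>0. \<forall>\<delta>. 0 < \<delta> \<longrightarrow> \<delta> < pi \<longrightarrow>
        (\<exists>K err. \<forall>z\<in>sector \<delta> 1 r.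
           norm (err z) \<le> K * norm (z - 1) \<and>
           green_function X v z =
             (1 - z) powr complex_of_real (spectral_dim X F \<psi> / 2 - 1) *
             (\<omega> (Ln (1 - z) / complex_of_real (ln (time_scaling X F))) + err z)))"

definition fourier_coeff :: "(complex \<Rightarrow> complex) \<Rightarrow> int \<Rightarrow> complex" where
  "fourier_coeff f k =
     integral {0..1} (\<lambda>t. f (complex_of_real t) *
       exp (- (2 * of_int k * complex_of_real pi * \<i> * complex_of_real t)))"

end

theory Submission
  imports Defs
begin

text \<open>
  The walk is a self-adjoint contraction, so the return probabilities are moments of a measure on
  \<open>[-1, 1]\<close>; expanding the resolvent in Chebyshev polynomials continues the Green function to
  \<^const>\<open>green_domain\<close>. If the graph is not bipartite, neither are its cells, and the resulting
  uniform supply of odd closed walks gives a spectral gap at \<open>-1\<close>, so that \<open>1\<close> is the only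
  singularity on the unit circle. If it is bipartite, the Green function is even and \<open>-1\<close>
  contributes exactly as much as \<open>1\<close>.

  The leading term \<open>(1 - z)\<^sup>\<alpha> \<omega>(log (1 - z) / log \<tau>)\<close> is expanded into its Fourier series; the \<open>n\<close>-th
  coefficient of each summand \<open>(1 - z)\<^sup>-\<^sup>s\<close> is \<open>n\<^sup>s\<^sup>-\<^sup>1 / \<Gamma>(s) (1 + O(1/n))\<close> with an error that grows at most
  like \<open>exp (\<pi> |Im s| / 2)\<close> up to a polynomial, half of the exponential decay rate of the Fourier
  coefficients. The remainder is differentiated until its singularity is so strong that a bound on
  the circle of radius \<open>1 - 1/n\<close>, against the Poisson kernel, gives the right order of its coefficients.
  That \<open>\<tau> > 1\<close> follows since \<open>\<tau>\<close> is the expected number of steps between two boundary vertices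
  of a cell, which are not adjacent.
\<close>

subsection \<open>Analytic continuation of generating functions of moment sequences\<close>

text \<open>No spectral measure is ever constructed. The continuation uses only the linear
  functional sending x^n to the n-th return probability and its positivity on q^2, (1 - x) q^2 and
  (x - a) q^2; the quadratic form of the walk supplies these three inequalities. The left end a
  stays a parameter: a = -1 is always admissible and yields the continuation to the slit plane,
  while some a > -1 makes the same formula regular at -1. The half width of the strip of \<tau>^2
  has its origin in an exact balance. The Fourier coefficients decay like exp (-2 pi h |k|) for
  every h < pi / log \<tau>. The k-th exponent has imaginary part 2 pi k / log \<tau>, so its Gamma
  factor costs exp (pi^2 |k| / log \<tau>), and what is left converges for |Im z| < pi / (2 log
  \<tau>). Hence the constant pi / 2 in the growth of the binomial coefficients must not be
  worsened. It is obtained on the line Re s = 1/2, where the reflection formula gives |1 / Gamma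
  (s)| in closed form, and then carried to the other real parts at the price of polynomial factors
  only.\<close>

lemma half_joukowski:
  assumes w: "\<And>t. -1 \<le> t \<Longrightarrow> t \<le> 1 \<Longrightarrow> 1 - w * complex_of_real t \<noteq> 0"
  defines "s \<equiv> csqrt (1 - w\<^sup>2)"
  defines "\<zeta> \<equiv> w / (1 + s)"
  shows "1 - w\<^sup>2 \<notin> \<real>\<^sub>\<le>\<^sub>0" "1 + s \<noteq> 0" "norm \<zeta> < 1" "w * (1 + \<zeta>\<^sup>2) = 2 * \<zeta>" "1 + \<zeta>\<^sup>2 \<noteq> 0"
proof -
  \<comment> \<open>A value of 1 - w^2 on the cut would make \<open>w\<close> real with |w| >= 1,
    which the hypothesis excludes at t = 1/w.\<close>
  show nn: "1 - w\<^sup>2 \<notin> \<real>\<^sub>\<le>\<^sub>0"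
  proof
    assume "1 - w\<^sup>2 \<in> \<real>\<^sub>\<le>\<^sub>0"
    then obtain r where r: "1 - w\<^sup>2 = of_real r" "r \<le> 0" by (auto simp: nonpos_Reals_def)
    define u where "u = sqrt (1 - r)"
    have u: "u \<ge> 1" "u\<^sup>2 = 1 - r" using r by (simp_all add: u_def)
    have "w\<^sup>2 = (of_real u)\<^sup>2"
    proof -
      have "w\<^sup>2 = 1 - of_real r" by (simp flip: r(1))
      then show ?thesis by (simp add: u(2) flip: of_real_power)
    qed
    then have "w = of_real u \<or> w = - of_real u" by (simp add: power2_eq_iff)
    moreover have u1: "0 \<le> 1 / u" "1 / u \<le> 1" using u(1) by auto
    have "1 - w * complex_of_real (1 / u) \<noteq> 0" "1 - w * complex_of_real (- (1 / u)) \<noteq> 0"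
      by (rule w; use u1 in linarith)+
    ultimately show False using u(1) by auto
  qed
  have s2: "s\<^sup>2 = 1 - w\<^sup>2" by (simp add: s_def)
  have "s \<noteq> 0" using nn by (auto simp: s_def)
  have "Re s > 0"
  proof (rule ccontr)
    assume "\<not> Re s > 0"
    moreover have "Re s \<ge> 0" unfolding s_def using csqrt_principal[of "1 - w\<^sup>2"] by auto
    ultimately have "Re s = 0" by simp
    then have "s\<^sup>2 = of_real (-(Im s)\<^sup>2)" by (simp add: complex_eq_iff power2_eq_square)
    then have "s\<^sup>2 \<in> \<real>\<^sub>\<le>\<^sub>0" by (simp del: of_real_minus of_real_power)
    then show False using nn s2 by simp
  qed
  then show s1: "1 + s \<noteq> 0" by (auto simp: complex_eq_iff)
  \<comment> \<open>\<open>\<zeta>\<close> is the solution in the unit disc of w = 2 \<zeta> / (1 +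
    \<zeta>^2). Since w^2 = (1 - s)(1 + s), the inequality Re s > 0 yields |w| < |1 + s|.\<close>
  have "cmod (1 - s) < cmod (1 + s)"
    using \<open>Re s > 0\<close> by (simp add: cmod_def power2_eq_square algebra_simps)
  moreover have "(cmod w)\<^sup>2 = cmod (1 - s) * cmod (1 + s)"
  proof -
    have "w\<^sup>2 = (1 - s) * (1 + s)" using s2 by algebra
    then show ?thesis by (metis norm_mult norm_power)
  qed
  ultimately have "(cmod w)\<^sup>2 < (cmod (1 + s))\<^sup>2"
    using s1 by (simp add: power2_eq_square)
  then have "cmod w < cmod (1 + s)" by (rule power2_less_imp_less) simp
  then show "norm \<zeta> < 1" using s1 by (simp add: \<zeta>_def norm_divide)
  have \<zeta>w: "\<zeta> * (1 + s) = w" using s1 by (simp add: \<zeta>_def)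
  have "(1 + s) * ((1 + \<zeta>\<^sup>2) * (1 + s)) = (1 + 2 * s + s\<^sup>2) + (\<zeta> * (1 + s))\<^sup>2"
    by (simp add: power2_eq_square algebra_simps)
  also have "\<dots> = (1 + s) * 2" unfolding \<zeta>w s2 by simp
  finally have z: "(1 + \<zeta>\<^sup>2) * (1 + s) = 2" using s1 mult_left_cancel by blast
  then show "1 + \<zeta>\<^sup>2 \<noteq> 0" by auto
  have "w * (1 + \<zeta>\<^sup>2) = \<zeta> * ((1 + \<zeta>\<^sup>2) * (1 + s))"
    unfolding \<zeta>w[symmetric] by (simp only: mult_ac)
  then show "w * (1 + \<zeta>\<^sup>2) = 2 * \<zeta>" unfolding z by simp
qed

section \<open>Moment functionals on polynomials and their Chebyshev coefficients\<close>

definition mom :: "(nat \<Rightarrow> real) \<Rightarrow> real poly \<Rightarrow> real" where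
  "mom p q = (\<Sum>i\<le>degree q. coeff q i * p i)"

lemma mom_altdef: "degree q \<le> n \<Longrightarrow> mom p q = (\<Sum>i\<le>n. coeff q i * p i)"
  unfolding mom_def by (rule sum.mono_neutral_left) (auto simp: coeff_eq_0)

lemma mom_add: "mom p (q + r) = mom p q + mom p r"
proof -
  let ?n = "max (degree q) (degree r)"
  have "mom p (q + r) = (\<Sum>i\<le>?n. coeff (q + r) i * p i)"
    by (rule mom_altdef) (simp add: degree_add_le)
  then show ?thesis
    by (simp add: mom_altdef[of q ?n] mom_altdef[of r ?n] sum.distrib distrib_right)
qed

lemma mom_smult: "mom p (smult c q) = c * mom p q"
  by (cases "c = 0") (simp_all add: mom_def sum_distrib_left mult.assoc)

lemma mom_minus: "mom p (- q) = - mom p q"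
  using mom_smult[of p "-1" q] by simp

lemma mom_diff: "mom p (q - r) = mom p q - mom p r"
  using mom_add[of p q "- r"] by (simp add: mom_minus)

lemma mom_2: "mom p (2 * q) = 2 * mom p q"
  unfolding mult_2 mom_add ..

lemma mom_monom [simp]: "mom p (monom 1 k) = p k"
  by (simp add: mom_altdef[of _ k] degree_monom_eq sum.remove[of "{..k}" k])

lemma mom_1 [simp]: "mom p 1 = p 0"
  by (simp add: mom_def)

text \<open>Chebyshev polynomials of the first and second kind in the affine variable \<open>y\<close>, the second
  component being shifted by one in the index.\<close>

primrec cheb :: "real poly \<Rightarrow> nat \<Rightarrow> real poly \<times> real poly" where
  "cheb y 0 = (1, 0)"
| "cheb y (Suc n) = (y * fst (cheb y n) - (1 - y * y) * snd (cheb y n), y * snd (cheb y n) + fst (cheb y n))"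

text \<open>For y = cos t the pair is (cos nt, sin nt / sin t), so this is cos^2 + sin^2 = 1. Once 1
  - y^2 is a positive weight, it bounds the functional on the square of the first component.\<close>

lemma cheb_pell:
  "fst (cheb y n) * fst (cheb y n) + (1 - y * y) * (snd (cheb y n) * snd (cheb y n)) = 1"
proof (induction n)
  case (Suc n)
  obtain T V where TV: "cheb y n = (T, V)" by fastforce
  have "(y * T - (1 - y*y) * V) * (y * T - (1 - y*y) * V) + (1 - y*y) * ((y * V + T) * (y * V + T))
        = T * T + (1 - y*y) * (V * V)"
    by algebra
  with Suc TV show ?case by simp
qed auto

lemma cheb_rec: "snd (cheb y (Suc (Suc n))) = 2 * y * snd (cheb y (Suc n)) - snd (cheb y n)"
proof -
  obtain T V where TV: "cheb y n = (T, V)" by fastforce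
  have "y * (y * V + T) + (y * T - (1 - y*y) * V) = 2 * y * (y * V + T) - V" by algebra
  with TV show ?thesis by simp
qed

text \<open>Makes a product of two positive weights positive: when s + t is a positive constant, s t
  q^2 is up to this constant a sum of s times a square and t times a square.\<close>

lemma mult_split_sum:
  fixes s t :: "'b :: comm_ring_1"
  shows "(s + t) * ((s * t) * (q * q)) = s * ((t * q) * (t * q)) + t * ((s * q) * (s * q))"
  by (simp add: algebra_simps)

lemma one_minus_square_mult:
  fixes y q :: "'b :: comm_ring_1"
  shows "(1 - y * y) * (q * q) = q * q - (y * q) * (y * q)"
  by (simp add: algebra_simps)

lemma summable_quadratic_geometric:
  assumes "\<bar>r::real\<bar> < 1"
  shows "summable (\<lambda>n. r ^ n * (1 + (real n + 1)\<^sup>2))"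
proof -
  have 1: "summable (\<lambda>n. diffs (\<lambda>_. 1) n * x ^ n)" if "norm x < 1" for x :: real
    by (rule termdiff_converges[OF that]) (auto simp: summable_geometric)
  have 2: "summable (\<lambda>n. diffs (diffs (\<lambda>_. 1)) n * \<bar>r\<bar> ^ n)"
    by (rule termdiff_converges[of _ 1]) (use assms 1 in auto)
  show ?thesis
  proof (rule summable_comparison_test'[OF 2, of 0])
    fix n :: nat
    have "1 + (real n + 1)\<^sup>2 \<le> (real n + 1) * (real n + 2)" by (simp add: power2_eq_square algebra_simps)
    then have "(1 + (real n + 1)\<^sup>2) * \<bar>r\<bar>^n \<le> (real n + 1) * (real n + 2) * \<bar>r\<bar>^n"
      by (rule mult_right_mono) simp
    then show "norm (r ^ n * (1 + (real n + 1)\<^sup>2)) \<le> diffs (diffs (\<lambda>_. 1)) n * \<bar>r\<bar> ^ n"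
      by (simp add: diffs_def abs_mult power_abs mult_ac add_ac)
  qed
qed

text \<open>The positivity conditions satisfied by the moments of a positive measure on [a, 1]; they
  stand in for the measure.\<close>

locale moment_seq =
  fixes p :: "nat \<Rightarrow> real" and a :: real
  assumes a: "-1 \<le> a" "a < 1"
  and pos: "\<And>q. mom p (q * q) \<ge> 0"
  and pos_upper: "\<And>q. mom p ([:1, -1:] * (q * q)) \<ge> 0"
  and pos_lower: "\<And>q. mom p ([:-a, 1:] * (q * q)) \<ge> 0"
begin

text \<open>Half length and midpoint of [a, 1]; \<open>y\<close> is the affine polynomial that
  carries [a, 1] onto [-1, 1].\<close>

definition h where "h = (1 - a) / 2"
definition m where "m = (1 + a) / 2"
definition y where "y = [:- m / h, 1 / h:]"

lemma h_pos: "h > 0" using a by (simp add: h_def)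

lemma smult_const: "smult c q = [:c:] * q" for c :: real by simp

text \<open>1 + x is x - a plus the nonnegative constant 1 + a, and (1 - x) + (1 + x) = 2, so
  \<open>mult_split_sum\<close> applies. It is needed to compare even moments, which concerns the
  interval [-1, 1] whatever \<open>a\<close> is.\<close>

lemma pos_unit: "mom p (([:1, -1:] * [:1,1:]) * (q * q)) \<ge> 0"
proof -
  have low: "mom p ([:1, 1:] * (r * r)) \<ge> 0" for r
  proof -
    have "[:1, 1:] * (r * r) = [:-a, 1:] * (r * r) + smult (1 + a) (r * r)"
      unfolding smult_const distrib_right[symmetric] by simp
    then have "mom p ([:1, 1:] * (r * r)) = mom p ([:-a, 1:] * (r * r)) + (1 + a) * mom p (r * r)"
      by (simp only: mom_add mom_smult)
    then show ?thesis using pos[of r] pos_lower[of r] a by simp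
  qed
  have "smult 2 (([:1, -1:] * [:1,1:]) * (q * q)) =
     [:1,-1:] * (([:1,1:] * q) * ([:1,1:] * q)) + [:1,1:] * (([:1,-1:] * q) * ([:1,-1:] * q))"
  proof -
    have "[:2:] = [:1,-1:] + [:1,1::real:]" by simp
    then show ?thesis unfolding smult_const by (simp only: mult_split_sum)
  qed
  then have "2 * mom p (([:1, -1:] * [:1,1:]) * (q * q)) \<ge> 0"
    by (metis mom_add mom_smult low pos_upper add_nonneg_nonneg)
  then show ?thesis by simp
qed

text \<open>h^2 (1 - y^2) = (1 - x)(x - a), and these two factors add up to the positive constant 1
  - a.\<close>

lemma y_bound: "mom p ((1 - y * y) * (q * q)) \<ge> 0"
proof -
  have e1: "smult (h * h) (1 - y * y) = [:1,-1:] * [:-a,1:]"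
  proof -
    have "smult (h * h) (1 - y * y) = [:h * h - m * m, 2 * m, -1:]"
      using h_pos by (simp add: y_def one_pCons field_simps)
    moreover have "h * h - m * m = - a" "2 * m = 1 + a" by (simp_all add: h_def m_def field_simps)
    ultimately show ?thesis by simp
  qed
  have e2: "[:1 - a:] = [:1,-1:] + [:-a,1:]" by simp
  have "smult (1 - a) (smult (h*h) ((1 - y * y) * (q * q))) = [:1 - a:] * (([:1,-1:] * [:-a,1:]) * (q * q))"
    unfolding e1[symmetric] mult_smult_left smult_const[of "1 - a"] ..
  also have "\<dots> = [:1,-1:] * (([:-a,1:] * q) * ([:-a,1:] * q)) + [:-a,1:] * (([:1,-1:] * q) * ([:1,-1:] * q))"
    unfolding e2 by (rule mult_split_sum)
  finally have "(1 - a) * (h * h * mom p ((1 - y * y) * (q * q))) = 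
      mom p ([:1,-1:] * (([:-a,1:] * q) * ([:-a,1:] * q))) + mom p ([:-a,1:] * (([:1,-1:] * q) * ([:1,-1:] * q)))"
    by (simp only: mom_add[symmetric] mom_smult[symmetric])
  then have "(1 - a) * (h * h * mom p ((1 - y * y) * (q * q))) \<ge> 0"
    using pos_lower[of "[:1,-1:] * q"] pos_upper[of "[:-a,1:] * q"] by linarith
  then show ?thesis using h_pos a
    by (metis diff_gt_0_iff_gt mult_pos_pos zero_le_mult_iff not_less)
qed

lemma cheb_T_bound: "mom p (fst (cheb y n) * fst (cheb y n)) \<le> p 0"
proof -
  have "mom p (fst (cheb y n) * fst (cheb y n)) + mom p ((1 - y * y) * (snd (cheb y n) * snd (cheb y n))) = p 0"
    unfolding mom_add[symmetric] cheb_pell by simp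
  with y_bound[of "snd (cheb y n)"] show ?thesis by linarith
qed

lemma mom_square_add:
  assumes "c > 0"
  shows "mom p ((q + r) * (q + r)) \<le> (1 + 1 / c) * mom p (q * q) + (1 + c) * mom p (r * r)"
proof -
  have "0 \<le> mom p ((q - smult c r) * (q - smult c r))" by (rule pos)
  then have "2 * c * mom p (q * r) \<le> mom p (q * q) + c * c * mom p (r * r)"
    by (simp add: left_diff_distrib right_diff_distrib mom_diff mom_smult mult.commute[of r q])
  then have "2 * mom p (q * r) \<le> 1 / c * mom p (q * q) + c * mom p (r * r)"
    using assms by (simp add: field_simps)
  moreover have "mom p ((q + r) * (q + r)) = mom p (q * q) + 2 * mom p (q * r) + mom p (r * r)"
    by (simp add: distrib_left distrib_right mom_add mom_2 mult.commute[of r q])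
  ultimately show ?thesis by (simp add: algebra_simps)
qed

text \<open>The triangle inequality for the seminorm belonging to the functional: multiplication by
  \<open>y\<close> does not increase it, and each step adds a \<open>T\<close> of norm at most that
  of 1.\<close>

lemma cheb_V_bound: "mom p (snd (cheb y n) * snd (cheb y n)) \<le> (real n)\<^sup>2 * p 0"
proof (induction n)
  case 0
  then show ?case by (simp add: mom_def)
next
  case (Suc n)
  show ?case
  proof (cases "n = 0")
    case True
    then show ?thesis by simp
  next
    case False
    let ?V = "snd (cheb y n)" and ?T = "fst (cheb y n)"
    have "mom p ((1 - y * y) * (?V * ?V)) = mom p (?V * ?V) - mom p ((y * ?V) * (y * ?V))"
      by (simp only: one_minus_square_mult mom_diff)
    with y_bound[of ?V] have "mom p ((y * ?V) * (y * ?V)) \<le> mom p (?V * ?V)" by simp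
    also note Suc
    finally have "(1 + 1 / real n) * mom p ((y * ?V) * (y * ?V)) \<le> (1 + 1 / real n) * ((real n)\<^sup>2 * p 0)"
      by (rule mult_left_mono) simp
    moreover have "(1 + real n) * mom p (?T * ?T) \<le> (1 + real n) * p 0"
      by (rule mult_left_mono[OF cheb_T_bound]) simp
    \<comment> \<open>The weight n is the sharp one: (1 + 1/n) n^2 + (1 + n) = (n + 1)^2.\<close>
    moreover have "mom p ((y * ?V + ?T) * (y * ?V + ?T)) \<le>
        (1 + 1 / real n) * mom p ((y * ?V) * (y * ?V)) + (1 + real n) * mom p (?T * ?T)"
      using mom_square_add[of "real n" "y * ?V" ?T] False by simp
    ultimately have "mom p ((y * ?V + ?T) * (y * ?V + ?T)) \<le>
        (1 + 1 / real n) * ((real n)\<^sup>2 * p 0) + (1 + real n) * p 0" by linarith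
    also have "\<dots> = ((1 + 1 / real n) * (real n)\<^sup>2) * p 0 + (1 + real n) * p 0" by (simp only: mult.assoc)
    also have "(1 + 1 / real n) * (real n)\<^sup>2 = (real n)\<^sup>2 + real n"
      using False by (simp add: field_simps power2_eq_square)
    also have "((real n)\<^sup>2 + real n) * p 0 + (1 + real n) * p 0 = (real (Suc n))\<^sup>2 * p 0"
      by (simp add: power2_eq_square algebra_simps)
    finally show ?thesis by simp
  qed
qed

lemma monom_Suc_square: "monom 1 (Suc k) * monom 1 (Suc k) = monom (1::real) k * monom 1 k - ([:1,-1:] * [:1,1:]) * (monom 1 k * monom 1 k)"
proof -
  have "monom (1::real) (Suc k) = [:0,1:] * monom 1 k" by (simp add: monom_Suc)
  moreover have "([:0,1:] * q) * ([:0,1:] * q) = q * q - ([:1,-1:] * [:1,1:]) * (q * q)" for q :: "real poly"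
  proof -
    have e: "[:1,-1:] * [:1,1:] = 1 - [:0,1:] * [:0,1::real:]" by (simp add: one_pCons)
    show ?thesis unfolding e one_minus_square_mult by simp
  qed
  ultimately show ?thesis by simp
qed

lemma monom_bound: "mom p (monom 1 k * monom 1 k) \<le> p 0"
proof (induction k)
  case (Suc k)
  then show ?case using pos_unit[of "monom 1 k"] unfolding monom_Suc_square mom_diff by linarith
qed (simp add: mom_def monom_0)

text \<open>The functional on x^k U_n(y), where U_n is the Chebyshev polynomial of the second kind.
  The power x^k is carried along so that the remainders of the geometric series of 1 / (1 - z x)
  have the same form.\<close>

definition c :: "nat \<Rightarrow> nat \<Rightarrow> real" where
  "c k n = mom p (monom 1 k * snd (cheb y (Suc n)))"

lemma abs_mom_mult_le: "2 * \<bar>mom p (q * r)\<bar> \<le> mom p (q * q) + mom p (r * r)"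
proof -
  have "0 \<le> mom p ((q - r) * (q - r))" "0 \<le> mom p ((q + r) * (q + r))" by (rule pos)+
  then show ?thesis
    by (simp add: left_diff_distrib right_diff_distrib distrib_left distrib_right mom_add mom_diff mom_2 mult.commute[of r q])
qed

lemma c_bound: "\<bar>c k n\<bar> \<le> p 0 * (1 + (real n + 1)\<^sup>2)"
  using abs_mom_mult_le[of "monom 1 k" "snd (cheb y (Suc n))"] monom_bound[of k] cheb_V_bound[of "Suc n"]
  by (simp add: c_def algebra_simps del: cheb.simps)

lemma c_0: "c k 0 = p k"
  by (simp add: c_def)

lemma y_eq: "[:h:] * y = [:0,1:] - [:m:]"
  using h_pos by (simp add: y_def)

lemma c_step: "h * mom p (monom 1 k * (2 * y * q)) = 2 * (mom p (monom 1 (Suc k) * q) - m * mom p (monom 1 k * q))"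
proof -
  have "smult h (monom 1 k * (2 * y * q)) = 2 * (([:h:] * y) * (monom 1 k * q))"
    unfolding smult_const by (simp only: mult.assoc mult.left_commute)
  also have "\<dots> = 2 * (monom 1 (Suc k) * q - smult m (monom 1 k * q))"
    unfolding y_eq left_diff_distrib smult_const by (simp add: monom_Suc)
  finally have "mom p (smult h (monom 1 k * (2 * y * q))) = mom p (2 * (monom 1 (Suc k) * q - smult m (monom 1 k * q)))"
    by simp
  then show ?thesis by (simp only: mom_smult mom_diff mult_2 mom_add) 
qed

lemma c_1: "h * c k 1 = 2 * (c (Suc k) 0 - m * c k 0)"
proof -
  have "snd (cheb y (Suc 1)) = 2 * y * 1" by (simp flip: mult_2)
  then show ?thesis using c_step[of k 1] by (simp add: c_def del: cheb.simps(2)) simp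
qed

lemma c_rec: "h * (c k (Suc (Suc n)) + c k n) = 2 * (c (Suc k) (Suc n) - m * c k (Suc n))"
  using c_step[of k "snd (cheb y (Suc (Suc n)))"]
  unfolding c_def cheb_rec[of _ "Suc n"] right_diff_distrib mom_diff by simp


lemma cheb_moment_summable:
  assumes "norm (\<zeta>::complex) < 1"
  shows "summable (\<lambda>n. complex_of_real (c k n) * \<zeta> ^ n)"
proof -
  have "summable (\<lambda>n. (norm \<zeta>) ^ n * (1 + (real n + 1)\<^sup>2))"
    using assms by (intro summable_quadratic_geometric) simp
  then have "summable (\<lambda>n. p 0 * ((norm \<zeta>) ^ n * (1 + (real n + 1)\<^sup>2)))"
    by (rule summable_mult)
  then show ?thesis
  proof (rule summable_comparison_test')
    show "norm (complex_of_real (c k n) * \<zeta> ^ n) \<le> p 0 * ((norm \<zeta>) ^ n * (1 + (real n + 1)\<^sup>2))" if "n \<ge> 0" for n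
      using mult_left_mono[OF c_bound[of k n], of "norm \<zeta> ^ n"]
      by (simp add: norm_mult norm_power mult_ac)
  qed
qed

text \<open>As the sum of U_n(y) \<zeta>^n is 1 / (1 - 2 y \<zeta> + \<zeta>^2), this plays the role
  of the functional applied to x^k / (1 - 2 y \<zeta> + \<zeta>^2).\<close>

definition cheb_series :: "nat \<Rightarrow> complex \<Rightarrow> complex" where
  "cheb_series k \<zeta> = (\<Sum>n. complex_of_real (c k n) * \<zeta> ^ n)"

lemma cheb_series_sums: "norm \<zeta> < 1 \<Longrightarrow> (\<lambda>n. complex_of_real (c k n) * \<zeta> ^ n) sums cheb_series k \<zeta>"
  unfolding cheb_series_def by (rule summable_sums[OF cheb_moment_summable])

text \<open>The point is uniformity in \<open>k\<close>, which comes from the even moments never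
  exceeding \<open>p 0\<close>; it lets the remainder of the geometric series tend to zero.\<close>

lemma cheb_series_bounded:
  assumes "norm \<zeta> < 1"
  shows "\<exists>B. \<forall>k. norm (cheb_series k \<zeta>) \<le> B"
proof -
  have s: "summable (\<lambda>n. p 0 * ((norm \<zeta>) ^ n * (1 + (real n + 1)\<^sup>2)))"
    using assms by (intro summable_mult summable_quadratic_geometric) simp
  have "norm (cheb_series k \<zeta>) \<le> (\<Sum>n. p 0 * ((norm \<zeta>) ^ n * (1 + (real n + 1)\<^sup>2)))" for k
    unfolding cheb_series_def
  proof (rule norm_suminf_le[OF _ s])
    show "norm (complex_of_real (c k n) * \<zeta> ^ n) \<le> p 0 * ((norm \<zeta>) ^ n * (1 + (real n + 1)\<^sup>2))" for n
      using mult_left_mono[OF c_bound[of k n], of "norm \<zeta> ^ n"]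
      by (simp add: norm_mult norm_power mult_ac)
  qed
  then show ?thesis by blast
qed

text \<open>Multiplying the generating function by its denominator 1 - 2 y \<zeta> + \<zeta>^2
  leaves x^k. The factor y is then removed by h y = x - m, which raises \<open>k\<close> by
  one.\<close>

lemma cheb_series_rec:
  assumes "norm \<zeta> < 1"
  shows "complex_of_real h * (1 + \<zeta>\<^sup>2) * cheb_series k \<zeta> = complex_of_real h * complex_of_real (p k) + 2 * \<zeta> * (cheb_series (Suc k) \<zeta> - complex_of_real m * cheb_series k \<zeta>)"
proof -
  let ?f = "\<lambda>k n. complex_of_real (c k n) * \<zeta> ^ n"
  note S = cheb_series_sums[OF assms]
  have s1: "(\<lambda>n. ?f k (Suc n)) sums (cheb_series k \<zeta> - p k)"
    using S[of k] by (subst sums_Suc_iff) (simp add: c_0)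
  have s2: "(\<lambda>n. ?f k (Suc (Suc n))) sums (cheb_series k \<zeta> - p k - c k 1 * \<zeta>)"
    using s1 by (subst sums_Suc_iff) simp
  have "(\<lambda>n. h * (?f k (Suc (Suc n)) + \<zeta>\<^sup>2 * ?f k n)) sums (h * (cheb_series k \<zeta> - p k - c k 1 * \<zeta> + \<zeta>\<^sup>2 * cheb_series k \<zeta>))"
    by (intro sums_mult sums_add s2 S)
  moreover have "h * (?f k (Suc (Suc n)) + \<zeta>\<^sup>2 * ?f k n) = (2 * \<zeta>) * (?f (Suc k) (Suc n) - m * ?f k (Suc n))" for n
  proof -
    have "h * (?f k (Suc (Suc n)) + \<zeta>\<^sup>2 * ?f k n) = complex_of_real (h * (c k (Suc (Suc n)) + c k n)) * \<zeta>^n * \<zeta>\<^sup>2"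
      by (simp add: power2_eq_square algebra_simps)
    also have "\<dots> = (2 * \<zeta>) * (?f (Suc k) (Suc n) - m * ?f k (Suc n))"
      unfolding c_rec by (simp add: power2_eq_square algebra_simps)
    finally show ?thesis .
  qed
  moreover have "(\<lambda>n. (2 * \<zeta>) * (?f (Suc k) (Suc n) - m * ?f k (Suc n))) sums
      ((2 * \<zeta>) * ((cheb_series (Suc k) \<zeta> - c (Suc k) 0) - m * (cheb_series k \<zeta> - c k 0)))"
    using S[of k] S[of "Suc k"] by (intro sums_mult sums_diff) (subst sums_Suc_iff, simp)+
  ultimately have "h * (cheb_series k \<zeta> - p k - c k 1 * \<zeta> + \<zeta>\<^sup>2 * cheb_series k \<zeta>) = (2 * \<zeta>) * ((cheb_series (Suc k) \<zeta> - c (Suc k) 0) - m * (cheb_series k \<zeta> - c k 0))"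
    by (simp add: sums_unique2)
  moreover have "complex_of_real (h * c k 1) = 2 * (complex_of_real (c (Suc k) 0) - m * complex_of_real (c k 0))"
    unfolding c_1 by simp
  then have "2 * complex_of_real (c (Suc k) 0) = h * complex_of_real (c k 1) + 2 * complex_of_real m * complex_of_real (c k 0)"
    by simp
  ultimately show ?thesis
    unfolding c_0 by algebra
qed

definition resolvent_dom where "resolvent_dom = {z::complex. \<forall>t::real. a \<le> t \<longrightarrow> t \<le> 1 \<longrightarrow> 1 - z * t \<noteq> 0}"

text \<open>For x = m + h y one has 1 - z x = (1 - z m)(1 - w y) with w the
  \<open>affine_arg\<close>, and 1 - w y = (1 - 2 \<zeta> y + \<zeta>^2) / (1 + \<zeta>^2) with
  \<zeta> the \<open>disc_arg\<close>. So \<open>resolvent_ext\<close> represents the functional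
  applied to 1 / (1 - z x).\<close>

definition affine_arg :: "complex \<Rightarrow> complex" where "affine_arg z = z * h / (1 - z * m)"
definition disc_arg :: "complex \<Rightarrow> complex" where "disc_arg z = affine_arg z / (1 + csqrt (1 - (affine_arg z)\<^sup>2))"
definition resolvent_ext :: "complex \<Rightarrow> complex" where "resolvent_ext z = (1 + (disc_arg z)\<^sup>2) / (1 - z * m) * cheb_series 0 (disc_arg z)"

lemma resolvent_dom_m: "z \<in> resolvent_dom \<Longrightarrow> 1 - z * m \<noteq> 0"
  using a unfolding resolvent_dom_def by (auto dest!: spec[of _ m] simp: m_def)

lemma resolvent_dom_affine_arg:
  assumes "z \<in> resolvent_dom" "-1 \<le> t" "t \<le> 1"
  shows "1 - affine_arg z * complex_of_real t \<noteq> 0"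
proof -
  have "a \<le> m + h * t" "m + h * t \<le> 1"
    using mult_left_mono[OF assms(2), of h] mult_left_mono[OF assms(3), of h] h_pos by (simp_all add: m_def h_def field_simps)
  then have "1 - z * complex_of_real (m + h * t) \<noteq> 0" using assms(1) unfolding resolvent_dom_def by blast
  moreover have "(1 - z * m) * (1 - affine_arg z * complex_of_real t) = 1 - z * complex_of_real (m + h * t)"
  proof -
    have "(1 - z * m) * affine_arg z = z * h" using resolvent_dom_m[OF assms(1)] by (simp add: affine_arg_def)
    then have "(1 - z * m) * (affine_arg z * t) = z * h * t" by (metis mult.assoc)
    then show ?thesis by (simp add: right_diff_distrib distrib_left mult.assoc)
  qed
  ultimately show ?thesis by auto
qed

lemma resolvent_ext_holomorphic: "resolvent_ext holomorphic_on resolvent_dom"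
proof -
  have affine_arg: "affine_arg holomorphic_on resolvent_dom" unfolding affine_arg_def using resolvent_dom_m by (intro holomorphic_intros) auto
  have disc_arg: "disc_arg holomorphic_on resolvent_dom" unfolding disc_arg_def
    using half_joukowski(1,2)[OF resolvent_dom_affine_arg] by (intro holomorphic_intros affine_arg) auto
  have "(\<lambda>\<zeta>. cheb_series 0 \<zeta>) holomorphic_on ball 0 1"
  proof (rule power_series_holomorphic)
    show "(\<lambda>n. complex_of_real (c 0 n) * (w - 0) ^ n) sums cheb_series 0 w" if "w \<in> ball 0 1" for w
      using cheb_series_sums[of w 0] that by simp
  qed
  moreover have "disc_arg ` resolvent_dom \<subseteq> ball 0 1"
    using half_joukowski(3)[OF resolvent_dom_affine_arg] by (auto simp: disc_arg_def)
  ultimately have "(\<lambda>z. cheb_series 0 (disc_arg z)) holomorphic_on resolvent_dom"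
    using holomorphic_on_compose_gen[OF disc_arg, of "cheb_series 0"] by (simp add: o_def)
  then show ?thesis unfolding resolvent_ext_def using resolvent_dom_m by (intro holomorphic_intros disc_arg) auto
qed

lemma disc_resolvent_dom: "norm z < 1 \<Longrightarrow> z \<in> resolvent_dom"
proof -
  assume z: "norm z < 1"
  have "norm (z * complex_of_real t) < 1" if "a \<le> t" "t \<le> 1" for t
  proof -
    have "norm (z * complex_of_real t) \<le> norm z * 1"
      unfolding norm_mult using that a by (intro mult_left_mono) auto
    with z show ?thesis by simp
  qed
  then show "z \<in> resolvent_dom" unfolding resolvent_dom_def by fastforce
qed

lemma resolvent_ext_sums:
  assumes z: "norm z < 1"
  shows "(\<lambda>n. complex_of_real (p n) * z ^ n) sums resolvent_ext z"
proof -
  note d = disc_resolvent_dom[OF z]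
  define \<zeta> where "\<zeta> = disc_arg z"
  have \<zeta>: "norm \<zeta> < 1" "affine_arg z * (1 + \<zeta>\<^sup>2) = 2 * \<zeta>"
    using half_joukowski(3,4)[OF resolvent_dom_affine_arg[OF d]] by (simp_all add: disc_arg_def \<zeta>_def)
  define D where "D = (1 + \<zeta>\<^sup>2) / (1 - z * m)"
  have zD: "z * complex_of_real h * D = 2 * \<zeta>"
    using \<zeta>(2) by (simp add: D_def affine_arg_def)
  have "complex_of_real h * D * (1 - z * m) = complex_of_real h * (1 + \<zeta>\<^sup>2)"
    using resolvent_dom_m[OF d] by (simp add: D_def)
  then have hD: "complex_of_real h * D = complex_of_real h * (1 + \<zeta>\<^sup>2) + 2 * \<zeta> * m"
    using zD by algebra
  have rec: "D * cheb_series k \<zeta> = p k + z * (D * cheb_series (Suc k) \<zeta>)" for k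
  proof -
    have "complex_of_real h * (D * cheb_series k \<zeta>) = complex_of_real h * (p k + z * (D * cheb_series (Suc k) \<zeta>))"
      using cheb_series_rec[OF \<zeta>(1), of k] hD zD by algebra
    then show ?thesis using h_pos by simp
  qed
  \<comment> \<open>The identity 1 / (1 - z x) = 1 + z x / (1 - z x), iterated n times.\<close>
  have part: "D * cheb_series 0 \<zeta> = (\<Sum>i<n. complex_of_real (p i) * z ^ i) + z ^ n * (D * cheb_series n \<zeta>)" for n
  proof (induction n)
    case (Suc n)
    then show ?case using rec[of n] by (simp add: algebra_simps)
  qed simp
  obtain B where B: "\<And>k. norm (cheb_series k \<zeta>) \<le> B" using cheb_series_bounded[OF \<zeta>(1)] by blast
  have "(\<lambda>n. z ^ n * (D * cheb_series n \<zeta>)) \<longlonglongrightarrow> 0"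
  proof (rule Lim_null_comparison)
    show "\<forall>\<^sub>F n in sequentially. norm (z ^ n * (D * cheb_series n \<zeta>)) \<le> norm z ^ n * (norm D * B)"
      using B by (auto simp: norm_mult norm_power intro!: mult_left_mono always_eventually)
    show "(\<lambda>n. norm z ^ n * (norm D * B)) \<longlonglongrightarrow> 0"
      using z by (intro tendsto_mult_left_zero LIMSEQ_power_zero) simp
  qed
  then have "(\<lambda>n. D * cheb_series 0 \<zeta> - z ^ n * (D * cheb_series n \<zeta>)) \<longlonglongrightarrow> D * cheb_series 0 \<zeta> - 0"
    by (intro tendsto_intros)
  moreover have "(\<lambda>n. D * cheb_series 0 \<zeta> - z ^ n * (D * cheb_series n \<zeta>)) = (\<lambda>n. \<Sum>i<n. complex_of_real (p i) * z ^ i)"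
    using part by (auto simp: algebra_simps)
  moreover have "resolvent_ext z = D * cheb_series 0 \<zeta>" by (simp add: resolvent_ext_def D_def \<zeta>_def)
  ultimately show ?thesis unfolding sums_def by simp
qed

end

lemma powr_le_scaled:
  fixes x y c e :: real
  assumes "0 < x" "x \<le> c * y" "y \<le> c * x" "c \<ge> 1"
  shows "x powr e \<le> c powr \<bar>e\<bar> * y powr e"
proof -
  have y: "y > 0" using assms by (smt (verit) mult_nonneg_nonpos)
  show ?thesis
  proof (cases "e \<ge> 0")
    case True
    have "x powr e \<le> (c * y) powr e" using assms True by (intro powr_mono2) auto
    then show ?thesis using True y assms by (simp add: powr_mult)
  next
    case False
    have "x powr e = (c powr (-e) * (c powr e)) * x powr e" using assms by (simp flip: powr_add)
    also have "\<dots> = c powr (-e) * (c * x) powr e" using assms by (simp add: powr_mult)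
    also have "\<dots> \<le> c powr (-e) * y powr e"
      using assms False y by (intro mult_left_mono powr_mono2') auto
    finally show ?thesis using False by simp
  qed
qed

subsection \<open>Transfer of singular bounds to Taylor coefficients\<close>

text \<open>On the circle the conjugate of u is r^2 / u, so |1 - e u|^2 is the rational function (1
  - e u)(u - e r^2) / u there, and Cauchy's formula at e r^2 evaluates the integral.\<close>

lemma poisson_integral:
  assumes e: "e = 1 \<or> e = (-1::complex)" and r: "0 < r" "r < 1"
  shows "((\<lambda>t. 1 / (cmod (1 - e * circlepath 0 r t))\<^sup>2) has_integral 1 / (1 - r\<^sup>2)) {0..1}"
proof -
  have ee: "e * e = 1" "cnj e = e" "cmod e = 1" using e by auto
  have nz: "1 - e * u \<noteq> 0" if "cmod u \<le> r" for u
  proof -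
    have "cmod (e * u) < 1" using that r ee by (simp add: norm_mult)
    then show ?thesis by (metis norm_one right_minus_eq less_irrefl)
  qed
  have hol: "(\<lambda>u. 1 / (1 - e * u)) holomorphic_on cball 0 r"
    using nz by (intro holomorphic_intros) auto
  have "((\<lambda>u. (1 / (1 - e * u)) / (u - e * r\<^sup>2)) has_contour_integral (2 * of_real pi * \<i> * (1 / (1 - e * (e * r\<^sup>2))))) (circlepath 0 r)"
  proof (rule Cauchy_integral_circlepath)
    show "cmod (e * r\<^sup>2 - 0) < r" using r ee by (simp add: norm_mult norm_power power2_eq_square)
  qed (use hol in \<open>auto intro: holomorphic_on_imp_continuous_on holomorphic_on_subset\<close>)
  then have 1: "((\<lambda>t. (1 / (1 - e * circlepath 0 r t)) / (circlepath 0 r t - e * r\<^sup>2) * vector_derivative (circlepath 0 r) (at t))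
      has_integral (2 * of_real pi * \<i> * (1 / (1 - r\<^sup>2)))) {0..1}"
    unfolding has_contour_integral mult.assoc[symmetric, of e e] ee mult_1_left by simp
  have eq: "(1 / (1 - e * circlepath 0 r t)) / (circlepath 0 r t - e * r\<^sup>2) * vector_derivative (circlepath 0 r) (at t)
     = (2 * of_real pi * \<i>) * of_real (1 / (cmod (1 - e * circlepath 0 r t))\<^sup>2)" for t
  proof -
    define g where "g = circlepath 0 r t"
    have g: "cmod g = r" "vector_derivative (circlepath 0 r) (at t) = 2 * of_real pi * \<i> * g"
      using r by (simp_all add: g_def vector_derivative_circlepath) (simp_all add: circlepath norm_mult)
    have gg: "g * cnj g = of_real (r\<^sup>2)" using g(1) complex_norm_square[of g] by simp
    have gn: "g \<noteq> 0" using g r by auto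
    have "g - e * r\<^sup>2 = g * cnj (1 - e * g)"
      using gg ee by (simp add: algebra_simps flip: gg)
    then have "(1 / (1 - e * g)) / (g - e * r\<^sup>2) * (2 * of_real pi * \<i> * g) =
        (2 * of_real pi * \<i>) * (1 / ((1 - e * g) * cnj (1 - e * g)))"
      using gn by simp
    also have "(1 - e * g) * cnj (1 - e * g) = of_real ((cmod (1 - e * g))\<^sup>2)"
      using complex_norm_square[of "1 - e * g"] by simp
    finally show ?thesis using g(2) by (simp add: g_def)
  qed
  have "((\<lambda>t. (2 * of_real pi * \<i>) * of_real (1 / (cmod (1 - e * circlepath 0 r t))\<^sup>2))
      has_integral (2 * of_real pi * \<i> * (1 / (1 - r\<^sup>2)))) {0..1}"
    using 1 unfolding eq .
  from has_integral_mult_right[OF this, of "1 / (2 * of_real pi * \<i>)"]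
  have "((\<lambda>t. complex_of_real (1 / (cmod (1 - e * circlepath 0 r t))\<^sup>2)) has_integral (of_real (1 / (1 - r\<^sup>2)))) {0..1}"
    by simp
  from has_integral_linear[OF this bounded_linear_Re] show ?thesis by (simp add: o_def)
qed

text \<open>Cauchy's coefficient formula with the bound integrated instead of maximised: the kernel
  costs 2 / (1 - r^2), one order less than its maximum on the circle.\<close>

lemma taylor_coeff_circle_bound:
  assumes hol: "H holomorphic_on ball 0 1" and r: "0 < r" "r < 1"
    and bound: "\<And>z. norm z = r \<Longrightarrow> norm (H z) \<le> B * (1 / (norm (1 - z))\<^sup>2 + 1 / (norm (1 + z))\<^sup>2)"
  shows "norm ((deriv ^^ n) H 0 / fact n) * r ^ n \<le> B * (2 / (1 - r\<^sup>2))"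
proof -
  let ?g = "circlepath 0 r"
  have sub: "cball 0 r \<subseteq> ball 0 (1::real)" using r by auto
  have "((\<lambda>u. H u / (u - 0) ^ Suc n) has_contour_integral ((2 * pi * \<i>) / fact n * (deriv ^^ n) H 0)) ?g"
  proof (rule Cauchy_has_contour_integral_higher_derivative_circlepath)
    show "continuous_on (cball 0 r) H"
      using hol r by (intro holomorphic_on_imp_continuous_on) (auto intro: holomorphic_on_subset)
  qed (use hol r in \<open>auto intro: holomorphic_on_subset\<close>)
  then have I: "((\<lambda>t. H (?g t) / ?g t ^ Suc n * vector_derivative ?g (at t)) has_integral ((2 * pi * \<i>) / fact n * (deriv ^^ n) H 0)) {0..1}"
    unfolding has_contour_integral by simp
  let ?b = "\<lambda>t. (2 * pi * B / r ^ n) * (1 / (cmod (1 - 1 * ?g t))\<^sup>2 + 1 / (cmod (1 - (- 1) * ?g t))\<^sup>2)"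
  have J: "(?b has_integral ((2 * pi * B / r ^ n) * (1 / (1 - r\<^sup>2) + 1 / (1 - r\<^sup>2)))) {0..1}"
    by (intro has_integral_mult_right has_integral_add poisson_integral r) auto
  have le: "norm (H (?g t) / ?g t ^ Suc n * vector_derivative ?g (at t)) \<le> ?b t" for t
  proof -
    have g: "cmod (?g t) = r" "cmod (vector_derivative ?g (at t)) = 2 * pi * r"
      using r by (simp_all add: vector_derivative_circlepath norm_mult) (simp add: circlepath norm_mult)
    have "norm (H (?g t) / ?g t ^ Suc n * vector_derivative ?g (at t)) = norm (H (?g t)) * (2 * pi / r ^ n)"
      using r by (simp add: norm_mult norm_divide norm_power g)
    also have "\<dots> \<le> (B * (1 / (norm (1 - ?g t))\<^sup>2 + 1 / (norm (1 + ?g t))\<^sup>2)) * (2 * pi / r ^ n)"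
      by (rule mult_right_mono[OF bound]) (use g r in auto)
    finally show ?thesis by (simp add: mult_ac)
  qed
  have "norm (integral {0..1} (\<lambda>t. H (?g t) / ?g t ^ Suc n * vector_derivative ?g (at t))) \<le> integral {0..1} ?b"
    by (rule integral_norm_bound_integral) (use I J le in \<open>auto simp: has_integral_iff\<close>)
  then have "norm ((2 * pi * \<i>) / fact n * (deriv ^^ n) H 0) \<le> (2 * pi * B / r ^ n) * (1 / (1 - r\<^sup>2) + 1 / (1 - r\<^sup>2))"
    unfolding integral_unique[OF I] integral_unique[OF J] .
  then have "2 * pi * norm ((deriv ^^ n) H 0 / fact n) \<le> 2 * pi * (B / r ^ n * (2 / (1 - r\<^sup>2)))"
    by (simp add: norm_mult norm_divide)
  then have "norm ((deriv ^^ n) H 0 / fact n) \<le> B / r ^ n * (2 / (1 - r\<^sup>2))"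
    by (rule mult_left_le_imp_le) simp
  then have "norm ((deriv ^^ n) H 0 / fact n) * r ^ n \<le> (B / r ^ n * (2 / (1 - r\<^sup>2))) * r ^ n"
    by (rule mult_right_mono) (use r in auto)
  then show ?thesis using r by simp
qed

text \<open>Only the second power gets integrated; the surplus p - 2 is estimated by the distance
  \<open>d\<close> to the singularity, which is where p >= 2 enters.\<close>

lemma powr_minus_le_square:
  fixes x :: real
  assumes "0 < d" "d \<le> x" "p \<ge> 2"
  shows "x powr (-p) \<le> d powr (2 - p) * (1 / x\<^sup>2)"
proof -
  have "x powr (-p) = x powr (2 - p) * x powr (-2)" by (simp flip: powr_add)
  also have "\<dots> \<le> d powr (2 - p) * x powr (-2)"
    using assms by (intro mult_right_mono powr_mono2') auto
  also have "x powr (-2) = 1 / x\<^sup>2" using assms by (simp add: powr_minus divide_inverse)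
  finally show ?thesis .
qed

lemma taylor_coeff_bound:
  assumes hol: "H holomorphic_on ball 0 1" and p: "p \<ge> (2::real)" and K: "K \<ge> 0"
    and bound: "\<And>z. norm z < 1 \<Longrightarrow> norm (H z) \<le> K * (norm (1 - z) powr (-p) + norm (1 + z) powr (-p))"
    and n: "n \<ge> 1"
  shows "norm ((deriv ^^ n) H 0 / fact n) \<le> 2 * exp 1 * K * 2 powr \<bar>p - 1\<bar> * real n powr (p - 1)"
proof -
  \<comment> \<open>Then r = n / (n + 1): the distance to the unit circle is of order 1/n while r^n
    stays above 1/e.\<close>
  define d where "d = 1 / (real n + 1)"
  define r where "r = 1 - d"
  have d: "0 < d" "d < 1" using n by (auto simp: d_def)
  have r: "0 < r" "r < 1" using d by (auto simp: r_def)
  let ?B = "K * d powr (2 - p)"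
  have "norm (H z) \<le> ?B * (1 / (norm (1 - z))\<^sup>2 + 1 / (norm (1 + z))\<^sup>2)" if z: "norm z = r" for z
  proof -
    have a: "d \<le> norm (1 - z)" using norm_triangle_ineq2[of 1 z] z by (simp add: r_def)
    have b: "d \<le> norm (1 + z)" using norm_triangle_ineq2[of 1 "-z"] z by (simp add: r_def)
    have "norm (H z) \<le> K * (norm (1 - z) powr (-p) + norm (1 + z) powr (-p))" using bound z r by simp
    also have "\<dots> \<le> K * (d powr (2 - p) * (1 / (norm (1 - z))\<^sup>2) + d powr (2 - p) * (1 / (norm (1 + z))\<^sup>2))"
      by (intro mult_left_mono add_mono powr_minus_le_square d a b p K)
    finally show ?thesis by (simp add: distrib_left mult_ac)
  qed
  from taylor_coeff_circle_bound[OF hol r this]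
  have "norm ((deriv ^^ n) H 0 / fact n) * r ^ n \<le> ?B * (2 / (1 - r\<^sup>2))" .
  also have "\<dots> \<le> ?B * (2 / d)"
  proof -
    have "d \<le> 1 - r\<^sup>2" using d r by (simp add: r_def power2_eq_square algebra_simps)
    then show ?thesis using d K by (intro mult_left_mono divide_left_mono) auto
  qed
  also have "\<dots> = 2 * K * d powr (1 - p)"
  proof -
    have "d powr (2 - p) / d = d powr (1 - p)"
      using powr_diff[of d "2 - p" 1] d by simp
    then have "2 * K * (d powr (2 - p) / d) = 2 * K * d powr (1 - p)" by simp
    then show ?thesis by (simp add: mult_ac)
  qed
  also have "d powr (1 - p) = (real n + 1) powr (p - 1)"
    unfolding d_def by (simp add: powr_divide powr_minus[symmetric] flip: powr_minus_divide)
  finally have 1: "norm ((deriv ^^ n) H 0 / fact n) * r ^ n \<le> 2 * K * (real n + 1) powr (p - 1)" .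
  have r2: "r ^ n * exp 1 \<ge> 1"
  proof -
    have "inverse r = 1 + 1 / real n" using n by (simp add: r_def d_def field_simps)
    also have "\<dots> \<le> exp (1 / real n)" by (rule exp_ge_add_one_self)
    finally have "inverse r ^ n \<le> exp (1 / real n) ^ n" using r by (intro power_mono) auto
    also have "\<dots> = exp 1" using n by (simp flip: exp_of_nat_mult)
    finally show ?thesis using r by (simp add: power_inverse field_simps)
  qed
  have "norm ((deriv ^^ n) H 0 / fact n) \<le> norm ((deriv ^^ n) H 0 / fact n) * (r ^ n * exp 1)"
    using mult_left_mono[OF r2, of "norm ((deriv ^^ n) H 0 / fact n)"] by simp
  also have "\<dots> = norm ((deriv ^^ n) H 0 / fact n) * r ^ n * exp 1" by simp
  also have "\<dots> \<le> 2 * K * (real n + 1) powr (p - 1) * exp 1"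
    by (rule mult_right_mono[OF 1]) simp
  also have "\<dots> \<le> 2 * K * (2 powr \<bar>p - 1\<bar> * real n powr (p - 1)) * exp 1"
    using n K by (intro mult_right_mono mult_left_mono powr_le_scaled) auto
  finally show ?thesis by (simp add: mult_ac)
qed

section \<open>Growth of derivatives at the two possible singularities 1 and -1\<close>

definition tame_at :: "(complex \<Rightarrow> complex) \<Rightarrow> nat \<Rightarrow> real \<Rightarrow> complex \<Rightarrow> bool" where
  "tame_at R m p e \<longleftrightarrow> (\<exists>K \<rho>. \<rho> > 0 \<and> K \<ge> 0 \<and>
     (\<forall>z. norm z < 1 \<longrightarrow> norm (z - e) < \<rho> \<longrightarrow> norm ((deriv ^^ m) R z) \<le> K * norm (z - e) powr (-p)))"

text \<open>Off the two neighbourhoods the derivative is continuous on a compact set, and |1 - z| <=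
  2 keeps the power above 2^(-p); hence the factor 2^p in the constant.\<close>

lemma derivative_bound_disc:
  assumes hol: "R holomorphic_on U" and U: "open U" "ball 0 1 \<subseteq> U" "cball 0 1 - {1, -1} \<subseteq> U"
    and p: "p \<ge> 0" and t1: "tame_at R m p 1" and t2: "tame_at R m p (-1)"
  shows "\<exists>K\<ge>0. \<forall>z. norm z < 1 \<longrightarrow>
    norm ((deriv ^^ m) R z) \<le> K * (norm (1 - z) powr (-p) + norm (1 + z) powr (-p))"
proof -
  obtain K1 \<rho>1 where 1: "\<rho>1 > 0" "K1 \<ge> 0"
    "\<And>z. norm z < 1 \<Longrightarrow> norm (z - 1) < \<rho>1 \<Longrightarrow> norm ((deriv ^^ m) R z) \<le> K1 * norm (z - 1) powr (-p)"
    using t1 unfolding tame_at_def by blast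
  obtain K2 \<rho>2 where 2: "\<rho>2 > 0" "K2 \<ge> 0"
    "\<And>z. norm z < 1 \<Longrightarrow> norm (z - (-1)) < \<rho>2 \<Longrightarrow> norm ((deriv ^^ m) R z) \<le> K2 * norm (z - (-1)) powr (-p)"
    using t2 unfolding tame_at_def by blast
  let ?S = "cball (0::complex) 1 - ball 1 \<rho>1 - ball (-1) \<rho>2"
  have "compact ?S" by (intro compact_diff compact_cball open_ball)
  moreover have "continuous_on ?S ((deriv ^^ m) R)"
  proof (rule continuous_on_subset)
    show "continuous_on U ((deriv ^^ m) R)"
      by (intro holomorphic_on_imp_continuous_on holomorphic_higher_deriv hol U)
    show "?S \<subseteq> U" using U(3) 1(1) 2(1) by auto
  qed
  ultimately have "bounded ((deriv ^^ m) R ` ?S)" by (intro compact_imp_bounded compact_continuous_image)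
  then obtain B where B: "B > 0" "\<And>z. z \<in> ?S \<Longrightarrow> norm ((deriv ^^ m) R z) \<le> B"
    unfolding bounded_pos by blast
  let ?K = "K1 + K2 + B * 2 powr p"
  have "norm ((deriv ^^ m) R z) \<le> ?K * (norm (1 - z) powr (-p) + norm (1 + z) powr (-p))" if z: "norm z < 1" for z
  proof -
    let ?a = "norm (1 - z) powr (-p)" and ?b = "norm (1 + z) powr (-p)"
    have nn: "?a \<ge> 0" "?b \<ge> 0" by auto
    have BB: "B * 2 powr p \<ge> 0" using B by simp
    consider "norm (z - 1) < \<rho>1" | "norm (z - (-1)) < \<rho>2" | "z \<in> ?S"
      using z by (auto simp: dist_norm norm_minus_commute)
    then show ?thesis
    proof cases
      case c: 1
      then have "norm ((deriv ^^ m) R z) \<le> K1 * ?a" using 1(3)[OF z] by (simp add: norm_minus_commute)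
      also have "\<dots> \<le> ?K * (?a + ?b)" using nn 1(2) 2(2) BB by (intro mult_mono) auto
      finally show ?thesis .
    next
      case c: 2
      then have "norm ((deriv ^^ m) R z) \<le> K2 * ?b" using 2(3)[OF z] by (simp add: add.commute)
      also have "\<dots> \<le> ?K * (?a + ?b)" using nn 1(2) 2(2) BB by (intro mult_mono) auto
      finally show ?thesis .
    next
      case c: 3
      have "norm (1 - z) \<le> 2" using norm_triangle_ineq4[of 1 z] z by simp
      moreover have "norm (1 - z) > 0" using z by auto
      ultimately have "2 powr (-p) \<le> ?a" using p by (intro powr_mono2') auto
      then have "2 powr p * 2 powr (-p) \<le> 2 powr p * ?a" by (rule mult_left_mono) simp
      then have "1 \<le> 2 powr p * ?a" by (simp flip: powr_add)
      then have "B * 1 \<le> B * (2 powr p * ?a)" using B by (intro mult_left_mono) auto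
      also have "\<dots> = (B * 2 powr p) * ?a" by simp
      also have "\<dots> \<le> ?K * (?a + ?b)" using nn 1(2) 2(2) BB by (intro mult_mono) auto
      finally show ?thesis using B(2)[OF c] by linarith
    qed
  qed
  moreover have "?K \<ge> 0" using 1(2) 2(2) B(1) by simp
  ultimately show ?thesis by blast
qed

lemma tame_at_add:
  assumes "f holomorphic_on ball 0 1" "g holomorphic_on ball 0 1" "tame_at f m p e" "tame_at g m p e"
  shows "tame_at (\<lambda>z. f z + g z) m p e"
proof -
  obtain K1 \<rho>1 where 1: "\<rho>1 > 0" "K1 \<ge> 0"
    "\<And>z. norm z < 1 \<Longrightarrow> norm (z - e) < \<rho>1 \<Longrightarrow> norm ((deriv ^^ m) f z) \<le> K1 * norm (z - e) powr (-p)"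
    using assms(3) unfolding tame_at_def by blast
  obtain K2 \<rho>2 where 2: "\<rho>2 > 0" "K2 \<ge> 0"
    "\<And>z. norm z < 1 \<Longrightarrow> norm (z - e) < \<rho>2 \<Longrightarrow> norm ((deriv ^^ m) g z) \<le> K2 * norm (z - e) powr (-p)"
    using assms(4) unfolding tame_at_def by blast
  show ?thesis unfolding tame_at_def
  proof (intro exI conjI allI impI)
    fix z assume z: "norm z < 1" "norm (z - e) < min \<rho>1 \<rho>2"
    have "(deriv ^^ m) (\<lambda>z. f z + g z) z = (deriv ^^ m) f z + (deriv ^^ m) g z"
      by (rule higher_deriv_add[OF assms(1,2)]) (use z in auto)
    then show "norm ((deriv ^^ m) (\<lambda>z. f z + g z) z) \<le> (K1 + K2) * norm (z - e) powr (-p)"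
      using 1(3)[of z] 2(3)[of z] z norm_triangle_ineq[of "(deriv ^^ m) f z" "(deriv ^^ m) g z"]
      unfolding distrib_right by auto
  qed (use 1 2 in auto)
qed

lemma tame_at_cong:
  assumes "f holomorphic_on ball 0 1" "\<And>z. norm z < 1 \<Longrightarrow> f z = g z" "tame_at f m p e"
  shows "tame_at g m p e"
proof -
  have g: "g holomorphic_on ball 0 1" using holomorphic_transform[OF assms(1)] assms(2) by auto
  have "(deriv ^^ m) f z = (deriv ^^ m) g z" if "norm z < 1" for z
    by (rule higher_deriv_transform_within_open[OF assms(1) g]) (use that assms(2) in auto)
  then show ?thesis using assms(3) unfolding tame_at_def by simp
qed

lemma tame_at_reflect:
  assumes "f holomorphic_on ball 0 1" "tame_at f m p e"
  shows "tame_at (\<lambda>z. f (- z)) m p (- e)"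
proof -
  obtain K \<rho> where 1: "\<rho> > 0" "K \<ge> 0"
    "\<And>z. norm z < 1 \<Longrightarrow> norm (z - e) < \<rho> \<Longrightarrow> norm ((deriv ^^ m) f z) \<le> K * norm (z - e) powr (-p)"
    using assms(2) unfolding tame_at_def by blast
  show ?thesis unfolding tame_at_def
  proof (intro exI conjI allI impI)
    fix z assume z: "norm z < 1" "norm (z - - e) < \<rho>"
    have "(deriv ^^ m) (\<lambda>z. f (-1 * z)) z = (-1) ^ m * (deriv ^^ m) f (-1 * z)"
      by (rule higher_deriv_compose_linear[OF assms(1) open_ball[of 0 1] open_ball]) (use z in auto)
    then have "norm ((deriv ^^ m) (\<lambda>z. f (- z)) z) = norm ((deriv ^^ m) f (- z))"
      by (simp add: norm_mult norm_power)
    moreover have "norm (- z - e) = norm (z - - e)"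
    proof -
      have "- z - e = - (z - - e)" by simp
      then show ?thesis by (simp only: norm_minus_cancel)
    qed
    ultimately show "norm ((deriv ^^ m) (\<lambda>z. f (- z)) z) \<le> K * norm (z - - e) powr (-p)"
      using 1(3)[of "- z"] z by simp
  qed (use 1 in auto)
qed

lemma tame_at_holomorphic:
  assumes "f holomorphic_on ball e \<rho>" "\<rho> > 0" "p \<ge> 0" "norm e = 1"
  shows "tame_at f m p e"
proof -
  define r where "r = min (\<rho> / 2) 1"
  have r: "r > 0" "r < \<rho>" "r \<le> 1" using assms by (auto simp: r_def min_def)
  have "continuous_on (cball e r) ((deriv ^^ m) f)"
    using r by (intro holomorphic_on_imp_continuous_on holomorphic_on_subset[OF holomorphic_higher_deriv[OF assms(1) open_ball]]) auto
  then have "bounded ((deriv ^^ m) f ` cball e r)" by (intro compact_imp_bounded compact_continuous_image) auto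
  then obtain B where B: "B > 0" "\<And>z. z \<in> cball e r \<Longrightarrow> norm ((deriv ^^ m) f z) \<le> B"
    unfolding bounded_pos by blast
  show ?thesis unfolding tame_at_def
  proof (intro exI conjI allI impI)
    fix z assume z: "norm z < 1" "norm (z - e) < r"
    have "z \<noteq> e" using z assms(4) by auto
    then have "1 powr (-p) \<le> norm (z - e) powr (-p)"
      using z r assms by (intro powr_mono2') auto
    then have "B * 1 \<le> B * norm (z - e) powr (-p)" using B by (intro mult_left_mono) auto
    moreover have "norm ((deriv ^^ m) f z) \<le> B" using B(2)[of z] z by (simp add: dist_norm norm_minus_commute)
    ultimately show "norm ((deriv ^^ m) f z) \<le> B * norm (z - e) powr (-p)" by linarith
  qed (use r B in auto)
qed

lemma in_sector_120:
  assumes "w \<noteq> 0" "Re w > - (cmod w / 2)"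
  shows "\<bar>Arg w\<bar> < 2 * pi / 3"
proof (rule ccontr)
  assume "\<not> \<bar>Arg w\<bar> < 2 * pi / 3"
  then have "cos \<bar>Arg w\<bar> \<le> cos (2 * pi / 3)"
    using Arg_bounded[of w] by (intro cos_monotone_0_pi_le) auto
  then have "cos (Arg w) \<le> - 1/2" using cos_120 by simp
  moreover have "cos (Arg w) = Re w / cmod w" using assms by (simp add: cos_Arg)
  ultimately have "Re w / cmod w \<le> - (1/2)" by simp
  then have "Re w \<le> - (1/2) * cmod w" using assms by (simp add: pos_divide_le_eq)
  with assms show False by simp
qed

text \<open>Cauchy's inequality on a disc about \<open>z\<close> with radius proportional to |z - 1|
  costs one power of |z - 1| per derivative. Such discs stick out of the unit disc, so the bound on
  \<open>R\<close> has to hold in a sector reaching beyond it.\<close>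

lemma tame_at_sector:
  assumes hol: "R holomorphic_on U" and U: "open U" "sector (2 * pi / 3) 1 \<rho> \<subseteq> U" and \<rho>: "\<rho> > 0"
    and bound: "\<And>z. z \<in> sector (2 * pi / 3) 1 \<rho> \<Longrightarrow> norm (R z) \<le> K * norm (z - 1) powr \<gamma>"
  shows "tame_at R m (real m - \<gamma>) 1"
proof -
  define K' where "K' = fact m * (\<bar>K\<bar> * 2 powr \<bar>\<gamma>\<bar>) * 4 ^ m"
  have main: "norm ((deriv ^^ m) R z) \<le> K' * norm (z - 1) powr (- (real m - \<gamma>))"
    if z: "norm z < 1" "norm (z - 1) < \<rho> / 2" for z
  proof -
    define d where "d = norm (z - 1)"
    have d: "d > 0" using z by (auto simp: d_def)
    have Rez: "Re (1 - z) > 0" using z complex_Re_le_cmod[of z] by simp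
    \<comment> \<open>Radius d/4 is small enough: |1 - u| >= 3d/4 and Re (1 - u) > -d/4 give Re (1 -
      u) > -|1 - u| / 2, an angle below 2 pi / 3.\<close>
    have sec: "u \<in> sector (2 * pi / 3) 1 \<rho>" "norm (u - 1) \<le> 2 * d" "d \<le> 2 * norm (u - 1)"
      if u: "norm (z - u) \<le> d / 4" for u
    proof -
      have a: "norm (u - 1) \<le> d + d / 4" using norm_triangle_ineq[of "u - z" "z - 1"] u by (simp add: d_def norm_minus_commute)
      have b: "norm (1 - u) \<ge> d - d / 4" using norm_triangle_ineq[of "z - u" "u - 1"] u by (simp add: d_def norm_minus_commute)
      have "Re (1 - u) = Re (1 - z) + Re (z - u)" by simp
      then have c: "Re (1 - u) > - (d / 4)" using Rez u abs_Re_le_cmod[of "z - u"] by linarith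
      have "\<bar>Arg (1 - u)\<bar> < 2 * pi / 3"
        by (rule in_sector_120) (use b c d in auto)
      moreover have "norm (u - 1) < \<rho>" using a d z(2) unfolding d_def[symmetric] by linarith
      moreover have "u \<noteq> 1" using b d by auto
      ultimately show "u \<in> sector (2 * pi / 3) 1 \<rho>" by (simp add: sector_def)
      show "norm (u - 1) \<le> 2 * d" "d \<le> 2 * norm (u - 1)" using a b d by (auto simp: norm_minus_commute)
    qed
    have sub: "cball z (d / 4) \<subseteq> U" using sec(1) U(2) by (auto simp: dist_norm)
    have "norm ((deriv ^^ m) R z) \<le> fact m * (\<bar>K\<bar> * (2 powr \<bar>\<gamma>\<bar> * d powr \<gamma>)) / (d / 4) ^ m"
    proof (rule Cauchy_inequality)
      show "R holomorphic_on ball z (d / 4)" using sub ball_subset_cball by (blast intro: holomorphic_on_subset[OF hol])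
      show "continuous_on (cball z (d / 4)) R" by (intro holomorphic_on_imp_continuous_on holomorphic_on_subset[OF hol] sub)
      show "d / 4 > 0" using d by simp
      fix x assume "norm (z - x) = d / 4"
      then have x: "norm (z - x) \<le> d / 4" by simp
      have pos: "norm (x - 1) > 0" using sec(3)[OF x] d by linarith
      have "norm (R x) \<le> K * norm (x - 1) powr \<gamma>" by (rule bound[OF sec(1)[OF x]])
      also have "\<dots> \<le> \<bar>K\<bar> * norm (x - 1) powr \<gamma>" by (rule mult_right_mono) auto
      also have "\<dots> \<le> \<bar>K\<bar> * (2 powr \<bar>\<gamma>\<bar> * d powr \<gamma>)"
        using sec(2,3)[OF x] pos by (intro mult_left_mono powr_le_scaled) auto
      finally show "norm (R x) \<le> \<bar>K\<bar> * (2 powr \<bar>\<gamma>\<bar> * d powr \<gamma>)" .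
    qed
    also have "\<dots> = K' * (d powr \<gamma> / d ^ m)" using d by (simp add: K'_def field_simps power_divide)
    also have "d powr \<gamma> / d ^ m = d powr (- (real m - \<gamma>))"
      using d by (simp add: powr_diff powr_realpow)
    finally show ?thesis by (simp add: d_def)
  qed
  have "K' \<ge> 0" by (simp add: K'_def)
  with main \<rho> show ?thesis unfolding tame_at_def by (intro exI[of _ K'] exI[of _ "\<rho> / 2"] conjI allI impI) auto
qed

text \<open>The coefficient of z^(N - m) in the m-th derivative is N! / (N - m)! times that of z^N
  in \<open>R\<close>. The former is of order N^(m - \<gamma> - 1), and dividing by a factor of
  order N^m leaves N^(-\<gamma> - 1).\<close>

theorem big_O_transfer:
  assumes hol: "R holomorphic_on U" and U: "open U" "ball 0 1 \<subseteq> U" "cball 0 1 - {1, -1} \<subseteq> U"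
    and m: "real m - \<gamma> \<ge> 2"
    and t: "tame_at R m (real m - \<gamma>) 1" "tame_at R m (real m - \<gamma>) (-1)"
  shows "\<exists>C. \<forall>n\<ge>1. norm ((deriv ^^ n) R 0 / fact n) \<le> C * real n powr (-\<gamma> - 1)"
proof -
  let ?p = "real m - \<gamma>" and ?e = "-\<gamma> - 1"
  obtain K where K: "K \<ge> 0"
    "\<And>z. norm z < 1 \<Longrightarrow> norm ((deriv ^^ m) R z) \<le> K * (norm (1 - z) powr (-?p) + norm (1 + z) powr (-?p))"
    using derivative_bound_disc[OF hol U _ t] m by auto
  define C1 where "C1 = 2 * exp 1 * K * 2 powr \<bar>?p - 1\<bar>"
  have C1: "C1 \<ge> 0" using K by (simp add: C1_def)
  define a where "a n = norm ((deriv ^^ n) R 0 / fact n)" for n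
  have a0: "a n \<ge> 0" for n by (simp add: a_def)
  have hol': "(deriv ^^ m) R holomorphic_on ball 0 1"
    using hol U by (intro holomorphic_higher_deriv) (auto intro: holomorphic_on_subset)
  have big: "a N \<le> C1 * (real m + 1) powr \<bar>?e\<bar> * real N powr ?e" if N: "N > m" for N
  proof -
    define n where "n = N - m"
    have n: "n \<ge> 1" "N = n + m" using N by (auto simp: n_def)
    have "norm ((deriv ^^ n) ((deriv ^^ m) R) 0 / fact n) \<le> C1 * real n powr (?p - 1)"
      using taylor_coeff_bound[OF hol' m K n(1)] by (simp add: C1_def)
    also have "(deriv ^^ n) ((deriv ^^ m) R) = (deriv ^^ N) R" by (simp add: n(2) funpow_add)
    finally have 1: "norm ((deriv ^^ N) R 0 / fact n) \<le> C1 * real n powr (?p - 1)" .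
    have "fact n * n ^ m \<le> (fact N :: nat)"
    proof -
      have "fact n * n ^ k \<le> (fact (n + k) :: nat)" for k
      proof (induction k)
        case (Suc k)
        have "fact n * n ^ Suc k = n * (fact n * n ^ k)" by simp
        also have "\<dots> \<le> Suc (n + k) * fact (n + k)" by (intro mult_mono Suc) auto
        finally show ?case by simp
      qed simp
      then show ?thesis by (simp add: n(2))
    qed
    then have f: "(fact n :: real) * real n ^ m \<le> fact N"
      by (metis of_nat_fact of_nat_le_iff of_nat_mult of_nat_power)
    have "a N = norm ((deriv ^^ N) R 0) / fact N" by (simp add: a_def norm_divide)
    also have "\<dots> \<le> norm ((deriv ^^ N) R 0) / (fact n * real n ^ m)"
      using n by (intro divide_left_mono f) (auto intro!: mult_pos_pos)
    also have "\<dots> = norm ((deriv ^^ N) R 0 / fact n) / real n ^ m" by (simp add: norm_divide)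
    also have "\<dots> \<le> C1 * real n powr (?p - 1) / real n ^ m"
      by (intro divide_right_mono 1) simp
    also have "\<dots> = C1 * real n powr ?e"
    proof -
      have "real n powr (?p - 1) / real n ^ m = real n powr (?p - 1) / real n powr (real m)"
        using n by (simp add: powr_realpow)
      also have "\<dots> = real n powr ?e" by (simp flip: powr_diff)
      finally show ?thesis by (metis times_divide_eq_right)
    qed
    also have "\<dots> \<le> C1 * ((real m + 1) powr \<bar>?e\<bar> * real N powr ?e)"
    proof (intro mult_left_mono powr_le_scaled C1)
      have "real m * real n \<ge> real m * 1" using n by (intro mult_left_mono) auto
      then show "real N \<le> (real m + 1) * real n" using n by (simp add: algebra_simps)
      have "real N * (real m + 1) \<ge> real N * 1" by (intro mult_left_mono) auto
      then show "real n \<le> (real m + 1) * real N" using n by (simp add: algebra_simps)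
    qed (use n in auto)
    finally show ?thesis by simp
  qed
  \<comment> \<open>The finitely many coefficients with N <= m, not reached through the m-th
    derivative at a positive index, are absorbed into the constant.\<close>
  define C2 where "C2 = (\<Sum>N=1..m. a N / real N powr ?e)"
  have C2: "C2 \<ge> 0" unfolding C2_def by (intro sum_nonneg divide_nonneg_nonneg a0) simp
  have small: "a N \<le> C2 * real N powr ?e" if N: "N \<ge> 1" "N \<le> m" for N
  proof -
    have "a N / real N powr ?e \<le> C2" unfolding C2_def
      using N a0 by (intro member_le_sum) (auto intro!: divide_nonneg_nonneg)
    then have "a N / real N powr ?e * real N powr ?e \<le> C2 * real N powr ?e" by (rule mult_right_mono) simp
    then show ?thesis using N by simp
  qed
  have "a N \<le> (C1 * (real m + 1) powr \<bar>?e\<bar> + C2) * real N powr ?e" if "N \<ge> 1" for N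
  proof (cases "N \<le> m")
    case True
    have "0 \<le> C1 * (real m + 1) powr \<bar>?e\<bar> * real N powr ?e" using C1 by simp
    then show ?thesis using small[OF that True] unfolding distrib_right by linarith
  next
    case False
    have "0 \<le> C2 * real N powr ?e" using C2 by simp
    then show ?thesis using big[of N] False unfolding distrib_right by linarith
  qed
  then show ?thesis unfolding a_def by blast
qed

subsection \<open>Binomial coefficients with complex parameter\<close>

text \<open>On the line Re s = 1/2 the reflected point 1 - s is the conjugate of s, so the
  reflection formula gives |1 / Gamma (s)|^2 = cosh (pi y) / pi exactly.\<close>

lemma rGamma_half_bound: "cmod (rGamma (Complex (1/2) y)) * sqrt pi \<le> exp (pi * \<bar>y\<bar> / 2)"
proof -
  let ?s = "Complex (1/2) y"
  have s: "1 - ?s = cnj ?s" by (simp add: complex_eq_iff)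
  have "of_real ((cmod (rGamma ?s))\<^sup>2) = rGamma ?s * cnj (rGamma ?s)"
    by (simp only: complex_norm_square)
  also have "\<dots> = rGamma ?s * rGamma (1 - ?s)" unfolding s by (simp add: cnj_rGamma)
  also have "\<dots> = sin (of_real pi * ?s) / of_real pi" by (rule rGamma_reflection_complex)
  also have "of_real pi * ?s = of_real pi / 2 - (- (\<i> * of_real (pi * y)))" by (simp add: complex_eq_iff)
  also have "sin (of_real pi / 2 - (- (\<i> * of_real (pi * y)))) = cos (- (\<i> * of_real (pi * y)))"
    by (rule cos_sin_eq[symmetric])
  also have "\<dots> = of_real (cosh (pi * y))"
  proof -
    have "\<i> * (- (\<i> * of_real (pi * y))) = of_real (pi * y)" by simp
    then have "cos (- (\<i> * of_real (pi * y))) = (exp (of_real (pi * y)) + exp (- of_real (pi * y))) / 2"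
      unfolding cos_exp_eq by (simp only:)
    also have "\<dots> = of_real (cosh (pi * y))"
      by (simp add: cosh_def exp_minus exp_of_real del: of_real_mult)
    finally show ?thesis .
  qed
  finally have "of_real ((cmod (rGamma ?s))\<^sup>2) = complex_of_real (cosh (pi * y) / pi)" by simp
  then have e: "(cmod (rGamma ?s))\<^sup>2 * pi = cosh (pi * y)"
    unfolding of_real_eq_iff by simp
  have "cosh (pi * y) \<le> exp \<bar>pi * y\<bar>"
    by (cases "y \<ge> 0") (simp_all add: cosh_def abs_mult mult_le_0_iff)
  also have "\<dots> = (exp (pi * \<bar>y\<bar> / 2))\<^sup>2"
    by (simp add: power2_eq_square abs_mult flip: exp_add)
  finally have "(cmod (rGamma ?s) * sqrt pi)\<^sup>2 \<le> (exp (pi * \<bar>y\<bar> / 2))\<^sup>2"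
    using e by (simp add: power_mult_distrib)
  then show ?thesis by (rule power2_le_imp_le) simp
qed

lemma norm_shift_le:
  assumes "0 < b" "b \<le> a"
  shows "cmod (Complex a y) * b \<le> a * cmod (Complex b y)"
proof (rule power2_le_imp_le)
  have "b\<^sup>2 * y\<^sup>2 \<le> a\<^sup>2 * y\<^sup>2" using assms by (intro mult_right_mono power_mono) auto
  then show "(cmod (Complex a y) * b)\<^sup>2 \<le> (a * cmod (Complex b y))\<^sup>2"
    by (simp add: cmod_def power_mult_distrib algebra_simps)
qed (use assms in auto)

lemma Complex_plus_nat: "Complex x y + of_nat n = Complex (x + real n) y"
  by (simp add: complex_eq_iff)

lemma pochhammer_ratio_le:
  assumes "x \<ge> 1/2"
  shows "cmod (pochhammer (Complex x y) n) * pochhammer (1/2) n \<le> pochhammer x n * cmod (pochhammer (Complex (1/2) y) n)"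
proof (induction n)
  case (Suc n)
  have "cmod (pochhammer (Complex x y) (Suc n)) * pochhammer (1/2) (Suc n) =
     (cmod (pochhammer (Complex x y) n) * pochhammer (1/2) n) * (cmod (Complex (x + n) y) * (1/2 + n))"
    by (simp add: pochhammer_Suc norm_mult Complex_plus_nat)
  also have "\<dots> \<le> (pochhammer x n * cmod (pochhammer (Complex (1/2) y) n)) * ((x + n) * cmod (Complex (1/2 + n) y))"
    using assms by (intro mult_mono Suc norm_shift_le) (auto intro!: mult_nonneg_nonneg pochhammer_nonneg)
  also have "\<dots> = pochhammer x (Suc n) * cmod (pochhammer (Complex (1/2) y) (Suc n))"
    by (simp add: pochhammer_Suc norm_mult Complex_plus_nat)
  finally show ?case .
qed simp

lemma norm_rGamma_series:
  assumes "n > 0"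
  shows "cmod (rGamma_series s n) = cmod (pochhammer s (Suc n)) / (fact n * real n powr Re s)"
  using assms by (simp add: rGamma_series_def norm_divide norm_mult powr_def mult.commute)

text \<open>The quotient by the value at y = 0 increases with n, so it is bounded by its limit, a
  quotient of values of 1 / Gamma known from the reflection formula. The bound therefore holds for
  all n with constant 1.\<close>

lemma pochhammer_half_bound:
  "cmod (pochhammer (Complex (1/2) y) n) \<le> pochhammer (1/2) n * exp (pi * \<bar>y\<bar> / 2)"
proof -
  let ?s = "Complex (1/2) y"
  define u where "u n = cmod (pochhammer ?s n) / pochhammer (1/2) n" for n
  have pos: "pochhammer (1/2 :: real) n > 0" for n by (intro pochhammer_pos) simp
  have "incseq u"
  proof (rule incseq_SucI)
    fix n
    have "1/2 + real n \<le> cmod (Complex (1/2 + real n) y)"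
      using complex_Re_le_cmod[of "Complex (1/2 + real n) y"] by simp
    then have "u n * 1 \<le> u n * (cmod (Complex (1/2 + real n) y) / (1/2 + real n))"
      using pos[of n] by (intro mult_left_mono) (auto simp: u_def less_imp_le)
    also have "\<dots> = u (Suc n)" by (simp add: u_def pochhammer_Suc norm_mult Complex_plus_nat)
    finally show "u n \<le> u (Suc n)" by simp
  qed
  moreover have "u \<longlonglongrightarrow> cmod (rGamma ?s) / rGamma (1/2)"
  proof (rule LIMSEQ_imp_Suc)
    have "(\<lambda>n. cmod (rGamma_series ?s n) / rGamma_series (1/2) n) \<longlonglongrightarrow> cmod (rGamma ?s) / rGamma (1/2)"
      by (intro tendsto_intros rGamma_series_LIMSEQ) (simp add: rGamma_inverse_Gamma Gamma_one_half_real)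
    moreover have "\<forall>\<^sub>F n in sequentially. cmod (rGamma_series ?s n) / rGamma_series (1/2) n = u (Suc n)"
      using eventually_gt_at_top[of 0]
    proof eventually_elim
      case (elim n)
      have "rGamma_series (1/2 :: real) n = pochhammer (1/2) (Suc n) / (fact n * real n powr (1/2))"
        using elim by (simp add: rGamma_series_def powr_def mult.commute)
      then show ?case using elim by (simp add: norm_rGamma_series u_def)
    qed
    ultimately show "(\<lambda>n. u (Suc n)) \<longlonglongrightarrow> cmod (rGamma ?s) / rGamma (1/2)"
      by (rule Lim_transform_eventually)
  qed
  ultimately have "u n \<le> cmod (rGamma ?s) / rGamma (1/2)" by (rule incseq_le)
  also have "\<dots> = cmod (rGamma ?s) * sqrt pi" 
  proof -
    have "rGamma (1/2 :: real) = 1 / sqrt pi"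
      unfolding rGamma_inverse_Gamma Gamma_one_half_real by (rule inverse_eq_divide)
    then show ?thesis by simp
  qed
  also have "\<dots> \<le> exp (pi * \<bar>y\<bar> / 2)" by (rule rGamma_half_bound)
  finally show ?thesis using pos[of n] by (simp add: u_def pos_divide_le_eq mult.commute)
qed

lemma pochhammer_real_bound:
  assumes "x > 0"
  shows "\<exists>C\<ge>0. \<forall>n\<ge>1. pochhammer x n \<le> C * (fact n * real n powr (x - 1))"
proof -
  have "Bseq (rGamma_series x)" using rGamma_series_LIMSEQ convergent_def convergent_imp_Bseq by blast
  then obtain C where C: "C > 0" "\<And>n. \<bar>rGamma_series x n\<bar> \<le> C" unfolding Bseq_def by auto
  have "pochhammer x n \<le> C * (fact n * real n powr (x - 1))" if n: "n \<ge> 1" for n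
  proof -
    have "pochhammer x n * (x + real n) = rGamma_series x n * (fact n * real n powr x)"
      using n by (simp add: rGamma_series_def pochhammer_Suc powr_def mult.commute)
    also have "\<dots> \<le> C * (fact n * real n powr x)"
      using C(2)[of n] by (intro mult_right_mono) auto
    also have "real n powr x = real n powr (x - 1) * real n"
      using n powr_mult_base[of "real n" "x - 1"] by (simp add: mult.commute)
    also have "C * (fact n * (real n powr (x - 1) * real n)) \<le> C * (fact n * real n powr (x - 1)) * (x + real n)"
      using assms C(1) by (simp add: mult.assoc mult_left_mono)
    finally show ?thesis using assms by (simp add: mult_right_le_imp_le)
  qed
  with C(1) show ?thesis using less_imp_le by blast
qed

text \<open>The constants are uniform in \<open>y\<close>. The exponential rate pi / 2 is the one
  that the Fourier coefficients can absorb; the power of 1 + |y| is harmless.\<close>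

definition poch_bounded :: "real \<Rightarrow> bool" where
  "poch_bounded x \<longleftrightarrow> (\<exists>C m. C \<ge> 0 \<and> (\<forall>y n. n \<ge> 1 \<longrightarrow>
     cmod (pochhammer (Complex x y) n) \<le> C * (1 + \<bar>y\<bar>) ^ m * exp (pi * \<bar>y\<bar> / 2) * (fact n * real n powr (x - 1))))"

lemma poch_bounded_base:
  assumes "x \<ge> 1/2"
  shows "poch_bounded x"
proof -
  obtain C where C: "C \<ge> 0" "\<And>n. n \<ge> 1 \<Longrightarrow> pochhammer x n \<le> C * (fact n * real n powr (x - 1))"
    using pochhammer_real_bound[of x] assms by auto
  have "cmod (pochhammer (Complex x y) n) \<le> C * (1 + \<bar>y\<bar>) ^ 0 * exp (pi * \<bar>y\<bar> / 2) * (fact n * real n powr (x - 1))"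
    if n: "n \<ge> 1" for y n
  proof -
    have pos: "pochhammer (1/2 :: real) n > 0" by (intro pochhammer_pos) simp
    have "cmod (pochhammer (Complex x y) n) * pochhammer (1/2) n \<le> pochhammer x n * cmod (pochhammer (Complex (1/2) y) n)"
      by (rule pochhammer_ratio_le[OF assms])
    also have "\<dots> \<le> pochhammer x n * (pochhammer (1/2) n * exp (pi * \<bar>y\<bar> / 2))"
      using assms by (intro mult_left_mono pochhammer_half_bound pochhammer_nonneg) auto
    finally have "cmod (pochhammer (Complex x y) n) * pochhammer (1/2) n \<le> (pochhammer x n * exp (pi * \<bar>y\<bar> / 2)) * pochhammer (1/2) n"
      by (simp add: mult_ac)
    then have "cmod (pochhammer (Complex x y) n) \<le> pochhammer x n * exp (pi * \<bar>y\<bar> / 2)"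
      by (rule mult_right_le_imp_le) (rule pos)
    also have "\<dots> \<le> (C * (fact n * real n powr (x - 1))) * exp (pi * \<bar>y\<bar> / 2)"
      by (intro mult_right_mono C n) simp
    finally show ?thesis by (simp add: mult_ac)
  qed
  with C(1) show ?thesis unfolding poch_bounded_def by blast
qed

text \<open>(s)_n = s (s + 1)_(n - 1): moving the real part one to the left costs the factor |s|,
  hence one more power of 1 + |y|.\<close>

lemma poch_bounded_step:
  assumes "poch_bounded (x + 1)"
  shows "poch_bounded x"
proof -
  obtain C m where C: "C \<ge> 0" "\<And>y n. n \<ge> 1 \<Longrightarrow>
     cmod (pochhammer (Complex (x + 1) y) n) \<le> C * (1 + \<bar>y\<bar>) ^ m * exp (pi * \<bar>y\<bar> / 2) * (fact n * real n powr x)"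
    using assms unfolding poch_bounded_def by auto
  \<comment> \<open>The inner summand 1 covers n = 1, for which the hypothesis would be needed at n
    - 1 = 0.\<close>
  let ?D = "(1 + \<bar>x\<bar>) * (1 + C * 2 powr \<bar>x\<bar>)"
  have D1: "1 + C * 2 powr \<bar>x\<bar> \<ge> 1" using C(1) by simp
  have s: "cmod (Complex x y) \<le> (1 + \<bar>x\<bar>) * (1 + \<bar>y\<bar>)" for y
  proof -
    have "cmod (Complex x y) \<le> \<bar>x\<bar> + \<bar>y\<bar>" using cmod_le[of "Complex x y"] by simp
    also have "\<dots> \<le> (1 + \<bar>x\<bar>) * (1 + \<bar>y\<bar>)" by (simp add: algebra_simps)
    finally show ?thesis .
  qed
  have "cmod (pochhammer (Complex x y) n) \<le> ?D * (1 + \<bar>y\<bar>) ^ Suc m * exp (pi * \<bar>y\<bar> / 2) * (fact n * real n powr (x - 1))"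
    if n: "n \<ge> 1" for y n
  proof -
    let ?E = "(1 + \<bar>y\<bar>) ^ m * exp (pi * \<bar>y\<bar> / 2)"
    have E: "?E \<ge> 1" using mult_mono[of 1 "(1 + \<bar>y\<bar>) ^ m" 1 "exp (pi * \<bar>y\<bar> / 2)"] by simp
    obtain k where k: "n = Suc k" using n by (cases n) auto
    have "pochhammer (Complex x y) n = Complex x y * pochhammer (Complex (x + 1) y) k"
      unfolding k pochhammer_rec by (simp add: complex_eq_iff[of "Complex x y + 1"] plus_complex.code one_complex.code)
    then have 1: "cmod (pochhammer (Complex x y) n) = cmod (Complex x y) * cmod (pochhammer (Complex (x + 1) y) k)"
      by (simp add: norm_mult)
    have 2: "cmod (pochhammer (Complex (x + 1) y) k) \<le> (1 + C * 2 powr \<bar>x\<bar>) * ?E * (fact n * real n powr (x - 1))"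
    proof (cases "k = 0")
      case True
      have "1 * 1 \<le> (1 + C * 2 powr \<bar>x\<bar>) * ?E" using D1 E by (intro mult_mono) auto
      then show ?thesis using True k by simp
    next
      case False
      have "cmod (pochhammer (Complex (x + 1) y) k) \<le> C * (1 + \<bar>y\<bar>) ^ m * exp (pi * \<bar>y\<bar> / 2) * (fact k * real k powr x)"
        using False by (intro C(2)) auto
      also have "\<dots> \<le> C * (1 + \<bar>y\<bar>) ^ m * exp (pi * \<bar>y\<bar> / 2) * (fact k * (2 powr \<bar>x\<bar> * real n powr x))"
        using False k C(1) by (intro mult_left_mono powr_le_scaled) auto
      also have "real n powr x = real n powr (x - 1) * real n"
        using n powr_mult_base[of "real n" "x - 1"] by (simp add: mult.commute)
      also have "C * (1 + \<bar>y\<bar>) ^ m * exp (pi * \<bar>y\<bar> / 2) * (fact k * (2 powr \<bar>x\<bar> * (real n powr (x - 1) * real n)))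
         = (C * 2 powr \<bar>x\<bar>) * ?E * (fact n * real n powr (x - 1))"
        by (simp add: k mult_ac)
      also have "\<dots> \<le> (1 + C * 2 powr \<bar>x\<bar>) * ?E * (fact n * real n powr (x - 1))"
        by (intro mult_right_mono) auto
      finally show ?thesis .
    qed
    have "cmod (pochhammer (Complex x y) n) \<le> ((1 + \<bar>x\<bar>) * (1 + \<bar>y\<bar>)) * ((1 + C * 2 powr \<bar>x\<bar>) * ?E * (fact n * real n powr (x - 1)))"
      unfolding 1 by (intro mult_mono s 2) auto
    then show ?thesis by (simp add: mult_ac)
  qed
  moreover have "?D \<ge> 0" using D1 by (intro mult_nonneg_nonneg) auto
  ultimately show ?thesis unfolding poch_bounded_def by blast
qed

lemma poch_bounded: "poch_bounded x"
proof -
  have "poch_bounded x" if "x + real k \<ge> 1/2" for k x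
    using that
  proof (induction k arbitrary: x)
    case (Suc k)
    have "poch_bounded (x + 1)" by (rule Suc.IH) (use Suc.prems in simp)
    then show ?case by (rule poch_bounded_step)
  qed (simp add: poch_bounded_base)
  moreover obtain k where "1/2 - x \<le> real k" using real_arch_simple by blast
  then have "x + real k \<ge> 1/2" by simp
  ultimately show ?thesis .
qed

section \<open>Taylor coefficients of (1 - z)^(-s), normalised by n^(s - 1), and their rate of
  convergence\<close>

definition binseq :: "complex \<Rightarrow> nat \<Rightarrow> complex" where
  "binseq s n = pochhammer s n / (fact n * of_nat n powr (s - 1))"

lemma norm_nat_powr: "n \<ge> 1 \<Longrightarrow> cmod (of_nat n powr s) = real n powr Re s"
  using norm_powr_real_powr[of "of_nat n" s] by simp

text \<open>\<open>rGamma_series\<close> has one more Pochhammer factor s + n and one more power of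
  n, so the two sequences differ by the factor n / (s + n).\<close>

lemma binseq_LIMSEQ: "binseq s \<longlonglongrightarrow> rGamma s"
proof (rule Lim_transform_eventually)
  have "(\<lambda>n. of_nat n / (s + of_nat n) :: complex) \<longlonglongrightarrow> 1"
  proof (rule Lim_transform_eventually)
    have "(\<lambda>n. 1 / (s * inverse (of_nat n) + 1)) \<longlonglongrightarrow> 1 / (s * 0 + 1)"
      by (intro tendsto_intros lim_inverse_n) auto
    then show "(\<lambda>n. 1 / (s * inverse (of_nat n) + 1)) \<longlonglongrightarrow> 1" by simp
    show "\<forall>\<^sub>F n in sequentially. 1 / (s * inverse (of_nat n) + 1) = of_nat n / (s + of_nat n)"
      using eventually_gt_at_top[of 0] by eventually_elim (simp add: divide_simps)
  qed
  then have "(\<lambda>n. rGamma_series s n * (of_nat n / (s + of_nat n))) \<longlonglongrightarrow> rGamma s * 1"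
    by (intro tendsto_mult rGamma_series_LIMSEQ)
  then show "(\<lambda>n. rGamma_series s n * (of_nat n / (s + of_nat n))) \<longlonglongrightarrow> rGamma s" by simp
  obtain k where k: "cmod s < real k" using reals_Archimedean2 by blast
  show "\<forall>\<^sub>F n in sequentially. rGamma_series s n * (of_nat n / (s + of_nat n)) = binseq s n"
    using eventually_ge_at_top[of "max 1 k"]
  proof eventually_elim
    case (elim n)
    have "s + of_nat n \<noteq> 0"
    proof
      assume "s + of_nat n = 0"
      then have "s = - of_nat n" by (rule eq_neg_iff_add_eq_0[THEN iffD2])
      then have "cmod s = real n" by simp
      with k elim show False by simp
    qed
    moreover have "of_nat n powr (s - 1) = exp (s * of_real (ln (real n))) / of_nat n"
      using elim by (simp add: powr_def left_diff_distrib exp_diff Ln_of_nat exp_of_real)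
    ultimately show ?case using elim
      by (simp add: rGamma_series_def binseq_def pochhammer_Suc exp_not_eq_zero Ln_of_nat exp_of_real)
  qed
qed

text \<open>For t = 1 / (n + 1) the expression is the quotient of consecutive values of
  \<open>binseq\<close>. Its derivative at u carries the factor u, so the deviation from 1 is
  quadratic in t.\<close>

lemma factor_deriv_bound:
  fixes s :: complex and t :: real
  assumes t: "0 \<le> t" "t \<le> 1/2"
  shows "cmod ((1 + (s - 1) * t) * (1 - t) powr (s - 1) - 1) \<le> cmod s * cmod (s - 1) * 2 powr \<bar>Re s - 2\<bar> * t\<^sup>2"
proof -
  let ?f = "\<lambda>u. (1 + (s - 1) * u) * (1 - u) powr (s - 1)"
  let ?B = "cmod s * cmod (s - 1) * 2 powr \<bar>Re s - 2\<bar> * t"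
  have D: "(?f has_field_derivative (- (s - 1) * s * u * (1 - u) powr (s - 2))) (at u)"
    "cmod (- (s - 1) * s * u * (1 - u) powr (s - 2)) \<le> ?B" if u: "u \<in> closed_segment 0 (of_real t)" for u
  proof -
    obtain r where r: "u = of_real r" "0 \<le> r" "r \<le> t"
    proof -
      obtain a where a: "u = (1 - a) *\<^sub>R 0 + a *\<^sub>R of_real t" "0 \<le> a" "a \<le> 1"
        using u by (auto simp: closed_segment_def)
      have "u = of_real (a * t)" using a(1) by (simp add: scaleR_conv_of_real)
      moreover have "0 \<le> a * t" "a * t \<le> t" using a t by (auto intro: mult_left_le_one_le)
      ultimately show ?thesis by (rule that)
    qed
    have n0: "1 - u \<notin> \<real>\<^sub>\<le>\<^sub>0" using r t by (auto simp: complex_nonpos_Reals_iff)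
    then have nz: "1 - u \<noteq> 0" by auto
    have pw: "(1 - u) powr (s - 1) = (1 - u) powr (s - 2) * (1 - u)"
      using powr_add[of "1 - u" "s - 2" 1] nz by (simp add: powr_to_1)
    have "(?f has_field_derivative ((s - 1) * (1 - u) powr (s - 1) + (1 + (s - 1) * u) * (- (s - 1) * (1 - u) powr (s - 1 - 1)))) (at u)"
      using n0 by (auto intro!: derivative_eq_intros simp: algebra_simps)
    also have "(s - 1) * (1 - u) powr (s - 1) + (1 + (s - 1) * u) * (- (s - 1) * (1 - u) powr (s - 1 - 1)) = - (s - 1) * s * u * (1 - u) powr (s - 2)"
      unfolding pw by (simp add: algebra_simps)
    finally show "(?f has_field_derivative (- (s - 1) * s * u * (1 - u) powr (s - 2))) (at u)" .
    have "cmod ((1 - u) powr (s - 2)) = (1 - r) powr (Re s - 2)"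
      using norm_powr_real_powr[of "1 - u" "s - 2"] r t by simp
    also have "\<dots> \<le> 2 powr \<bar>Re s - 2\<bar> * 1 powr (Re s - 2)"
      using r t by (intro powr_le_scaled) auto
    finally have "r * cmod ((1 - u) powr (s - 2)) \<le> t * 2 powr \<bar>Re s - 2\<bar>"
      using r t by (intro mult_mono) auto
    then have "cmod s * cmod (s - 1) * (r * cmod ((1 - u) powr (s - 2))) \<le> cmod s * cmod (s - 1) * (t * 2 powr \<bar>Re s - 2\<bar>)"
      by (rule mult_left_mono) simp
    then show "cmod (- (s - 1) * s * u * (1 - u) powr (s - 2)) \<le> ?B"
      using r by (simp add: norm_mult norm_minus_commute mult_ac)
  qed
  have "cmod (?f (of_real t) - ?f 0) \<le> ?B * cmod (of_real t - 0)"
    by (rule field_differentiable_bound[of "closed_segment 0 (of_real t)"])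
       (auto intro: has_field_derivative_at_within[OF D(1)] D(2))
  then show ?thesis using t by (simp add: power2_eq_square mult.assoc)
qed

text \<open>Consecutive differences are of order 1 / (k + 1)^2 <= 1/k - 1/(k + 1) and telescope up
  to the limit. They are proportional to \<open>binseq\<close> itself, so the uniform Pochhammer
  bound enters as the constant.\<close>

lemma binseq_rate:
  "\<exists>C m. C \<ge> 0 \<and> (\<forall>y n. n \<ge> 1 \<longrightarrow>
     cmod (binseq (Complex x y) n - rGamma (Complex x y)) \<le> C * (1 + \<bar>y\<bar>) ^ m * exp (pi * \<bar>y\<bar> / 2) / real n)"
proof -
  obtain C m where C: "C \<ge> 0" "\<And>y n. n \<ge> 1 \<Longrightarrow>
     cmod (pochhammer (Complex x y) n) \<le> C * (1 + \<bar>y\<bar>) ^ m * exp (pi * \<bar>y\<bar> / 2) * (fact n * real n powr (x - 1))"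
    using poch_bounded[of x] unfolding poch_bounded_def by auto
  let ?K = "C * ((2 + \<bar>x\<bar>)\<^sup>2 * 2 powr \<bar>x - 2\<bar>)"
  have "cmod (binseq s n - rGamma s) \<le> ?K * (1 + \<bar>y\<bar>) ^ (m + 2) * exp (pi * \<bar>y\<bar> / 2) / real n"
    if n: "n \<ge> 1" and s: "s = Complex x y" for y n s
  proof -
    let ?B = "C * (1 + \<bar>y\<bar>) ^ m * exp (pi * \<bar>y\<bar> / 2)"
    define M where "M = ?B * (cmod s * cmod (s - 1) * 2 powr \<bar>x - 2\<bar>)"
    have wb: "cmod (binseq s k) \<le> ?B" if k: "k \<ge> 1" for k
    proof -
      have "cmod (pochhammer s k) / (fact k * real k powr (x - 1)) \<le> ?B"
        using C(2)[OF k, of y] k by (simp add: s divide_le_eq)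
      then show ?thesis using k by (simp add: binseq_def norm_divide norm_mult norm_nat_powr s)
    qed
    have M0: "M \<ge> 0" using C(1) by (simp add: M_def)
    have step: "cmod (binseq s (Suc k) - binseq s k) \<le> M * (1 / real k - 1 / real (Suc k))" if k: "k \<ge> 1" for k
    proof -
      define t where "t = 1 / real (Suc k)"
      have t: "0 \<le> t" "t \<le> 1/2" using k by (auto simp: t_def)
      have nz: "complex_of_nat (Suc k) \<noteq> 0" by (simp del: of_nat_Suc)
      have a: "1 - complex_of_real t = of_nat k / of_nat (Suc k)" using nz by (simp add: t_def field_simps)
      have b: "1 + (s - 1) * t = (s + of_nat k) / of_nat (Suc k)" using nz by (simp add: t_def field_simps)
      have "(of_nat k / of_nat (Suc k)) powr (s - 1) = (of_nat k powr (s - 1)) / (of_nat (Suc k) powr (s - 1) :: complex)"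
      proof -
        have "Ln (of_nat k / of_nat (Suc k)) = Ln (of_real (real k / real (Suc k)))" by simp
        also have "\<dots> = of_real (ln (real k / real (Suc k)))" using k by (intro Ln_of_real) auto
        also have "\<dots> = of_real (ln (real k)) - of_real (ln (real (Suc k)))" using k by (simp add: ln_div)
        finally have "Ln (of_nat k / of_nat (Suc k)) = Ln (of_nat k) - Ln (of_nat (Suc k))"
          using k Ln_of_nat[of k] Ln_of_nat[of "Suc k"] by simp
        then show ?thesis using k nz unfolding powr_def by (simp add: right_diff_distrib exp_diff)
      qed
      then have e: "binseq s (Suc k) = binseq s k * ((1 + (s - 1) * t) * (1 - complex_of_real t) powr (s - 1))"
        using k unfolding a b by (simp add: binseq_def pochhammer_Suc)
      have "cmod (binseq s (Suc k) - binseq s k) = cmod (binseq s k) * cmod ((1 + (s - 1) * t) * (1 - complex_of_real t) powr (s - 1) - 1)"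
        unfolding e by (simp add: right_diff_distrib flip: norm_mult)
      also have "\<dots> \<le> ?B * (cmod s * cmod (s - 1) * 2 powr \<bar>x - 2\<bar> * t\<^sup>2)"
        using factor_deriv_bound[OF t, of s] C(1) by (intro mult_mono wb k) (auto simp: s)
      also have "\<dots> = M * t\<^sup>2" by (simp add: M_def mult_ac)
      also have "\<dots> \<le> M * (1 / real k - 1 / real (Suc k))"
      proof (rule mult_left_mono[OF _ M0])
        have "1 / real k - 1 / real (Suc k) = 1 / (real k * real (Suc k))" using k by (simp add: field_simps)
        also have "\<dots> \<ge> 1 / (real (Suc k) * real (Suc k))" using k by (intro divide_left_mono mult_right_mono) auto
        finally show "t\<^sup>2 \<le> 1 / real k - 1 / real (Suc k)" by (simp add: t_def power2_eq_square)
      qed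
      finally show ?thesis .
    qed
    have tel: "cmod (binseq s (n + j) - binseq s n) \<le> M * (1 / real n - 1 / real (n + j))" for j
    proof (induction j)
      case (Suc j)
      have "cmod (binseq s (n + Suc j) - binseq s n) \<le> cmod (binseq s (Suc (n + j)) - binseq s (n + j)) + cmod (binseq s (n + j) - binseq s n)"
        using norm_triangle_ineq[of "binseq s (Suc (n + j)) - binseq s (n + j)" "binseq s (n + j) - binseq s n"] by simp
      also have "\<dots> \<le> M * (1 / real (n + j) - 1 / real (Suc (n + j))) + M * (1 / real n - 1 / real (n + j))"
        using n by (intro add_mono step Suc) auto
      finally show ?case by (simp add: right_diff_distrib)
    qed simp
    have le: "cmod (binseq s (n + j) - binseq s n) \<le> M / real n" for j
    proof -
      have "M * (1 / real n - 1 / real (n + j)) \<le> M * (1 / real n)" using M0 by (intro mult_left_mono) auto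
      then show ?thesis using tel[of j] by simp
    qed
    have "(\<lambda>j. cmod (binseq s (j + n) - binseq s n)) \<longlonglongrightarrow> cmod (rGamma s - binseq s n)"
      by (intro tendsto_intros LIMSEQ_ignore_initial_segment binseq_LIMSEQ)
    then have "cmod (rGamma s - binseq s n) \<le> M / real n"
      by (rule LIMSEQ_le_const2) (use le in \<open>auto simp: add.commute\<close>)
    also have "M \<le> ?K * (1 + \<bar>y\<bar>) ^ (m + 2) * exp (pi * \<bar>y\<bar> / 2)"
    proof -
      have nn: "\<bar>x\<bar> * \<bar>y\<bar> \<ge> 0" by simp
      have "cmod s \<le> \<bar>x\<bar> + \<bar>y\<bar>" using cmod_le[of s] by (simp add: s)
      then have 1: "cmod s \<le> (2 + \<bar>x\<bar>) * (1 + \<bar>y\<bar>)" unfolding distrib_left distrib_right using nn by linarith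
      have "cmod (s - 1) \<le> \<bar>x - 1\<bar> + \<bar>y\<bar>" using cmod_le[of "s - 1"] by (simp add: s)
      then have 2: "cmod (s - 1) \<le> (2 + \<bar>x\<bar>) * (1 + \<bar>y\<bar>)" unfolding distrib_left distrib_right using nn by linarith
      have "M \<le> ?B * ((2 + \<bar>x\<bar>) * (1 + \<bar>y\<bar>) * ((2 + \<bar>x\<bar>) * (1 + \<bar>y\<bar>)) * 2 powr \<bar>x - 2\<bar>)"
        unfolding M_def using C(1) by (intro mult_left_mono mult_right_mono mult_mono 1 2) auto
      then show ?thesis by (simp add: power2_eq_square mult_ac power_add)
    qed
    then have "M / real n \<le> ?K * (1 + \<bar>y\<bar>) ^ (m + 2) * exp (pi * \<bar>y\<bar> / 2) / real n"
      by (rule divide_right_mono) simp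
    finally show ?thesis by (simp add: norm_minus_commute)
  qed
  moreover have "?K \<ge> 0" using C(1) by simp
  ultimately show ?thesis by blast
qed

subsection \<open>Fourier series of periodic holomorphic functions\<close>

definition hstrip :: "real \<Rightarrow> complex set" where "hstrip H = {z. \<bar>Im z\<bar> < H}"

definition per :: "int \<Rightarrow> complex \<Rightarrow> complex" where
  "per k z = exp (2 * of_int k * complex_of_real pi * \<i> * z)"

lemma per_add: "per (k + l) z = per k z * per l z"
  by (simp add: per_def algebra_simps flip: exp_add)

lemma per_plus_1 [simp]: "per k (z + 1) = per k z"
proof -
  have "per k (z + 1) = per k z * exp (2 * of_int k * complex_of_real pi * \<i>)"
    by (simp add: per_def distrib_left exp_add)
  also have "exp (2 * of_int k * complex_of_real pi * \<i>) = 1"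
    using exp_integer_2pi[of "of_int k"] by (simp add: mult_ac)
  finally show ?thesis by simp
qed

lemma per_0 [simp]: "per 0 z = 1" by (simp add: per_def)
lemma per_nonzero [simp]: "per k z \<noteq> 0" by (simp add: per_def)
lemma norm_per: "cmod (per k z) = exp (- (2 * pi * real_of_int k * Im z))"
  by (simp add: per_def)
lemma per_holomorphic: "per k holomorphic_on S"
  unfolding per_def by (intro holomorphic_intros)
lemma per_deriv: "(per k has_field_derivative (2 * of_int k * complex_of_real pi * \<i> * per k z)) (at z)"
  unfolding per_def by (auto intro!: derivative_eq_intros)

lemma fourier_coeff_per: "fourier_coeff f k = integral {0..1} (\<lambda>t. f (of_real t) * per (- k) (of_real t))"
  by (simp add: fourier_coeff_def per_def)

lemma open_hstrip: "open (hstrip H)"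
proof -
  have "hstrip H = {z. Im z < H} \<inter> {z. Im z > - H}" by (auto simp: hstrip_def)
  then show ?thesis by (auto intro!: open_Int open_halfspace_Im_lt open_halfspace_Im_gt)
qed

lemma convex_hstrip: "convex (hstrip H)"
proof -
  have "hstrip H = {z. Im z < H} \<inter> {z. Im z > - H}" by (auto simp: hstrip_def)
  then show ?thesis by (auto intro!: convex_Int convex_halfspace_Im_lt convex_halfspace_Im_gt)
qed

lemma summable_on_UNIV_int:
  fixes f :: "int \<Rightarrow> 'a :: banach"
  assumes "(\<lambda>n. f (int n)) summable_on UNIV" "(\<lambda>n. f (- int n)) summable_on UNIV"
  shows "f summable_on UNIV"
proof -
  have 1: "f summable_on range int"
    using assms(1) by (subst summable_on_reindex) (auto simp: o_def)
  have 2: "f summable_on range (\<lambda>n. - int n)"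
    using assms(2) by (subst summable_on_reindex) (auto simp: o_def inj_def)
  have "f summable_on (range int \<union> (range (\<lambda>n. - int n) - range int))"
    by (intro summable_on_Un_disjoint 1 summable_on_subset_banach[OF 2]) auto
  also have "range int \<union> (range (\<lambda>n. - int n) - range int) = UNIV"
    by (auto intro: int_cases2)
  finally show ?thesis .
qed

lemma summable_exp_nat:
  assumes "c > 0"
  shows "(\<lambda>n::nat. exp (- (c * real n))) summable_on UNIV"
proof -
  have e: "exp (- (c * real n)) = exp (- c) ^ n" for n by (simp flip: exp_of_nat_mult add: mult.commute)
  have "summable (\<lambda>n. exp (- c) ^ n)" using assms by (intro summable_geometric) simp
  then have "summable (\<lambda>n::nat. norm (exp (- (c * real n))))" unfolding e by simp
  then show ?thesis by (rule norm_summable_imp_summable_on)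
qed

lemma summable_exp_int:
  assumes "c > 0"
  shows "(\<lambda>k::int. exp (- (c * \<bar>real_of_int k\<bar>))) summable_on UNIV"
  by (rule summable_on_UNIV_int) (use summable_exp_nat[OF assms] in simp_all)

lemma poly_le_exp:
  fixes m :: nat and c :: real
  assumes "c > 0"
  shows "\<exists>K\<ge>0. \<forall>x\<ge>0. (1 + x) ^ m \<le> K * exp (c * x)"
proof -
  define b where "b = c / (real m + 1)"
  have b: "b > 0" using assms by (simp add: b_def)
  have "(1 + x) ^ m \<le> ((1 + 1 / b) ^ m) * exp (c * x)" if x: "x \<ge> 0" for x
  proof -
    have "1 + x \<le> (1 + 1 / b) * (1 + b * x)"
      using b x by (simp add: field_simps)
    also have "\<dots> \<le> (1 + 1 / b) * exp (b * x)"
      using b by (intro mult_left_mono exp_ge_add_one_self) auto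
    finally have "(1 + x) ^ m \<le> ((1 + 1 / b) * exp (b * x)) ^ m"
      using x by (intro power_mono) auto
    also have "\<dots> = (1 + 1 / b) ^ m * exp (real m * (b * x))"
      by (simp add: power_mult_distrib exp_of_nat_mult)
    also have "real m * (b * x) \<le> c * x"
    proof -
      have "real m * b \<le> c" using assms by (simp add: b_def field_simps)
      then show ?thesis using x by (metis mult.assoc mult_right_mono)
    qed
    then have "(1 + 1 / b) ^ m * exp (real m * (b * x)) \<le> (1 + 1 / b) ^ m * exp (c * x)"
      using b by (intro mult_left_mono) auto
    finally show ?thesis .
  qed
  moreover have "(1 + 1 / b) ^ m \<ge> 0" using b by simp
  ultimately show ?thesis by blast
qed

locale periodic_holomorphic =
  fixes \<omega> :: "complex \<Rightarrow> complex" and H :: real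
  assumes H: "H > 0" and hol: "\<omega> holomorphic_on hstrip H"
    and periodic: "\<And>z. z \<in> hstrip H \<Longrightarrow> \<omega> (z + 1) = \<omega> z"
begin

lemma line_in_strip: "\<bar>h\<bar> < H \<Longrightarrow> of_real t + \<i> * of_real h \<in> hstrip H"
  by (simp add: hstrip_def)

lemma integrand_continuous:
  assumes "\<bar>h\<bar> < H"
  shows "continuous_on A (\<lambda>t. \<omega> (of_real t + \<i> * of_real h) * per k (of_real t + \<i> * of_real h))"
proof -
  have "continuous_on A (\<lambda>t. \<omega> (of_real t + \<i> * of_real h))"
    by (rule continuous_on_compose2[OF holomorphic_on_imp_continuous_on[OF hol]])
       (use line_in_strip[OF assms] in \<open>auto intro!: continuous_intros\<close>)
  then show ?thesis unfolding per_def by (intro continuous_intros)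
qed

text \<open>A primitive of the integrand grows by the same constant over every unit step, because
  its increment has derivative zero by periodicity. So any horizontal line in the strip gives the
  same integral.\<close>

lemma fourier_coeff_shift:
  assumes h: "\<bar>h\<bar> < H"
  shows "fourier_coeff \<omega> k = integral {0..1} (\<lambda>t. \<omega> (of_real t + \<i> * of_real h) * per (- k) (of_real t + \<i> * of_real h))"
proof -
  let ?g = "\<lambda>z. \<omega> z * per (- k) z"
  have "?g holomorphic_on hstrip H" by (intro holomorphic_intros hol per_holomorphic)
  then obtain \<Phi> where "\<And>z. z \<in> hstrip H \<Longrightarrow> (\<Phi> has_field_derivative ?g z) (at z within hstrip H)"
    using holomorphic_convex_primitive'[OF convex_hstrip open_hstrip] by blast
  then have \<Phi>: "(\<Phi> has_field_derivative ?g z) (at z)" if "z \<in> hstrip H" for z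
    using that at_within_open[OF that open_hstrip] by metis
  have in1: "z + 1 \<in> hstrip H" if "z \<in> hstrip H" for z using that by (simp add: hstrip_def)
  have D: "((\<lambda>z. \<Phi> (z + 1) - \<Phi> z) has_field_derivative 0) (at z)" if z: "z \<in> hstrip H" for z
  proof -
    have "((\<lambda>z. \<Phi> (z + 1)) has_field_derivative ?g (z + 1)) (at z)"
      using \<Phi>[OF in1[OF z]] by (subst (asm) DERIV_shift)
    from DERIV_diff[OF this \<Phi>[OF z]] show ?thesis using periodic[OF z] by simp
  qed
  have "\<exists>c. \<forall>z\<in>hstrip H. \<Phi> (z + 1) - \<Phi> z = c"
    by (rule has_field_derivative_zero_constant[OF convex_hstrip])
       (use D in \<open>blast intro: has_field_derivative_at_within\<close>)
  then obtain c where c: "\<And>z. z \<in> hstrip H \<Longrightarrow> \<Phi> (z + 1) - \<Phi> z = c" by blast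
  have I: "integral {0..1} (\<lambda>t. ?g (of_real t + \<i> * of_real h)) = c" if h: "\<bar>h\<bar> < H" for h
  proof -
    let ?z = "\<lambda>t::real. of_real t + \<i> * of_real h"
    have "((\<lambda>t. \<Phi> (?z t)) has_vector_derivative ?g (?z t)) (at t within {0..1})" for t
    proof -
      have "(?z has_vector_derivative 1) (at t within {0..1})"
        by (auto intro!: derivative_eq_intros simp: has_vector_derivative_def scaleR_conv_of_real)
      from field_vector_diff_chain_within[OF this has_field_derivative_at_within[OF \<Phi>[OF line_in_strip[OF h]]]]
      show ?thesis by (simp add: o_def)
    qed
    then have "((\<lambda>t. ?g (?z t)) has_integral (\<Phi> (?z 1) - \<Phi> (?z 0))) {0..1}"
      by (intro fundamental_theorem_of_calculus) auto
    then have "integral {0..1} (\<lambda>t. ?g (?z t)) = \<Phi> (?z 1) - \<Phi> (?z 0)" by (rule integral_unique)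
    also have "\<dots> = c" using c[OF line_in_strip[OF h, of 0]] by (simp add: add.commute)
    finally show ?thesis .
  qed
  have "fourier_coeff \<omega> k = c" using I[of 0] H by (simp add: fourier_coeff_per)
  then show ?thesis using I[OF h] by simp
qed

lemma fourier_coeff_decay:
  assumes h: "0 \<le> h" "h < H"
  shows "\<exists>M\<ge>0. \<forall>k. cmod (fourier_coeff \<omega> k) \<le> M * exp (- (2 * pi * h * \<bar>real_of_int k\<bar>))"
proof -
  have "\<exists>B>0. \<forall>t\<in>{0..1}. cmod (\<omega> (of_real t + \<i> * of_real h')) \<le> B" if "\<bar>h'\<bar> < H" for h'
  proof -
    have "compact ((\<lambda>t. \<omega> (of_real t + \<i> * of_real h')) ` {0..1})"
      using integrand_continuous[OF that, of "{0..1}" 0] by (intro compact_continuous_image) auto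
    from compact_imp_bounded[OF this] show ?thesis unfolding bounded_pos by (simp only: ball_simps)
  qed
  from this[of h] this[of "-h"] h obtain B1 B2 where
    B1: "B1 > 0" "\<And>t. t \<in> {0..1} \<Longrightarrow> cmod (\<omega> (of_real t + \<i> * of_real h)) \<le> B1" and
    B2: "B2 > 0" "\<And>t. t \<in> {0..1} \<Longrightarrow> cmod (\<omega> (of_real t + \<i> * of_real (- h))) \<le> B2" by auto
  have "cmod (fourier_coeff \<omega> k) \<le> (B1 + B2) * exp (- (2 * pi * h * \<bar>real_of_int k\<bar>))" for k
  proof -
    \<comment> \<open>The line is moved to the side on which \<open>per (- k)\<close> has modulus
      exp (-2 pi h |k|).\<close>
    define h' where "h' = (if k \<ge> 0 then - h else h)"
    have h': "\<bar>h'\<bar> < H" using h by (simp add: h'_def)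
    have b: "cmod (\<omega> (of_real t + \<i> * of_real h')) \<le> B1 + B2" if "t \<in> {0..1}" for t
      using B1(1) B2(1) B1(2)[OF that] B2(2)[OF that] by (auto simp: h'_def)
    let ?f = "\<lambda>t. \<omega> (of_real t + \<i> * of_real h') * per (- k) (of_real t + \<i> * of_real h')"
    have "norm (integral {0..1} ?f) \<le> ((B1 + B2) * exp (- (2 * pi * h * \<bar>real_of_int k\<bar>))) * (1 - 0)"
    proof (rule integral_bound)
      show "continuous_on {0..1} ?f" by (rule integrand_continuous[OF h'])
      fix t :: real assume t: "t \<in> {0..1}"
      have "cmod (per (- k) (of_real t + \<i> * of_real h')) = exp (- (2 * pi * h * \<bar>real_of_int k\<bar>))"
        by (simp add: norm_per h'_def)
      then show "norm (?f t) \<le> (B1 + B2) * exp (- (2 * pi * h * \<bar>real_of_int k\<bar>))"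
        using b[OF t] by (simp add: norm_mult mult_right_mono)
    qed simp
    then show ?thesis unfolding fourier_coeff_shift[OF h'] by simp
  qed
  moreover have "B1 + B2 \<ge> 0" using B1(1) B2(1) by simp
  ultimately show ?thesis by blast
qed

lemma fourier_terms_summable:
  assumes z: "z \<in> hstrip H"
  shows "(\<lambda>k. cmod (fourier_coeff \<omega> k * per k z)) summable_on UNIV"
proof -
  define h where "h = (\<bar>Im z\<bar> + H) / 2"
  have h: "0 \<le> h" "h < H" "h - \<bar>Im z\<bar> > 0" using z H by (auto simp: h_def hstrip_def)
  obtain M where M: "M \<ge> 0" "\<And>k. cmod (fourier_coeff \<omega> k) \<le> M * exp (- (2 * pi * h * \<bar>real_of_int k\<bar>))"
    using fourier_coeff_decay[OF h(1,2)] by blast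
  have "(\<lambda>k::int. M * exp (- ((2 * pi * (h - \<bar>Im z\<bar>)) * \<bar>real_of_int k\<bar>))) summable_on UNIV"
    by (intro summable_on_cmult_right summable_exp_int) (use h in simp)
  then show ?thesis
  proof (rule summable_on_comparison_test)
    fix k :: int
    have "- (real_of_int k * Im z) \<le> \<bar>real_of_int k\<bar> * \<bar>Im z\<bar>"
      by (metis abs_ge_minus_self abs_mult)
    then have "2 * pi * (- (real_of_int k * Im z)) \<le> 2 * pi * (\<bar>real_of_int k\<bar> * \<bar>Im z\<bar>)"
      by (intro mult_left_mono) auto
    then have "cmod (per k z) \<le> exp (2 * pi * \<bar>Im z\<bar> * \<bar>real_of_int k\<bar>)"
      by (simp add: norm_per mult_ac)
    then have "cmod (fourier_coeff \<omega> k) * cmod (per k z) \<le> (M * exp (- (2 * pi * h * \<bar>real_of_int k\<bar>))) * exp (2 * pi * \<bar>Im z\<bar> * \<bar>real_of_int k\<bar>)"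
      using M by (intro mult_mono) auto
    also have "\<dots> = M * exp (- ((2 * pi * (h - \<bar>Im z\<bar>)) * \<bar>real_of_int k\<bar>))"
      by (simp add: algebra_simps flip: exp_add)
    finally show "cmod (fourier_coeff \<omega> k * per k z) \<le> M * exp (- ((2 * pi * (h - \<bar>Im z\<bar>)) * \<bar>real_of_int k\<bar>))"
      by (simp add: norm_mult)
  qed auto
qed

lemma periodic_int:
  assumes "z \<in> hstrip H"
  shows "\<omega> (z + of_int n) = \<omega> z"
proof -
  have nat: "\<omega> (z + of_nat n) = \<omega> z" if "z \<in> hstrip H" for n z
  proof (induction n)
    case (Suc n)
    have "\<omega> (z + of_nat n + 1) = \<omega> (z + of_nat n)"
      by (rule periodic) (use that in \<open>simp add: hstrip_def\<close>)
    then show ?case using Suc by (simp add: add_ac)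
  qed simp
  show ?thesis
  proof (cases n rule: int_cases2)
    case (nonneg m) then show ?thesis using nat[OF assms] by simp
  next
    case (nonpos m)
    then show ?thesis using nat[of "z + of_int n" m] assms by (simp add: hstrip_def)
  qed
qed

text \<open>With e = \<open>per 1\<close>, a zero at \<open>w\<close> is divided out: \<omega> = (e
  - e(w)) \<psi> with \<psi> again holomorphic and periodic. On coefficients the factor acts as a
  weighted difference, so the series at \<open>w\<close> is a difference of one absolutely
  convergent series and its own shift. No summability kernel is involved.\<close>

lemma fourier_series_zero:
  assumes w: "w \<in> hstrip H" "\<omega> w = 0"
  shows "((\<lambda>k. fourier_coeff \<omega> k * per k w) has_sum 0) UNIV"
proof -
  let ?e = "per 1"
  define \<psi> where "\<psi> u = (if ?e u = ?e w then deriv \<omega> u / (2 * complex_of_real pi * \<i> * ?e w) else \<omega> u / (?e u - ?e w))" for u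
  have zero: "\<omega> u = 0" if "?e u = ?e w" for u
  proof -
    have "exp (2 * complex_of_real pi * \<i> * u) = exp (2 * complex_of_real pi * \<i> * w)"
      using that by (simp add: per_def)
    then obtain n :: int where "2 * complex_of_real pi * \<i> * u = 2 * complex_of_real pi * \<i> * w + (of_int (2 * n) * pi) * \<i>"
      unfolding exp_eq by blast
    then have "(2 * complex_of_real pi * \<i>) * u = (2 * complex_of_real pi * \<i>) * (w + of_int n)"
      by (simp add: algebra_simps)
    then have "u = w + of_int n" by (subst (asm) mult_cancel_left) simp
    then show ?thesis using periodic_int[OF w(1)] w(2) by simp
  qed
  have diff: "\<psi> field_differentiable (at u)" if u: "u \<in> hstrip H" for u
  proof (cases "?e u = ?e w")
    case False
    have "open {v. ?e v \<noteq> ?e w}"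
      unfolding per_def by (intro open_Collect_neq continuous_intros)
    then have o: "open (hstrip H \<inter> {v. ?e v \<noteq> ?e w})" using open_hstrip by auto
    have "(\<lambda>v. \<omega> v / (?e v - ?e w)) holomorphic_on (hstrip H \<inter> {v. ?e v \<noteq> ?e w})"
      by (intro holomorphic_intros per_holomorphic holomorphic_on_subset[OF hol]) auto
    then have "\<psi> holomorphic_on (hstrip H \<inter> {v. ?e v \<noteq> ?e w})"
      by (rule holomorphic_transform) (auto simp: \<psi>_def)
    then show ?thesis using o u False by (auto intro: holomorphic_on_imp_differentiable_at)
  next
    case True
    \<comment> \<open>At such a point numerator and denominator of \<psi> both vanish. Their
      difference quotients \<open>a\<close> and \<open>b\<close> are holomorphic, and b(u) = e'(u)
      is nonzero, so a / b continues \<psi> across.\<close>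
    define a where "a v = (if v = u then deriv \<omega> u else (\<omega> v - \<omega> u) / (v - u))" for v
    define b where "b v = (if v = u then deriv ?e u else (?e v - ?e u) / (v - u))" for v
    have a: "a holomorphic_on hstrip H" unfolding a_def by (intro pole_lemma_open hol open_hstrip)
    have b: "b holomorphic_on UNIV" unfolding b_def by (intro pole_lemma_open per_holomorphic) auto
    have bu: "b u = 2 * complex_of_real pi * \<i> * ?e w"
      using DERIV_imp_deriv[OF per_deriv[of 1 u]] True by (simp add: b_def)
    have "continuous_on UNIV b" by (rule holomorphic_on_imp_continuous_on[OF b])
    then have "open {v. b v \<noteq> 0}" by (intro open_Collect_neq) auto
    then have o: "open (hstrip H \<inter> {v. b v \<noteq> 0})" using open_hstrip by auto
    have "(\<lambda>v. a v / b v) holomorphic_on (hstrip H \<inter> {v. b v \<noteq> 0})"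
      by (intro holomorphic_intros holomorphic_on_subset[OF a] holomorphic_on_subset[OF b]) auto
    then have "\<psi> holomorphic_on (hstrip H \<inter> {v. b v \<noteq> 0})"
    proof (rule holomorphic_transform)
      fix v assume v: "v \<in> hstrip H \<inter> {v. b v \<noteq> 0}"
      show "a v / b v = \<psi> v"
      proof (cases "v = u")
        case vu: True
        then show ?thesis using True bu by (simp add: \<psi>_def a_def)
      next
        case vu: False
        then have "?e v \<noteq> ?e w" using v True by (auto simp: b_def)
        then show ?thesis using vu zero[OF True] True by (simp add: \<psi>_def a_def b_def)
      qed
    qed
    then show ?thesis using o u bu by (auto intro: holomorphic_on_imp_differentiable_at)
  qed
  have \<psi>hol: "\<psi> holomorphic_on hstrip H"
    unfolding holomorphic_on_def using diff field_differentiable_at_within by blast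
  have \<psi>per: "\<psi> (u + 1) = \<psi> u" if u: "u \<in> hstrip H" for u
  proof -
    have u1: "u + 1 \<in> hstrip H" using u by (simp add: hstrip_def)
    have "(\<omega> has_field_derivative deriv \<omega> (u + 1)) (at (u + 1))"
      using hol u1 open_hstrip by (auto intro!: holomorphic_derivI)
    then have "((\<lambda>z. \<omega> (z + 1)) has_field_derivative deriv \<omega> (u + 1)) (at u)"
      by (subst (asm) DERIV_shift)
    then have "(\<omega> has_field_derivative deriv \<omega> (u + 1)) (at u)"
      by (rule has_field_derivative_transform_within_open[OF _ open_hstrip u]) (rule periodic)
    then have "deriv \<omega> u = deriv \<omega> (u + 1)" by (rule DERIV_imp_deriv)
    then show ?thesis using periodic[OF u] by (simp add: \<psi>_def)
  qed
  interpret P: periodic_holomorphic \<psi> H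
    by unfold_locales (use H \<psi>hol \<psi>per in auto)
  have rel: "\<omega> u = ?e u * \<psi> u - ?e w * \<psi> u" for u
    using zero[of u] by (auto simp: \<psi>_def field_simps)
  have coeff: "fourier_coeff \<omega> k = fourier_coeff \<psi> (k - 1) - ?e w * fourier_coeff \<psi> k" for k
  proof -
    have c: "continuous_on {0..1} (\<lambda>t::real. \<psi> (of_real t) * per l (of_real t))" for l
      using P.integrand_continuous[of 0 "{0..1}" l] H by simp
    have "fourier_coeff \<omega> k = integral {0..1} (\<lambda>t::real. \<psi> (of_real t) * per (- (k - 1)) (of_real t) - ?e w * (\<psi> (of_real t) * per (- k) (of_real t)))"
    proof -
      have "per (- (k - 1)) z = ?e z * per (- k) z" for z using per_add[of 1 "- k" z] by simp
      then show ?thesis unfolding fourier_coeff_per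
        by (intro integral_cong) (simp add: rel algebra_simps)
    qed
    also have "\<dots> = integral {0..1} (\<lambda>t::real. \<psi> (of_real t) * per (- (k - 1)) (of_real t)) - integral {0..1} (\<lambda>t::real. ?e w * (\<psi> (of_real t) * per (- k) (of_real t)))"
      by (intro Henstock_Kurzweil_Integration.integral_diff integrable_continuous_interval continuous_intros c)
    also have "\<dots> = fourier_coeff \<psi> (k - 1) - ?e w * fourier_coeff \<psi> k"
      unfolding fourier_coeff_per by simp
    finally show ?thesis .
  qed
  define f where "f k = fourier_coeff \<psi> k * per (k + 1) w" for k
  have "(\<lambda>k. fourier_coeff \<psi> k * per k w) summable_on UNIV"
    using P.fourier_terms_summable[OF w(1)] by (rule abs_summable_summable)
  then have "(\<lambda>k. fourier_coeff \<psi> k * per k w * ?e w) summable_on UNIV"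
    by (rule summable_on_cmult_left)
  then have "f summable_on UNIV" by (simp add: f_def[abs_def] per_add mult.assoc)
  then obtain s where s: "(f has_sum s) UNIV" unfolding summable_on_def by blast
  have "((\<lambda>k. f (k - 1)) has_sum s) UNIV"
  proof -
    have bij: "bij_betw (\<lambda>k::int. k - 1) UNIV UNIV"
      by (rule bij_betwI[of _ _ _ "\<lambda>k. k + 1"]) auto
    show ?thesis using has_sum_reindex_bij_betw[OF bij, of f s] s by simp
  qed
  moreover from s have "((\<lambda>k. - f k) has_sum - s) UNIV" by (simp add: has_sum_uminus)
  ultimately have "((\<lambda>k. f (k - 1) + - f k) has_sum s + - s) UNIV" by (rule has_sum_add)
  then have "((\<lambda>k. f (k - 1) - f k) has_sum 0) UNIV" by simp
  moreover have "f (k - 1) - f k = fourier_coeff \<omega> k * per k w" for k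
    unfolding coeff f_def using per_add[of k 1 w] by (simp add: algebra_simps)
  ultimately show ?thesis by simp
qed

end

lemma fourier_coeff_const: "fourier_coeff (\<lambda>_. a) k = (if k = 0 then a else 0)"
proof (cases "k = 0")
  case False
  let ?c = "2 * of_int (- k) * complex_of_real pi * \<i>"
  have c: "?c \<noteq> 0" using False by simp
  have "((\<lambda>t. per (- k) (of_real t) / ?c) has_vector_derivative per (- k) (of_real t)) (at t within {0..1})" for t :: real
  proof -
    have "((\<lambda>z. per (- k) z / ?c) has_field_derivative (?c * per (- k) (of_real t) / ?c)) (at (of_real t))"
      by (intro DERIV_cdivide per_deriv)
    then have "((\<lambda>z. per (- k) z / ?c) has_field_derivative per (- k) (of_real t)) (at (of_real t))"
      using c by simp
    then show ?thesis by (rule has_vector_derivative_real_field)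
  qed
  then have "((\<lambda>t. per (- k) (of_real t)) has_integral (per (- k) (of_real 1) / ?c - per (- k) (of_real 0) / ?c)) {0..1}"
    by (intro fundamental_theorem_of_calculus) auto
  moreover have "per (- k) (of_real 1) = per (- k) (of_real 0)" using per_plus_1[of "- k" 0] by simp
  ultimately have "integral {0..1} (\<lambda>t. per (- k) (of_real t)) = 0" by (simp add: integral_unique)
  then show ?thesis using False by (simp add: fourier_coeff_per)
qed (simp add: fourier_coeff_per)

context periodic_holomorphic
begin

text \<open>Subtracting the constant \<omega>(w) creates the zero required above and alters only the
  coefficient of index 0.\<close>

theorem fourier_series:
  assumes w: "w \<in> hstrip H"
  shows "((\<lambda>k. fourier_coeff \<omega> k * per k w) has_sum \<omega> w) UNIV"
proof -
  let ?v = "\<lambda>z. \<omega> z - \<omega> w"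
  interpret V: periodic_holomorphic ?v H
    by unfold_locales (use H periodic in \<open>auto intro!: holomorphic_intros hol\<close>)
  have 1: "((\<lambda>k. fourier_coeff ?v k * per k w) has_sum 0) UNIV"
    by (rule V.fourier_series_zero[OF w]) simp
  have 2: "((\<lambda>k. fourier_coeff (\<lambda>_. \<omega> w) k * per k w) has_sum \<omega> w) UNIV"
  proof -
    have "((\<lambda>k. fourier_coeff (\<lambda>_. \<omega> w) k * per k w) has_sum (\<Sum>k\<in>{0}. fourier_coeff (\<lambda>_. \<omega> w) k * per k w)) {0}"
      by (rule has_sum_finite) simp
    then show ?thesis
      by (subst (asm) has_sum_cong_neutral[where T = UNIV]) (auto simp: fourier_coeff_const)
  qed
  have "fourier_coeff ?v k + fourier_coeff (\<lambda>_. \<omega> w) k = fourier_coeff \<omega> k" for k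
  proof -
    have c: "(\<lambda>t::real. \<omega> (of_real t) * per (- k) (of_real t)) integrable_on {0..1}"
      using integrand_continuous[of 0 "{0..1}" "- k"] H by (intro integrable_continuous_interval) simp
    have d: "(\<lambda>t::real. \<omega> w * per (- k) (of_real t)) integrable_on {0..1}"
      unfolding per_def by (intro integrable_continuous_interval continuous_intros)
    show ?thesis unfolding fourier_coeff_per left_diff_distrib
      by (subst Henstock_Kurzweil_Integration.integral_diff[OF c d]) simp
  qed
  with has_sum_add[OF 1 2] show ?thesis by (simp flip: distrib_right)
qed

end

subsection \<open>Coefficients of the leading term\<close>

lemma has_sum_tail_bound:
  fixes f :: "'i \<Rightarrow> 'b :: banach"
  assumes f: "(f has_sum a) UNIV" and M: "(M has_sum m) UNIV" and le: "\<And>k. norm (f k) \<le> M k" and S: "finite S"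
  shows "norm (a - sum f S) \<le> m - sum M S"
proof -
  have "f summable_on (- S)" "M summable_on (- S)"
    using f M by (auto intro: summable_on_subset_banach has_sum_imp_summable)
  then obtain a' m' where a': "(f has_sum a') (- S)" and m': "(M has_sum m') (- S)"
    unfolding summable_on_def by blast
  have "(f has_sum (sum f S + a')) (S \<union> - S)" "(M has_sum (sum M S + m')) (S \<union> - S)"
    by (intro has_sum_Un_disjoint a' m' has_sum_finite S; simp)+
  then have "a = sum f S + a'" "m = sum M S + m'"
    using f M has_sum_unique by (auto simp: Compl_partition)
  moreover have "norm a' \<le> m'" by (rule norm_infsum_le[OF a' m' le])
  ultimately show ?thesis by simp
qed

lemma higher_deriv_diff_sum:
  assumes "open U" "z \<in> U" "A holomorphic_on U" "\<And>k. f k holomorphic_on U" "finite S"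
  shows "(deriv ^^ n) (\<lambda>z. A z - (\<Sum>k\<in>S. f k z)) z = (deriv ^^ n) A z - (\<Sum>k\<in>S. (deriv ^^ n) (f k) z)"
  using assms(5)
proof (induction S rule: finite_induct)
  case (insert k S)
  have "(\<lambda>z. A z - (\<Sum>k\<in>insert k S. f k z)) = (\<lambda>z. (A z - (\<Sum>k\<in>S. f k z)) - f k z)"
    using insert(1,2) by (auto simp: algebra_simps)
  then have "(deriv ^^ n) (\<lambda>z. A z - (\<Sum>k\<in>insert k S. f k z)) z = (deriv ^^ n) (\<lambda>z. A z - (\<Sum>k\<in>S. f k z)) z - (deriv ^^ n) (f k) z"
    using higher_deriv_diff[of "\<lambda>z. A z - (\<Sum>k\<in>S. f k z)" U "f k" z n] assms(1-4)
    by (simp add: holomorphic_on_diff holomorphic_on_sum)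
  then show ?case using insert by simp
qed simp

text \<open>Cauchy's inequality on the circle of radius 1/2 bounds the coefficients of
  \<open>A\<close> minus a finite partial sum by the tail of the majorant, which vanishes along the
  finite subsets.\<close>

lemma taylor_coeff_has_sum:
  assumes A: "A holomorphic_on ball 0 1" and f: "\<And>k. f k holomorphic_on ball 0 1"
    and s: "\<And>z. cmod z = 1/2 \<Longrightarrow> ((\<lambda>k. f k z) has_sum A z) UNIV"
    and le: "\<And>k z. cmod z = 1/2 \<Longrightarrow> cmod (f k z) \<le> M k" and M: "M summable_on UNIV"
  shows "((\<lambda>k. (deriv ^^ n) (f k) 0 / fact n) has_sum (deriv ^^ n) A 0 / fact n) UNIV"
proof -
  obtain m where m: "(M has_sum m) UNIV" using M unfolding summable_on_def by blast
  have bound: "cmod ((\<Sum>k\<in>S. (deriv ^^ n) (f k) 0 / fact n) - (deriv ^^ n) A 0 / fact n) \<le> 2 ^ n * (m - sum M S)"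
    if S: "finite S" for S
  proof -
    let ?D = "\<lambda>z. A z - (\<Sum>k\<in>S. f k z)"
    have D: "?D holomorphic_on ball 0 1" by (intro holomorphic_intros A f)
    have "cmod ((deriv ^^ n) ?D 0) \<le> fact n * (m - sum M S) / (1/2) ^ n"
    proof (rule Cauchy_inequality)
      show "?D holomorphic_on ball 0 (1/2)" by (rule holomorphic_on_subset[OF D]) auto
      show "continuous_on (cball 0 (1/2)) ?D" by (rule holomorphic_on_imp_continuous_on, rule holomorphic_on_subset[OF D]) auto
      show "cmod (?D z) \<le> m - sum M S" if "cmod (0 - z) = 1/2" for z
        by (rule has_sum_tail_bound[OF s m le S]) (use that in auto)
    qed simp
    also have "(deriv ^^ n) ?D 0 = (deriv ^^ n) A 0 - (\<Sum>k\<in>S. (deriv ^^ n) (f k) 0)"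
      by (rule higher_deriv_diff_sum[of "ball 0 1"]) (use A f S in auto)
    finally have "cmod ((deriv ^^ n) A 0 - (\<Sum>k\<in>S. (deriv ^^ n) (f k) 0)) / fact n \<le> (fact n * (m - sum M S) / (1/2) ^ n) / fact n"
      by (rule divide_right_mono) simp
    also have "\<dots> = 2 ^ n * (m - sum M S)" by (simp add: power_divide)
    also have "cmod ((deriv ^^ n) A 0 - (\<Sum>k\<in>S. (deriv ^^ n) (f k) 0)) / fact n = cmod (((deriv ^^ n) A 0 - (\<Sum>k\<in>S. (deriv ^^ n) (f k) 0)) / fact n)"
      by (simp add: norm_divide)
    also have "((deriv ^^ n) A 0 - (\<Sum>k\<in>S. (deriv ^^ n) (f k) 0)) / fact n = (deriv ^^ n) A 0 / fact n - (\<Sum>k\<in>S. (deriv ^^ n) (f k) 0 / fact n)"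
      by (simp add: diff_divide_distrib sum_divide_distrib)
    finally show ?thesis by (simp add: norm_minus_commute)
  qed
  have "((\<lambda>S. 2 ^ n * (m - sum M S)) \<longlongrightarrow> 2 ^ n * (m - m)) (finite_subsets_at_top UNIV)"
    using m unfolding has_sum_def by (intro tendsto_intros)
  then have lim: "((\<lambda>S. 2 ^ n * (m - sum M S)) \<longlongrightarrow> 0) (finite_subsets_at_top UNIV)" by simp
  have "((\<lambda>S. (\<Sum>k\<in>S. (deriv ^^ n) (f k) 0 / fact n) - (deriv ^^ n) A 0 / fact n) \<longlongrightarrow> 0) (finite_subsets_at_top UNIV)"
    by (rule Lim_null_comparison[OF _ lim]) (auto intro!: eventually_finite_subsets_at_top_weakI bound)
  then show ?thesis unfolding has_sum_def by (rule Lim_null[THEN iffD2])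
qed

lemma one_minus_notin: "cmod z < 1 \<Longrightarrow> 1 - z \<notin> \<real>\<^sub>\<le>\<^sub>0"
  using complex_Re_le_cmod[of z] by (auto simp: complex_nonpos_Reals_iff)

lemma powr_taylor:
  assumes "cmod z < 1"
  shows "(deriv ^^ n) (\<lambda>z. (1 - z) powr (- s)) z = pochhammer s n * (1 - z) powr (- s - of_nat n)"
  using assms
proof (induction n arbitrary: z)
  case (Suc n)
  have o: "open {z. cmod z < 1}" by (intro open_Collect_less continuous_intros)
  have "((\<lambda>z. pochhammer s n * (1 - z) powr (- s - of_nat n)) has_field_derivative
     pochhammer s n * (- (- s - of_nat n) * (1 - z) powr (- s - of_nat n - 1))) (at z)"
    using one_minus_notin[OF Suc.prems] by (auto intro!: derivative_eq_intros simp: algebra_simps)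
  then have "((deriv ^^ n) (\<lambda>z. (1 - z) powr (- s)) has_field_derivative
     pochhammer s n * (- (- s - of_nat n) * (1 - z) powr (- s - of_nat n - 1))) (at z)"
    by (rule has_field_derivative_transform_within_open[OF _ o]) (use Suc in auto)
  then have "deriv ((deriv ^^ n) (\<lambda>z. (1 - z) powr (- s))) z = pochhammer s n * (- (- s - of_nat n) * (1 - z) powr (- s - of_nat n - 1))"
    by (rule DERIV_imp_deriv)
  then show ?case by (simp add: pochhammer_Suc algebra_simps)
qed simp

section \<open>Fourier expansion of the leading term and the asymptotics of its coefficients\<close>

locale log_periodic =
  fixes \<omega> :: "complex \<Rightarrow> complex" and b :: real and \<alpha> :: real
  assumes b: "b > 0"
    and periodic_hol: "periodic_holomorphic \<omega> (pi / b)"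
begin

sublocale periodic_holomorphic \<omega> "pi / b" by (rule periodic_hol)

text \<open>The index is reversed because mode -k in log (1 - z) turns into mode k in log n: the
  summand is (1 - z)^(-s) with s = \<open>expo k\<close>, and its n-th coefficient behaves like n^(s
  - 1).\<close>

definition coef :: "int \<Rightarrow> complex" where "coef k = fourier_coeff \<omega> (- k)"
definition ord :: "int \<Rightarrow> real" where "ord k = 2 * pi * real_of_int k / b"
definition expo :: "int \<Rightarrow> complex" where "expo k = Complex (- \<alpha>) (ord k)"
definition lead :: "complex \<Rightarrow> complex" where
  "lead z = (1 - z) powr of_real \<alpha> * \<omega> (Ln (1 - z) / of_real b)"
definition profile :: "complex \<Rightarrow> complex" where
  "profile z = (\<Sum>\<^sub>\<infinity>k. coef k * rGamma (expo k) * per k z)"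

text \<open>Put q = pi / (2 b). The coefficients decay at every rate 2 pi h1 with h1 < 2 q and the
  Gamma factor grows at the rate 2 pi q, so an additional growth 2 pi h still fits exactly when h <
  q.\<close>

lemma coef_summable:
  assumes h: "h < pi / (2 * b)"
  shows "(\<lambda>k. cmod (coef k) * ((1 + \<bar>ord k\<bar>) ^ m * exp (pi * \<bar>ord k\<bar> / 2) * exp (2 * pi * h * \<bar>real_of_int k\<bar>))) summable_on UNIV"
proof -
  define q where "q = pi / (2 * b)"
  \<comment> \<open>The midpoint between h + q and 2 q; the maximum with 0 only matters for very
    negative \<open>h\<close>.\<close>
  define h1 where "h1 = max 0 ((h + 3 * q) / 2)"
  have q: "q > 0" "pi / b = 2 * q" "h < q" using b h by (auto simp: q_def)
  have h1: "0 \<le> h1" "h1 < pi / b" "h1 > h + q" using q by (auto simp: h1_def less_max_iff_disj)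
  define e where "e = 2 * pi * (h1 - h - q)"
  have e: "e > 0" using h1 by (simp add: e_def)
  obtain M where M: "M \<ge> 0" "\<And>k. cmod (fourier_coeff \<omega> k) \<le> M * exp (- (2 * pi * h1 * \<bar>real_of_int k\<bar>))"
    using fourier_coeff_decay[OF h1(1,2)] by blast
  \<comment> \<open>Chosen so that the polynomial factor uses up half of the surplus
    \<open>e\<close>.\<close>
  define c where "c = e * b / (4 * pi)"
  have c: "c > 0" using e b by (simp add: c_def)
  obtain K where K: "K \<ge> 0" "\<And>x. x \<ge> 0 \<Longrightarrow> (1 + x) ^ m \<le> K * exp (c * x)" using poly_le_exp[OF c] by blast
  have o: "\<bar>ord k\<bar> = 2 * pi / b * \<bar>real_of_int k\<bar>" for k using b by (simp add: ord_def abs_mult)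
  have "(\<lambda>k::int. (M * K) * exp (- ((e / 2) * \<bar>real_of_int k\<bar>))) summable_on UNIV"
    by (intro summable_on_cmult_right summable_exp_int) (use e in simp)
  then show ?thesis
  proof (rule summable_on_comparison_test)
    fix k :: int
    let ?x = "\<bar>real_of_int k\<bar>"
    have "(1 + \<bar>ord k\<bar>) ^ m \<le> K * exp (c * \<bar>ord k\<bar>)" by (rule K(2)) simp
    also have "c * \<bar>ord k\<bar> = e / 2 * ?x" using b by (simp add: o c_def)
    finally have 1: "(1 + \<bar>ord k\<bar>) ^ m \<le> K * exp (e / 2 * ?x)" .
    have 2: "cmod (coef k) \<le> M * exp (- (2 * pi * h1 * ?x))" using M(2)[of "- k"] by (simp add: coef_def)
    have "cmod (coef k) * ((1 + \<bar>ord k\<bar>) ^ m * exp (pi * \<bar>ord k\<bar> / 2) * exp (2 * pi * h * ?x))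
       \<le> (M * exp (- (2 * pi * h1 * ?x))) * ((K * exp (e / 2 * ?x)) * exp (pi * \<bar>ord k\<bar> / 2) * exp (2 * pi * h * ?x))"
      by (intro mult_mono mult_right_mono 1 2) (use M K in auto)
    also have "\<dots> = (M * K) * exp (- (2 * pi * h1 * ?x) + e / 2 * ?x + pi * \<bar>ord k\<bar> / 2 + 2 * pi * h * ?x)"
      unfolding exp_add by (simp only: mult_ac)
    also have "- (2 * pi * h1 * ?x) + e / 2 * ?x + pi * \<bar>ord k\<bar> / 2 + 2 * pi * h * ?x = - ((e / 2) * ?x)"
      using b by (simp add: o e_def q_def algebra_simps)
    finally show "cmod (coef k) * ((1 + \<bar>ord k\<bar>) ^ m * exp (pi * \<bar>ord k\<bar> / 2) * exp (2 * pi * h * ?x)) \<le> (M * K) * exp (- ((e / 2) * ?x))" .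
  qed auto
qed

text \<open>The rate estimate at n = 1 is enough, since \<open>binseq s 1\<close> is s.\<close>

lemma rGamma_bound:
  "\<exists>C m. C \<ge> 0 \<and> (\<forall>k. cmod (rGamma (expo k)) \<le> C * (1 + \<bar>ord k\<bar>) ^ m * exp (pi * \<bar>ord k\<bar> / 2))"
proof -
  obtain C m where C: "C \<ge> 0" "\<And>y n. n \<ge> 1 \<Longrightarrow>
     cmod (binseq (Complex (- \<alpha>) y) n - rGamma (Complex (- \<alpha>) y)) \<le> C * (1 + \<bar>y\<bar>) ^ m * exp (pi * \<bar>y\<bar> / 2) / real n"
    using binseq_rate[of "- \<alpha>"] by auto
  have "cmod (rGamma (expo k)) \<le> (C + (1 + \<bar>\<alpha>\<bar>)) * (1 + \<bar>ord k\<bar>) ^ (m + 1) * exp (pi * \<bar>ord k\<bar> / 2)" for k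
  proof -
    let ?y = "\<bar>ord k\<bar>" let ?E = "exp (pi * ?y / 2)"
    have E: "?E \<ge> 1" by simp
    have p: "(1 + ?y) ^ m \<le> (1 + ?y) ^ (m + 1)" "(1 + ?y) ^ 1 \<le> (1 + ?y) ^ (m + 1)" by (intro power_increasing; simp)+
    have "cmod (rGamma (expo k)) \<le> cmod (binseq (expo k) 1 - rGamma (expo k)) + cmod (binseq (expo k) 1)"
      by (metis add.commute norm_minus_commute norm_triangle_sub)
    also have "cmod (binseq (expo k) 1 - rGamma (expo k)) \<le> C * (1 + ?y) ^ m * ?E"
      using C(2)[of 1 "ord k"] by (simp add: expo_def)
    also have "\<dots> \<le> C * (1 + ?y) ^ (m + 1) * ?E" by (intro mult_right_mono mult_left_mono p C(1)) auto
    also have "cmod (binseq (expo k) 1) \<le> \<bar>\<alpha>\<bar> + ?y" using cmod_le[of "expo k"] by (simp add: binseq_def expo_def)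
    also have "\<dots> \<le> (1 + \<bar>\<alpha>\<bar>) * (1 + ?y) ^ 1" by (simp add: algebra_simps)
    also have "\<dots> \<le> (1 + \<bar>\<alpha>\<bar>) * (1 + ?y) ^ (m + 1)" by (intro mult_left_mono p) simp
    also have "\<dots> \<le> (1 + \<bar>\<alpha>\<bar>) * (1 + ?y) ^ (m + 1) * ?E"
      using mult_left_mono[OF E, of "(1 + \<bar>\<alpha>\<bar>) * (1 + ?y) ^ (m + 1)"] by simp
    finally show ?thesis by (simp only: distrib_right)
  qed
  moreover have "C + (1 + \<bar>\<alpha>\<bar>) \<ge> 0" using C(1) by simp
  ultimately show ?thesis by blast
qed

lemma profile_bound:
  assumes h: "h < pi / (2 * b)"
  shows "\<exists>M. M summable_on UNIV \<and> (\<forall>k z. \<bar>Im z\<bar> \<le> h \<longrightarrow> cmod (coef k * rGamma (expo k) * per k z) \<le> M k)"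
proof -
  obtain C m where C: "C \<ge> 0" "\<And>k. cmod (rGamma (expo k)) \<le> C * (1 + \<bar>ord k\<bar>) ^ m * exp (pi * \<bar>ord k\<bar> / 2)"
    using rGamma_bound by blast
  let ?M = "\<lambda>k. C * (cmod (coef k) * ((1 + \<bar>ord k\<bar>) ^ m * exp (pi * \<bar>ord k\<bar> / 2) * exp (2 * pi * h * \<bar>real_of_int k\<bar>)))"
  have "?M summable_on UNIV" by (intro summable_on_cmult_right coef_summable h)
  moreover have "cmod (coef k * rGamma (expo k) * per k z) \<le> ?M k" if z: "\<bar>Im z\<bar> \<le> h" for k z
  proof -
    have "- (real_of_int k * Im z) \<le> \<bar>real_of_int k\<bar> * \<bar>Im z\<bar>" by (metis abs_ge_minus_self abs_mult)
    also have "\<dots> \<le> \<bar>real_of_int k\<bar> * h" using z by (intro mult_left_mono) auto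
    finally have "2 * pi * (- (real_of_int k * Im z)) \<le> 2 * pi * (\<bar>real_of_int k\<bar> * h)" by (intro mult_left_mono) auto
    then have "cmod (per k z) \<le> exp (2 * pi * h * \<bar>real_of_int k\<bar>)" by (simp add: norm_per mult_ac)
    then have "cmod (coef k) * cmod (rGamma (expo k)) * cmod (per k z) \<le>
      cmod (coef k) * (C * (1 + \<bar>ord k\<bar>) ^ m * exp (pi * \<bar>ord k\<bar> / 2)) * exp (2 * pi * h * \<bar>real_of_int k\<bar>)"
      using C by (intro mult_mono mult_left_mono) auto
    then show ?thesis by (simp add: norm_mult mult_ac)
  qed
  ultimately show ?thesis by blast
qed

lemma profile_has_sum:
  assumes z: "z \<in> hstrip (pi / (2 * b))"
  shows "((\<lambda>k. coef k * rGamma (expo k) * per k z) has_sum profile z) UNIV"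
proof -
  obtain M where M: "M summable_on UNIV" "\<And>k. cmod (coef k * rGamma (expo k) * per k z) \<le> M k"
    using profile_bound[of "\<bar>Im z\<bar>"] z by (auto simp: hstrip_def)
  have "(\<lambda>k. cmod (coef k * rGamma (expo k) * per k z)) summable_on UNIV"
    by (rule Infinite_Sum.abs_summable_on_comparison_test'[OF M(1)]) (rule M(2))
  then have "(\<lambda>k. coef k * rGamma (expo k) * per k z) summable_on UNIV" by (rule abs_summable_summable)
  then show ?thesis unfolding profile_def by (rule has_sum_infsum)
qed

lemma profile_plus_1: "profile (z + 1) = profile z"
  by (simp add: profile_def)

lemma profile_holomorphic: "profile holomorphic_on hstrip (pi / (2 * b))"
proof -
  have "\<exists>r>0. profile holomorphic_on ball z r" if z: "z \<in> hstrip (pi / (2 * b))" for z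
  proof -
    define h where "h = (\<bar>Im z\<bar> + pi / (2 * b)) / 2"
    have h: "h < pi / (2 * b)" "h - \<bar>Im z\<bar> > 0" using z by (auto simp: h_def hstrip_def)
    obtain M where M: "M summable_on UNIV" "\<And>k u. \<bar>Im u\<bar> \<le> h \<Longrightarrow> cmod (coef k * rGamma (expo k) * per k u) \<le> M k"
      using profile_bound[OF h(1)] by blast
    let ?r = "h - \<bar>Im z\<bar>"
    have "uniform_limit (cball z ?r) (\<lambda>X u. \<Sum>k\<in>X. coef k * rGamma (expo k) * per k u) (\<lambda>u. \<Sum>\<^sub>\<infinity>k. coef k * rGamma (expo k) * per k u) (finite_subsets_at_top UNIV)"
    proof (rule Weierstrass_m_test_general[OF _ M(1)])
      fix k u assume "u \<in> cball z ?r"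
      then have "cmod (z - u) \<le> ?r" by (simp add: dist_norm)
      then have "\<bar>Im (z - u)\<bar> \<le> ?r" using abs_Im_le_cmod[of "z - u"] by linarith
      then have "\<bar>Im u\<bar> \<le> h" by auto
      then show "cmod (coef k * rGamma (expo k) * per k u) \<le> M k" by (rule M(2))
    qed
    then obtain "profile holomorphic_on ball z ?r"
      unfolding profile_def[abs_def]
      by (rule holomorphic_uniform_limit[rotated])
         (auto intro!: always_eventually holomorphic_intros per_holomorphic holomorphic_on_imp_continuous_on)
    then show ?thesis using h by blast
  qed
  then show ?thesis
    by (meson centre_in_ball holomorphic_on_imp_differentiable_at holomorphic_onI open_ball field_differentiable_at_within holomorphic_on_def)
qed

lemma strip_Ln: "w \<notin> \<real>\<^sub>\<le>\<^sub>0 \<Longrightarrow> Ln w / of_real b \<in> hstrip (pi / b)"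
proof -
  assume w: "w \<notin> \<real>\<^sub>\<le>\<^sub>0"
  then have "\<bar>Im (Ln w)\<bar> < pi" by (metis Im_Ln_less_pi Im_Ln_eq_pi abs_less_iff minus_less_iff mpi_less_Im_Ln nonpos_Reals_zero_I)
  then show ?thesis using b by (simp add: hstrip_def Im_divide_of_real abs_divide divide_strict_right_mono)
qed

lemma lead_holomorphic: "lead holomorphic_on {z. 1 - z \<notin> \<real>\<^sub>\<le>\<^sub>0}"
proof -
  have "(\<lambda>z. \<omega> (Ln (1 - z) / of_real b)) holomorphic_on {z. 1 - z \<notin> \<real>\<^sub>\<le>\<^sub>0}"
  proof (rule holomorphic_on_compose_gen[unfolded o_def, where g = \<omega> and t = "hstrip (pi / b)"])
    show "(\<lambda>z. Ln (1 - z) / of_real b) holomorphic_on {z. 1 - z \<notin> \<real>\<^sub>\<le>\<^sub>0}"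
      using b by (intro holomorphic_intros) auto
  qed (use hol strip_Ln in auto)
  then show ?thesis unfolding lead_def by (intro holomorphic_intros) auto
qed

lemma ball_subset: "ball 0 1 \<subseteq> {z :: complex. 1 - z \<notin> \<real>\<^sub>\<le>\<^sub>0}"
  using one_minus_notin by (simp add: subset_iff dist_norm)

lemma lead_term:
  assumes "1 - z \<noteq> 0"
  shows "(1 - z) powr of_real \<alpha> * per (- k) (Ln (1 - z) / of_real b) = (1 - z) powr (- expo k)"
proof -
  have "- expo k = of_real \<alpha> - \<i> * of_real (ord k)" by (simp add: expo_def complex_eq_iff)
  then have "(1 - z) powr (- expo k) = (1 - z) powr of_real \<alpha> * exp (- (\<i> * of_real (ord k)) * Ln (1 - z))"
    using assms by (simp add: powr_def exp_add exp_diff exp_minus left_diff_distrib field_simps)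
  also have "exp (- (\<i> * of_real (ord k)) * Ln (1 - z)) = per (- k) (Ln (1 - z) / of_real b)"
    unfolding per_def ord_def by (rule arg_cong[of _ _ exp]) (use b in \<open>simp add: field_simps\<close>)
  finally show ?thesis by simp
qed

lemma lead_has_sum:
  assumes z: "1 - z \<notin> \<real>\<^sub>\<le>\<^sub>0"
  shows "((\<lambda>k. coef k * (1 - z) powr (- expo k)) has_sum lead z) UNIV"
proof -
  have nz: "1 - z \<noteq> 0" using z by auto
  have "((\<lambda>k. fourier_coeff \<omega> k * per k (Ln (1 - z) / of_real b)) has_sum \<omega> (Ln (1 - z) / of_real b)) UNIV"
    by (rule fourier_series[OF strip_Ln[OF z]])
  then have "((\<lambda>k. fourier_coeff \<omega> (- k) * per (- k) (Ln (1 - z) / of_real b)) has_sum \<omega> (Ln (1 - z) / of_real b)) UNIV"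
    using has_sum_reindex_bij_betw[of "uminus :: int \<Rightarrow> int" UNIV UNIV "\<lambda>k. fourier_coeff \<omega> k * per k (Ln (1 - z) / of_real b)"]
    by (simp add: bij_uminus)
  from has_sum_cmult_right[OF this, of "(1 - z) powr of_real \<alpha>"]
  show ?thesis unfolding lead_def coef_def
    by (simp add: lead_term[OF nz, symmetric] mult_ac)
qed

lemma lead_coeff_has_sum:
  "((\<lambda>k. coef k * (pochhammer (expo k) n / fact n)) has_sum ((deriv ^^ n) lead 0 / fact n)) UNIV"
proof -
  let ?f = "\<lambda>k z. coef k * (1 - z) powr (- expo k)"
  let ?M = "\<lambda>k. 2 powr \<bar>\<alpha>\<bar> * (cmod (coef k) * ((1 + \<bar>ord k\<bar>) ^ 0 * exp (pi * \<bar>ord k\<bar> / 2) * exp (2 * pi * 0 * \<bar>real_of_int k\<bar>)))"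
  have "((\<lambda>k. (deriv ^^ n) (?f k) 0 / fact n) has_sum ((deriv ^^ n) lead 0 / fact n)) UNIV"
  proof (rule taylor_coeff_has_sum[where M = ?M])
    show "lead holomorphic_on ball 0 1" by (rule holomorphic_on_subset[OF lead_holomorphic ball_subset])
    show "?f k holomorphic_on ball 0 1" for k using one_minus_notin by (intro holomorphic_intros) auto
    show "((\<lambda>k. ?f k z) has_sum lead z) UNIV" if "cmod z = 1/2" for z
      by (rule lead_has_sum[OF one_minus_notin]) (use that in simp)
    show "?M summable_on UNIV" using b by (intro summable_on_cmult_right coef_summable) auto
    fix k z assume z: "cmod z = 1/2"
    define u where "u = 1 - z"
    have Reu: "Re u > 0" using z complex_Re_le_cmod[of z] by (simp add: u_def)
    then have u0: "u \<noteq> 0" by auto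
    have u1: "cmod u \<le> 2" "1 \<le> 2 * cmod u"
      using norm_triangle_ineq4[of 1 z] norm_triangle_ineq2[of 1 z] z by (auto simp: u_def)
    \<comment> \<open>The right half plane limits the argument to pi / 2, so the imaginary part of
      the exponent costs no more than the factor that the coefficients can absorb.\<close>
    have "\<bar>Im (Ln u)\<bar> \<le> pi / 2" using Reu Re_Ln_pos_le[OF u0] by simp
    then have "ord k * Im (Ln u) \<le> \<bar>ord k\<bar> * (pi / 2)"
      by (metis abs_ge_self abs_ge_zero abs_mult mult_left_mono order_trans)
    then have "cmod (u powr (- expo k)) \<le> exp (\<alpha> * ln (cmod u) + pi * \<bar>ord k\<bar> / 2)"
      using u0 by (simp add: powr_def expo_def mult_ac)
    also have "\<dots> = cmod u powr \<alpha> * exp (pi * \<bar>ord k\<bar> / 2)" using u0 by (simp add: powr_def exp_add)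
    also have "cmod u powr \<alpha> \<le> 2 powr \<bar>\<alpha>\<bar> * 1 powr \<alpha>" using u0 u1 by (intro powr_le_scaled) auto
    finally have "cmod (u powr (- expo k)) \<le> 2 powr \<bar>\<alpha>\<bar> * exp (pi * \<bar>ord k\<bar> / 2)" by simp
    then have "cmod (coef k) * cmod (u powr (- expo k)) \<le> cmod (coef k) * (2 powr \<bar>\<alpha>\<bar> * exp (pi * \<bar>ord k\<bar> / 2))"
      by (rule mult_left_mono) simp
    then show "cmod (?f k z) \<le> ?M k" by (simp add: norm_mult u_def mult_ac)
  qed
  moreover have "(deriv ^^ n) (?f k) 0 = coef k * pochhammer (expo k) n" for k
  proof -
    have "(deriv ^^ n) (?f k) 0 = coef k * (deriv ^^ n) (\<lambda>z. (1 - z) powr (- expo k)) 0"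
      by (rule higher_deriv_cmult[of _ "ball 0 1"]) (use one_minus_notin in \<open>auto intro!: holomorphic_intros\<close>)
    then show ?thesis by (simp add: powr_taylor)
  qed
  ultimately show ?thesis by simp
qed

text \<open>n^(s - 1) for s = \<open>expo k\<close> is n^(-\<alpha> - 1) times \<open>per k\<close>
  at log n / b, so the limits of the normalised coefficients add up to \<open>profile\<close>, and
  the errors of relative size 1/n are summed against the coefficients.\<close>

theorem lead_coeff_asymp:
  "\<exists>C. \<forall>n\<ge>1. cmod ((deriv ^^ n) lead 0 / fact n - of_real (real n powr (- \<alpha> - 1)) * profile (of_real (ln (real n) / b)))
     \<le> C * real n powr (- \<alpha> - 2)"
proof -
  obtain C m where C: "C \<ge> 0" "\<And>y n. n \<ge> 1 \<Longrightarrow>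
     cmod (binseq (Complex (- \<alpha>) y) n - rGamma (Complex (- \<alpha>) y)) \<le> C * (1 + \<bar>y\<bar>) ^ m * exp (pi * \<bar>y\<bar> / 2) / real n"
    using binseq_rate[of "- \<alpha>"] by auto
  let ?M = "\<lambda>k. cmod (coef k) * ((1 + \<bar>ord k\<bar>) ^ m * exp (pi * \<bar>ord k\<bar> / 2) * exp (2 * pi * 0 * \<bar>real_of_int k\<bar>))"
  have "?M summable_on UNIV" by (rule coef_summable) (use b in simp)
  then obtain s where s: "(?M has_sum s) UNIV" unfolding summable_on_def by blast
  have "cmod ((deriv ^^ n) lead 0 / fact n - of_real (real n powr (- \<alpha> - 1)) * profile (of_real (ln (real n) / b)))
     \<le> (C * s) * real n powr (- \<alpha> - 2)" if n: "n \<ge> 1" for n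
  proof -
    let ?x = "complex_of_real (ln (real n) / b)" and ?p = "complex_of_real (real n powr (- \<alpha> - 1))"
    have x: "?x \<in> hstrip (pi / (2 * b))" using b by (simp add: hstrip_def)
    have np: "of_nat n powr (expo k - 1) = ?p * per k ?x" for k
    proof -
      have "expo k = \<i> * of_real (ord k) - of_real \<alpha>" by (simp add: expo_def complex_eq_iff)
      have "of_nat n powr (\<i> * of_real (ord k) - of_real \<alpha> - 1) = of_nat n powr of_real (- \<alpha> - 1) * exp (\<i> * of_real (ord k) * of_real (ln (real n)))"
        using n by (simp add: powr_def Ln_of_nat algebra_simps flip: exp_add)
      also have "of_nat n powr of_real (- \<alpha> - 1) = ?p" by (metis of_real_of_nat_eq powr_of_real of_nat_0_le_iff)
      also have "exp (\<i> * of_real (ord k) * of_real (ln (real n))) = per k ?x"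
        unfolding per_def ord_def by (rule arg_cong[of _ _ exp]) (use b in \<open>simp add: field_simps\<close>)
      finally show ?thesis by (simp only: \<open>expo k = _\<close>)
    qed
    have poch: "pochhammer (expo k) n / fact n = ?p * per k ?x * binseq (expo k) n" for k
      using n by (simp add: binseq_def np)
    have "((\<lambda>k. ?p * (coef k * rGamma (expo k) * per k ?x)) has_sum (?p * profile ?x)) UNIV"
      by (intro has_sum_cmult_right profile_has_sum x)
    then have "((\<lambda>k. - (?p * (coef k * rGamma (expo k) * per k ?x))) has_sum - (?p * profile ?x)) UNIV"
      by (rule has_sum_uminusI)
    from has_sum_add[OF lead_coeff_has_sum[of n] this]
    have d: "((\<lambda>k. coef k * (pochhammer (expo k) n / fact n) + - (?p * (coef k * rGamma (expo k) * per k ?x))) has_sum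
       ((deriv ^^ n) lead 0 / fact n + - (?p * profile ?x))) UNIV" .
    have "cmod ((deriv ^^ n) lead 0 / fact n + - (?p * profile ?x)) \<le> C * real n powr (- \<alpha> - 2) * s"
    proof (rule norm_infsum_le[OF d has_sum_cmult_right[OF s]])
      fix k
      have "coef k * (pochhammer (expo k) n / fact n) + - (?p * (coef k * rGamma (expo k) * per k ?x))
         = coef k * ?p * per k ?x * (binseq (expo k) n - rGamma (expo k))"
        unfolding poch by (simp add: algebra_simps)
      also have "cmod \<dots> = cmod (coef k) * real n powr (- \<alpha> - 1) * cmod (binseq (expo k) n - rGamma (expo k))"
        by (simp add: norm_mult norm_per)
      also have "\<dots> \<le> cmod (coef k) * real n powr (- \<alpha> - 1) * (C * (1 + \<bar>ord k\<bar>) ^ m * exp (pi * \<bar>ord k\<bar> / 2) / real n)"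
        using C(2)[OF n, of "ord k"] by (intro mult_left_mono) (auto simp: expo_def)
      also have "\<dots> = C * (real n powr (- \<alpha> - 1) / real n) * ?M k" by simp
      also have "real n powr (- \<alpha> - 1) / real n = real n powr (- \<alpha> - 2)"
        using powr_diff[of "real n" "- \<alpha> - 1" 1] n by (simp add: algebra_simps)
      finally show "cmod (coef k * (pochhammer (expo k) n / fact n) + - (?p * (coef k * rGamma (expo k) * per k ?x)))
        \<le> C * real n powr (- \<alpha> - 2) * ?M k" .
    qed
    then show ?thesis by (simp add: mult_ac)
  qed
  then show ?thesis by blast
qed

end

subsection \<open>Spectrum of the simple random walk\<close>

lemma adj_sym: "adj X x y \<longleftrightarrow> adj X y x"
  by (simp add: adj_def insert_commute)

lemma adj_verts:
  assumes "simple_graph X" "adj X x y"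
  shows "x \<in> verts X" "y \<in> verts X" "x \<noteq> y"
  using assms unfolding simple_graph_def adj_def by (force simp: doubleton_eq_iff)+

lemma nbrs_iff: "simple_graph X \<Longrightarrow> y \<in> nbrs X x \<longleftrightarrow> adj X x y"
  by (auto simp: nbrs_def dest: adj_verts)

locale bounded_graph =
  fixes X :: "'a graph" and k :: nat
  assumes simple: "simple_graph X"
    and fin_nbrs: "\<And>x. x \<in> verts X \<Longrightarrow> finite (nbrs X x)"
    and deg_pos: "\<And>x. x \<in> verts X \<Longrightarrow> deg X x > 0"
    and deg_le: "\<And>x. x \<in> verts X \<Longrightarrow> deg X x \<le> k"
begin

definition supp :: "('a \<Rightarrow> real) \<Rightarrow> 'a set" where "supp f = {x. f x \<noteq> 0}"
definition fin_supp :: "('a \<Rightarrow> real) \<Rightarrow> bool" where "fin_supp f \<longleftrightarrow> finite (supp f) \<and> supp f \<subseteq> verts X"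
text \<open>Weighting by the degree makes the walk operator \<open>avg\<close> symmetric.\<close>

definition ip :: "('a \<Rightarrow> real) \<Rightarrow> ('a \<Rightarrow> real) \<Rightarrow> real" where
  "ip f g = (\<Sum>x\<in>supp f. real (deg X x) * f x * g x)"
definition avg :: "('a \<Rightarrow> real) \<Rightarrow> 'a \<Rightarrow> real" where
  "avg f x = (\<Sum>w\<in>nbrs X x. 1 / real (deg X x) * f w)"
definition total :: "('a \<Rightarrow> real) \<Rightarrow> real" where "total f = sum f (supp f)"
definition nbr_sum :: "('a \<Rightarrow> real) \<Rightarrow> 'a \<Rightarrow> real" where "nbr_sum f x = (\<Sum>w\<in>nbrs X x. f w)"

lemma fin_nbrs': "finite (nbrs X x)"
proof (cases "x \<in> verts X")
  case False
  then have "nbrs X x = {}" using nbrs_iff[OF simple] adj_verts[OF simple] by blast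
  then show ?thesis by simp
qed (rule fin_nbrs)

lemma deg_times_avg: "real (deg X x) * avg f x = nbr_sum f x"
proof (cases "deg X x = 0")
  case True
  then have "nbrs X x = {}" using fin_nbrs' by (simp add: deg_def)
  then show ?thesis by (simp add: nbr_sum_def True)
next
  case False
  then show ?thesis by (simp add: avg_def nbr_sum_def sum_divide_distrib[symmetric])
qed

lemma ip_eq: "finite A \<Longrightarrow> supp f \<subseteq> A \<Longrightarrow> ip f g = (\<Sum>x\<in>A. real (deg X x) * f x * g x)"
  unfolding ip_def by (rule sum.mono_neutral_left) (auto simp: supp_def)

lemma total_eq: "finite A \<Longrightarrow> supp f \<subseteq> A \<Longrightarrow> total f = sum f A"
  unfolding total_def by (rule sum.mono_neutral_left) (auto simp: supp_def)

lemma ip_sym: "fin_supp f \<Longrightarrow> fin_supp g \<Longrightarrow> ip f g = ip g f"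
  using ip_eq[of "supp f \<union> supp g" f g] ip_eq[of "supp f \<union> supp g" g f]
  by (simp add: fin_supp_def mult_ac)

lemma fin_supp_add: "fin_supp f \<Longrightarrow> fin_supp g \<Longrightarrow> fin_supp (\<lambda>x. f x + g x)"
proof -
  assume "fin_supp f" "fin_supp g"
  moreover have "supp (\<lambda>x. f x + g x) \<subseteq> supp f \<union> supp g" by (auto simp: supp_def)
  ultimately show ?thesis unfolding fin_supp_def by (meson finite_UnI finite_subset le_sup_iff order_trans)
qed

lemma fin_supp_scale: "fin_supp f \<Longrightarrow> fin_supp (\<lambda>x. c * f x)"
  unfolding fin_supp_def by (auto simp: supp_def elim: finite_subset[rotated])

lemma ip_add_left: "fin_supp f \<Longrightarrow> fin_supp g \<Longrightarrow> ip (\<lambda>x. f x + g x) h = ip f h + ip g h"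
proof -
  assume a: "fin_supp f" "fin_supp g"
  let ?A = "supp f \<union> supp g"
  have "supp (\<lambda>x. f x + g x) \<subseteq> ?A" by (auto simp: supp_def)
  then show ?thesis using a ip_eq[of ?A f h] ip_eq[of ?A g h] ip_eq[of ?A "\<lambda>x. f x + g x" h]
    by (simp add: fin_supp_def sum.distrib algebra_simps)
qed

lemma ip_scale_left: "fin_supp f \<Longrightarrow> ip (\<lambda>x. c * f x) h = c * ip f h"
proof -
  assume a: "fin_supp f"
  have "supp (\<lambda>x. c * f x) \<subseteq> supp f" by (auto simp: supp_def)
  then show ?thesis using a ip_eq[of "supp f" "\<lambda>x. c * f x" h]
    by (simp add: fin_supp_def ip_def sum_distrib_left mult_ac)
qed

lemma supp_nbr_sum: "supp (nbr_sum f) \<subseteq> (\<Union>y\<in>supp f. nbrs X y)"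
proof
  fix x assume "x \<in> supp (nbr_sum f)"
  then obtain w where "w \<in> nbrs X x" "f w \<noteq> 0"
    unfolding supp_def nbr_sum_def by (metis (mono_tags, lifting) mem_Collect_eq sum.neutral)
  then show "x \<in> (\<Union>y\<in>supp f. nbrs X y)"
    using nbrs_iff[OF simple] adj_sym by (fastforce simp: supp_def)
qed

lemma fin_supp_nbr_sum: "fin_supp f \<Longrightarrow> fin_supp (nbr_sum f)"
  using finite_subset[OF supp_nbr_sum[of f]] supp_nbr_sum[of f] fin_nbrs' unfolding fin_supp_def nbrs_def by blast

lemma fin_supp_avg: "fin_supp f \<Longrightarrow> fin_supp (avg f)"
proof -
  assume f: "fin_supp f"
  have "avg f x = 1 / real (deg X x) * nbr_sum f x" for x by (simp only: avg_def nbr_sum_def sum_distrib_left)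
  then have "supp (avg f) \<subseteq> supp (nbr_sum f)" by (auto simp: supp_def)
  then show ?thesis using fin_supp_nbr_sum[OF f] unfolding fin_supp_def by (blast intro: finite_subset)
qed

definition edge_sum :: "'a set \<Rightarrow> ('a \<Rightarrow> 'a \<Rightarrow> real) \<Rightarrow> real" where
  "edge_sum A \<phi> = (\<Sum>x\<in>A. \<Sum>y\<in>A. if adj X x y then \<phi> x y else 0)"

lemma nbr_sum_eq:
  assumes "finite A" "supp f \<subseteq> A"
  shows "nbr_sum f x = (\<Sum>y\<in>A. if adj X x y then f y else 0)"
proof -
  have "(\<Sum>y\<in>A. if adj X x y then f y else 0) = (\<Sum>y\<in>A \<inter> nbrs X x. f y)"
    using assms(1) by (simp add: sum.inter_restrict nbrs_iff[OF simple])
  also have "\<dots> = nbr_sum f x" unfolding nbr_sum_def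
    by (rule sum.mono_neutral_left) (use fin_nbrs' assms(2) in \<open>auto simp: supp_def\<close>)
  finally show ?thesis ..
qed

lemma ip_avg:
  assumes "fin_supp f" "fin_supp g" "finite A" "supp f \<subseteq> A" "supp g \<subseteq> A"
  shows "ip (avg f) g = edge_sum A (\<lambda>x y. f y * g x)"
proof -
  have "ip (avg f) g = ip g (avg f)" by (rule ip_sym[OF fin_supp_avg assms(2)]) (rule assms(1))
  also have "\<dots> = (\<Sum>x\<in>A. g x * (real (deg X x) * avg f x))"
    by (simp add: ip_eq[OF assms(3,5)] mult_ac)
  also have "\<dots> = edge_sum A (\<lambda>x y. f y * g x)"
    unfolding deg_times_avg edge_sum_def nbr_sum_eq[OF assms(3,4)] sum_distrib_left
    by (intro sum.cong refl) (auto simp: mult.commute)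
  finally show ?thesis .
qed

lemma edge_sum_swap: "edge_sum A \<phi> = edge_sum A (\<lambda>x y. \<phi> y x)"
  unfolding edge_sum_def by (subst sum.swap) (auto intro!: sum.cong simp: adj_sym)

lemma avg_selfadjoint:
  assumes "fin_supp f" "fin_supp g"
  shows "ip (avg f) g = ip f (avg g)"
proof -
  let ?A = "supp f \<union> supp g"
  have A: "finite ?A" using assms by (simp add: fin_supp_def)
  have "ip (avg f) g = edge_sum ?A (\<lambda>x y. f y * g x)" by (rule ip_avg[OF assms A]) auto
  also have "\<dots> = edge_sum ?A (\<lambda>x y. g y * f x)" by (subst edge_sum_swap) (simp add: mult.commute)
  also have "\<dots> = ip (avg g) f" by (rule ip_avg[OF assms(2,1) A, symmetric]) auto
  also have "\<dots> = ip f (avg g)" by (rule ip_sym[OF fin_supp_avg assms(1)]) (rule assms(2))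
  finally show ?thesis .
qed

text \<open>The sum runs over ordered pairs, whence the factor 2. For c = -1 it is the Dirichlet
  form and shows that the walk operator is at most 1; for c = 1 it is the signless form and bounds
  it from below by -1. The set \<open>A\<close> contains the neighbours so that each vertex of the
  support sees its full degree.\<close>

lemma edge_form:
  assumes f: "fin_supp f" and A: "finite A" "supp f \<subseteq> A" "(\<Union>y\<in>supp f. nbrs X y) \<subseteq> A" and c: "c\<^sup>2 = 1"
  shows "edge_sum A (\<lambda>x y. (f x + c * f y)\<^sup>2) = 2 * (ip f f + c * ip (avg f) f)"
proof -
  have d: "edge_sum A (\<lambda>x y. f x * f x) = ip f f"
  proof -
    have "(\<Sum>y\<in>A. if adj X x y then f x * f x else 0) = real (deg X x) * f x * f x" for x
    proof (cases "f x = 0")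
      case False
      then have "nbrs X x \<subseteq> A" using A(3) by (auto simp: supp_def)
      then have e: "{y \<in> A. adj X x y} = nbrs X x" using nbrs_iff[OF simple] by auto
      have "(\<Sum>y\<in>A. if adj X x y then f x * f x else 0) = (\<Sum>y\<in>{y \<in> A. adj X x y}. f x * f x)"
        by (rule sum.inter_filter[OF A(1), symmetric])
      then show ?thesis by (simp add: e deg_def)
    qed (auto intro!: sum.neutral)
    then show ?thesis unfolding edge_sum_def ip_eq[OF A(1,2)] by simp
  qed
  have e: "edge_sum A (\<lambda>x y. f y * f y) = ip f f" using d edge_sum_swap[of A "\<lambda>x y. f x * f x"] by simp
  have g: "edge_sum A (\<lambda>x y. f y * f x) = ip (avg f) f" by (rule ip_avg[OF f f A(1,2,2), symmetric])
  have "(f x + c * f y)\<^sup>2 = f x * f x + f y * f y + 2 * c * (f y * f x)" for x y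
  proof -
    have "(f x + c * f y)\<^sup>2 = f x * f x + c\<^sup>2 * (f y * f y) + 2 * c * (f y * f x)"
      by (simp add: power2_eq_square algebra_simps)
    then show ?thesis by (simp add: c)
  qed
  then have "edge_sum A (\<lambda>x y. (f x + c * f y)\<^sup>2) =
     edge_sum A (\<lambda>x y. f x * f x) + edge_sum A (\<lambda>x y. f y * f y) + 2 * c * edge_sum A (\<lambda>x y. f y * f x)"
    unfolding edge_sum_def sum_distrib_left sum.distrib[symmetric]
    by (intro sum.cong refl) auto
  then show ?thesis unfolding d e g by simp
qed

lemma edge_form_nonneg:
  assumes f: "fin_supp f" and c: "c\<^sup>2 = 1"
  shows "ip f f + c * ip (avg f) f \<ge> 0"
proof -
  let ?A = "supp f \<union> (\<Union>y\<in>supp f. nbrs X y)"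
  have "finite ?A" using f fin_nbrs' by (simp add: fin_supp_def)
  then have "2 * (ip f f + c * ip (avg f) f) = edge_sum ?A (\<lambda>x y. (f x + c * f y)\<^sup>2)"
    using edge_form[OF f _ _ _ c, of ?A] by auto
  also have "\<dots> \<ge> 0" unfolding edge_sum_def by (intro sum_nonneg) auto
  finally show ?thesis by simp
qed

lemma ip_nonneg: "ip f f \<ge> 0"
  unfolding ip_def by (intro sum_nonneg) (simp add: mult.assoc)

section \<open>Return probabilities as moments of the walk operator\<close>

definition walk_poly :: "'a \<Rightarrow> real poly \<Rightarrow> 'a \<Rightarrow> real" where
  "walk_poly v q x = mom (\<lambda>n. walk_prob X n x v) q"

lemma walk_prob_Suc_avg: "walk_prob X (Suc n) x v = avg (\<lambda>w. walk_prob X n w v) x"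
  by (simp add: avg_def)

lemma mom_pCons: "mom p (pCons a q) = a * p 0 + mom (\<lambda>n. p (Suc n)) q"
proof -
  have "mom p (pCons a q) = (\<Sum>i\<le>Suc (degree q). coeff (pCons a q) i * p i)"
    by (rule mom_altdef) (simp add: degree_pCons_le)
  also have "\<dots> = a * p 0 + (\<Sum>i\<le>degree q. coeff q i * p (Suc i))"
    by (subst sum.atMost_Suc_shift) simp
  finally show ?thesis by (simp add: mom_def)
qed

lemma walk_poly_pCons: "walk_poly v (pCons a q) = (\<lambda>x. a * walk_prob X 0 x v + avg (walk_poly v q) x)"
proof
  fix x
  have "mom (\<lambda>n. walk_prob X (Suc n) x v) q = avg (walk_poly v q) x"
    unfolding walk_prob_Suc_avg mom_def avg_def walk_poly_def sum_distrib_left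
    by (subst sum.swap) (simp add: mult_ac)
  then show "walk_poly v (pCons a q) x = a * walk_prob X 0 x v + avg (walk_poly v q) x"
    unfolding walk_poly_def mom_pCons by simp
qed

lemma fin_supp_delta: "v \<in> verts X \<Longrightarrow> fin_supp (\<lambda>x. walk_prob X 0 x v)"
  by (simp add: fin_supp_def supp_def)

lemma walk_poly_0: "walk_poly v 0 = (\<lambda>x. 0)" by (auto simp: walk_poly_def mom_def)

lemma fin_supp_walk_poly: "v \<in> verts X \<Longrightarrow> fin_supp (walk_poly v q)"
proof (induction q rule: pCons_induct)
  case 0 then show ?case by (simp add: walk_poly_0 fin_supp_def supp_def)
next
  case (pCons a q)
  then show ?case unfolding walk_poly_pCons by (intro fin_supp_add fin_supp_scale fin_supp_delta fin_supp_avg) auto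
qed

lemma ip_delta: "v \<in> verts X \<Longrightarrow> ip (\<lambda>x. walk_prob X 0 x v) g = real (deg X v) * g v"
proof -
  have "supp (\<lambda>x. walk_prob X 0 x v) = {v}" by (auto simp: supp_def)
  then show ?thesis by (simp add: ip_def)
qed

lemma walk_poly_shift: "walk_poly v (pCons 0 r) = avg (walk_poly v r)"
  by (auto simp: walk_poly_pCons)

text \<open>\<open>walk_poly v q\<close> is q(P) applied to the indicator of \<open>v\<close>, with
  P the walk operator. Symmetry moves one factor P at a time to the other argument.\<close>

lemma mom_mult:
  assumes v: "v \<in> verts X"
  shows "real (deg X v) * mom (\<lambda>n. walk_prob X n v v) (q * r) = ip (walk_poly v q) (walk_poly v r)"
proof (induction q arbitrary: r rule: pCons_induct)
  case 0
  then show ?case by (simp add: walk_poly_0 ip_def supp_def mom_def)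
next
  case (pCons a q)
  have "mom (\<lambda>n. walk_prob X n v v) (pCons a q * r) = a * walk_poly v r v + mom (\<lambda>n. walk_prob X n v v) (q * pCons 0 r)"
    by (simp add: mom_add mom_smult walk_poly_def)
  then have "real (deg X v) * mom (\<lambda>n. walk_prob X n v v) (pCons a q * r) =
     a * (real (deg X v) * walk_poly v r v) + real (deg X v) * mom (\<lambda>n. walk_prob X n v v) (q * pCons 0 r)"
    by (simp add: algebra_simps)
  also have "\<dots> = a * ip (\<lambda>x. walk_prob X 0 x v) (walk_poly v r) + ip (walk_poly v q) (avg (walk_poly v r))"
    unfolding pCons.IH walk_poly_shift ip_delta[OF v] ..
  also have "\<dots> = a * ip (\<lambda>x. walk_prob X 0 x v) (walk_poly v r) + ip (avg (walk_poly v q)) (walk_poly v r)"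
    using avg_selfadjoint[OF fin_supp_walk_poly[OF v] fin_supp_walk_poly[OF v]] by simp
  also have "\<dots> = ip (walk_poly v (pCons a q)) (walk_poly v r)"
    unfolding walk_poly_pCons
    by (subst ip_add_left) (auto intro!: fin_supp_scale fin_supp_delta fin_supp_avg fin_supp_walk_poly v simp: ip_scale_left[OF fin_supp_delta[OF v]] simp del: walk_prob.simps)
  finally show ?case .
qed

lemma walk_poly_add: "walk_poly v (q + r) = (\<lambda>x. walk_poly v q x + walk_poly v r x)" by (auto simp: walk_poly_def mom_add)
lemma walk_poly_smult: "walk_poly v (smult c q) = (\<lambda>x. c * walk_poly v q x)" by (auto simp: walk_poly_def mom_smult)

text \<open>The functional on q^2, (1 - x) q^2 and (x - a) q^2 becomes, up to the degree of
  \<open>v\<close>, the quadratic form of 1, 1 - P and P - a at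
  \<open>walk_poly v q\<close>.\<close>

lemma walk_moment_seq:
  assumes v: "v \<in> verts X" and a: "- 1 \<le> a" "a < 1"
    and gap: "\<And>f. fin_supp f \<Longrightarrow> a * ip f f \<le> ip (avg f) f"
  shows "moment_seq (\<lambda>n. walk_prob X n v v) a"
proof
  let ?p = "\<lambda>n. walk_prob X n v v"
  show "- 1 \<le> a" "a < 1" by fact+
  have d: "real (deg X v) > 0" using deg_pos[OF v] by simp
  fix q :: "real poly"
  note F = fin_supp_walk_poly[OF v, of q]
  have "real (deg X v) * mom ?p (q * q) \<ge> 0" unfolding mom_mult[OF v] by (rule ip_nonneg)
  then show "mom ?p (q * q) \<ge> 0" using d by (simp add: zero_le_mult_iff)
  have lin: "real (deg X v) * mom ?p ([:b, c:] * (q * q)) = b * ip (walk_poly v q) (walk_poly v q) + c * ip (avg (walk_poly v q)) (walk_poly v q)" for b c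
  proof -
    have "[:b, c:] * (q * q) = (smult b q + smult c (pCons 0 q)) * q"
      by (simp add: distrib_right)
    then have "real (deg X v) * mom ?p ([:b, c:] * (q * q)) = ip (walk_poly v (smult b q + smult c (pCons 0 q))) (walk_poly v q)"
      by (simp only: mom_mult[OF v])
    also have "\<dots> = b * ip (walk_poly v q) (walk_poly v q) + c * ip (avg (walk_poly v q)) (walk_poly v q)"
      unfolding walk_poly_add walk_poly_smult walk_poly_shift
      by (simp add: ip_add_left fin_supp_scale fin_supp_avg F ip_scale_left)
    finally show ?thesis .
  qed
  have "real (deg X v) * mom ?p ([:1, -1:] * (q * q)) \<ge> 0"
    unfolding lin using edge_form_nonneg[OF F, of "-1"] by simp
  then show "mom ?p ([:1, -1:] * (q * q)) \<ge> 0" using d by (simp add: zero_le_mult_iff)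
  have "real (deg X v) * mom ?p ([:-a, 1:] * (q * q)) \<ge> 0"
    unfolding lin using gap[OF F] by simp
  then show "mom ?p ([:-a, 1:] * (q * q)) \<ge> 0" using d by (simp add: zero_le_mult_iff)
qed

lemma no_gap: "fin_supp f \<Longrightarrow> - 1 * ip f f \<le> ip (avg f) f"
  using edge_form_nonneg[of f 1] by simp

section \<open>Energy along walks and the gap at -1\<close>

definition edge_energy :: "('a \<Rightarrow> real) \<Rightarrow> 'a \<Rightarrow> real" where
  "edge_energy f x = (\<Sum>y\<in>nbrs X x. (f x + f y)\<^sup>2)"

lemma nbr_sum_nonneg: "(\<And>x. g x \<ge> 0) \<Longrightarrow> nbr_sum g x \<ge> 0"
  unfolding nbr_sum_def by (intro sum_nonneg) auto

lemma nbr_sum_pow_nonneg: "(\<And>x. g x \<ge> 0) \<Longrightarrow> (nbr_sum ^^ i) g x \<ge> 0"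
  by (induction i arbitrary: x) (auto intro: nbr_sum_nonneg)

lemma le_nbr_sum: "(\<And>x. g x \<ge> 0) \<Longrightarrow> adj X x y \<Longrightarrow> g y \<le> nbr_sum g x"
  unfolding nbr_sum_def by (rule member_le_sum) (auto simp: nbrs_iff[OF simple] fin_nbrs')

lemma edge_energy_nonneg: "edge_energy f x \<ge> 0"
  unfolding edge_energy_def by (intro sum_nonneg) auto

lemma square_add_le: "(a + b)\<^sup>2 \<le> 2 * a\<^sup>2 + 2 * (b::real)\<^sup>2"
  using zero_le_power2[of "a - b"] by (simp add: power2_eq_square algebra_simps)

text \<open>Along the walk, f(x) - (-1)^l f(y) is an alternating sum of the edge terms f(u) + f(w).
  Each is controlled by the energy at u, and an i-fold neighbour sum brings that energy back to x.
  The power of 4 pays for splitting a square once per step.\<close>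

lemma walk_energy:
  assumes "(adj X ^^ l) x y"
  shows "(f x - (- 1) ^ l * f y)\<^sup>2 \<le> 4 ^ l * (\<Sum>i\<le>l. (nbr_sum ^^ i) (edge_energy f) x)"
  using assms
proof (induction l arbitrary: x)
  case 0
  then show ?case using edge_energy_nonneg by simp
next
  case (Suc l)
  then obtain w where w: "adj X x w" "(adj X ^^ l) w y" by (metis relpowp_Suc_E2)
  let ?S = "\<lambda>n. \<Sum>i\<le>n. (nbr_sum ^^ i) (edge_energy f) x"
  have nn: "(nbr_sum ^^ i) (edge_energy f) x \<ge> 0" for i x by (rule nbr_sum_pow_nonneg) (rule edge_energy_nonneg)
  have "(f x + f w)\<^sup>2 \<le> edge_energy f x" unfolding edge_energy_def
    by (rule member_le_sum) (use w(1) in \<open>auto simp: nbrs_iff[OF simple] fin_nbrs'\<close>)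
  moreover have "(f w - (- 1) ^ l * f y)\<^sup>2 \<le> 4 ^ l * (\<Sum>i\<le>l. (nbr_sum ^^ Suc i) (edge_energy f) x)"
  proof (rule order_trans[OF Suc.IH[OF w(2)]], intro mult_left_mono sum_mono)
    fix i
    show "(nbr_sum ^^ i) (edge_energy f) w \<le> (nbr_sum ^^ Suc i) (edge_energy f) x" using le_nbr_sum[of "(nbr_sum ^^ i) (edge_energy f)", OF nn w(1)] by simp
  qed simp
  moreover have "(f x - (- 1) ^ Suc l * f y)\<^sup>2 \<le> 2 * (f x + f w)\<^sup>2 + 2 * (f w - (- 1) ^ l * f y)\<^sup>2"
    using square_add_le[of "f x + f w" "- (f w - (- 1) ^ l * f y)"] by (simp add: power2_commute)
  ultimately have "(f x - (- 1) ^ Suc l * f y)\<^sup>2 \<le> 2 * edge_energy f x + 2 * (4 ^ l * (\<Sum>i\<le>l. (nbr_sum ^^ Suc i) (edge_energy f) x))" by linarith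
  also have "\<dots> \<le> 4 ^ Suc l * edge_energy f x + 4 ^ Suc l * (\<Sum>i\<le>l. (nbr_sum ^^ Suc i) (edge_energy f) x)"
  proof (rule add_mono)
    have "(1::real) \<le> 4 ^ l" by simp
    then have "(2::real) \<le> 4 ^ Suc l" by (simp only: power_Suc)
    then show "2 * edge_energy f x \<le> 4 ^ Suc l * edge_energy f x" by (rule mult_right_mono) (rule edge_energy_nonneg)
    have "0 \<le> 4 ^ l * (\<Sum>i\<le>l. (nbr_sum ^^ Suc i) (edge_energy f) x)" by (intro mult_nonneg_nonneg sum_nonneg nn) simp
    then show "2 * (4 ^ l * (\<Sum>i\<le>l. (nbr_sum ^^ Suc i) (edge_energy f) x)) \<le> 4 ^ Suc l * (\<Sum>i\<le>l. (nbr_sum ^^ Suc i) (edge_energy f) x)"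
      unfolding power_Suc mult.assoc by linarith
  qed
  also have "\<dots> = 4 ^ Suc l * ?S (Suc l)" by (subst sum.atMost_Suc_shift) (simp add: distrib_left)
  finally show ?case .
qed

lemma total_nbr_sum_le:
  assumes g: "fin_supp g" "\<And>x. g x \<ge> 0"
  shows "total (nbr_sum g) \<le> real k * total g"
proof -
  let ?A = "supp g \<union> (\<Union>y\<in>supp g. nbrs X y)"
  have A: "finite ?A" "supp g \<subseteq> ?A" "supp (nbr_sum g) \<subseteq> ?A" using g(1) fin_nbrs' supp_nbr_sum[of g] by (auto simp: fin_supp_def)
  have "total (nbr_sum g) = (\<Sum>x\<in>?A. \<Sum>y\<in>?A. if adj X x y then g y else 0)"
    unfolding total_eq[OF A(1,3)] nbr_sum_eq[OF A(1,2)] ..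
  also have "\<dots> = (\<Sum>y\<in>?A. \<Sum>x\<in>?A. if adj X x y then g y else 0)" by (rule sum.swap)
  also have "\<dots> \<le> (\<Sum>y\<in>?A. real k * g y)"
  proof (rule sum_mono)
    fix y assume "y \<in> ?A"
    then have y: "y \<in> verts X" using g(1) by (auto simp: fin_supp_def nbrs_def)
    have "(\<Sum>x\<in>?A. if adj X x y then g y else 0) = real (card {x \<in> ?A. adj X x y}) * g y"
      using A(1) by (simp add: sum.inter_filter[symmetric])
    also have "card {x \<in> ?A. adj X x y} \<le> deg X y" unfolding deg_def
      by (rule card_mono[OF fin_nbrs']) (auto simp: nbrs_iff[OF simple] adj_sym)
    then have "real (card {x \<in> ?A. adj X x y}) * g y \<le> real k * g y"
      using deg_le[OF y] g(2) by (intro mult_right_mono) auto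
    finally show "(\<Sum>x\<in>?A. if adj X x y then g y else 0) \<le> real k * g y" .
  qed
  also have "\<dots> = real k * total g" unfolding total_eq[OF A(1,2)] sum_distrib_left ..
  finally show ?thesis .
qed

lemma fin_supp_nbr_sum_pow: "fin_supp g \<Longrightarrow> fin_supp ((nbr_sum ^^ i) g)"
  by (induction i) (auto intro: fin_supp_nbr_sum)

lemma total_nbr_sum_pow_le:
  assumes g: "fin_supp g" "\<And>x. g x \<ge> 0"
  shows "total ((nbr_sum ^^ i) g) \<le> real k ^ i * total g"
proof (induction i)
  case (Suc i)
  have "total (nbr_sum ((nbr_sum ^^ i) g)) \<le> real k * total ((nbr_sum ^^ i) g)"
    by (rule total_nbr_sum_le[OF fin_supp_nbr_sum_pow[OF g(1)] nbr_sum_pow_nonneg[OF g(2)]])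
  also have "\<dots> \<le> real k * (real k ^ i * total g)" by (intro mult_left_mono Suc) simp
  finally show ?case by simp
qed simp

lemma sum_le_total:
  assumes "fin_supp g" "\<And>x. g x \<ge> 0" "finite A"
  shows "sum g A \<le> total g"
proof -
  have "sum g A \<le> sum g (A \<union> supp g)" using assms by (intro sum_mono2) (auto simp: fin_supp_def)
  also have "\<dots> = total g" by (rule total_eq[symmetric]) (use assms in \<open>auto simp: fin_supp_def\<close>)
  finally show ?thesis .
qed

lemma total_edge_energy:
  assumes f: "fin_supp f"
  shows "fin_supp (edge_energy f)" "total (edge_energy f) = 2 * (ip f f + ip (avg f) f)"
proof -
  let ?A = "supp f \<union> (\<Union>y\<in>supp f. nbrs X y)"
  let ?B = "?A \<union> (\<Union>y\<in>?A. nbrs X y)"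
  have A: "finite ?A" using f fin_nbrs' by (simp add: fin_supp_def)
  have B: "finite ?B" "supp f \<subseteq> ?B" "(\<Union>y\<in>supp f. nbrs X y) \<subseteq> ?B" using A fin_nbrs' by auto
  have z: "f x = 0" "\<And>y. adj X x y \<Longrightarrow> f y = 0" if "x \<notin> ?A" for x
  proof -
    show "f x = 0" using that by (auto simp: supp_def)
    show "f y = 0" if "adj X x y" for y
    proof (rule ccontr)
      assume "f y \<noteq> 0"
      then have "y \<in> supp f" by (simp add: supp_def)
      moreover have "x \<in> nbrs X y" using that by (simp add: nbrs_iff[OF simple] adj_sym)
      ultimately show False using \<open>x \<notin> ?A\<close> by blast
    qed
  qed
  have sE: "supp (edge_energy f) \<subseteq> ?A"
  proof
    fix x assume "x \<in> supp (edge_energy f)"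
    then have "edge_energy f x \<noteq> 0" by (simp add: supp_def)
    moreover have "edge_energy f x = 0" if "x \<notin> ?A"
      unfolding edge_energy_def by (rule sum.neutral) (use z[OF that] in \<open>auto simp: nbrs_iff[OF simple]\<close>)
    ultimately show "x \<in> ?A" by blast
  qed
  moreover have "?A \<subseteq> verts X" using f by (auto simp: fin_supp_def nbrs_def)
  ultimately show "fin_supp (edge_energy f)" using A unfolding fin_supp_def by (meson finite_subset order_trans)
  have "(\<Sum>y\<in>?B. if adj X x y then (f x + 1 * f y)\<^sup>2 else 0) = edge_energy f x" if "x \<in> ?A" for x
  proof -
    have e: "{y \<in> ?B. adj X x y} = nbrs X x" using that nbrs_iff[OF simple] by auto
    have "(\<Sum>y\<in>?B. if adj X x y then (f x + 1 * f y)\<^sup>2 else 0) = (\<Sum>y\<in>{y \<in> ?B. adj X x y}. (f x + f y)\<^sup>2)"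
      unfolding mult_1_left by (rule sum.inter_filter[OF B(1), symmetric])
    then show ?thesis unfolding e edge_energy_def .
  qed
  moreover have "(\<Sum>y\<in>?B. if adj X x y then (f x + 1 * f y)\<^sup>2 else 0) = edge_energy f x" if "x \<notin> ?A" for x
  proof -
    have "edge_energy f x = 0" using sE that unfolding supp_def by blast
    moreover have "(\<Sum>y\<in>?B. if adj X x y then (f x + 1 * f y)\<^sup>2 else 0) = 0"
      by (rule sum.neutral) (use z[OF that] in auto)
    ultimately show ?thesis by simp
  qed
  ultimately have "(\<Sum>y\<in>?B. if adj X x y then (f x + 1 * f y)\<^sup>2 else 0) = edge_energy f x" for x by blast
  then have "edge_sum ?B (\<lambda>x y. (f x + 1 * f y)\<^sup>2) = sum (edge_energy f) ?B" unfolding edge_sum_def by simp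
  also have "\<dots> = total (edge_energy f)" by (rule total_eq[symmetric]) (use B sE in auto)
  finally show "total (edge_energy f) = 2 * (ip f f + ip (avg f) f)" using edge_form[OF f B, of 1] by simp
qed

text \<open>A uniform supply of odd closed walks keeps the spectrum of the walk away from \<open>-1\<close>.\<close>

theorem spectral_gap:
  assumes odd_walk: "\<And>x. x \<in> verts X \<Longrightarrow> \<exists>l\<le>L. odd l \<and> (adj X ^^ l) x x"
  shows "\<exists>a. - 1 < a \<and> a < 1 \<and> (\<forall>f. fin_supp f \<longrightarrow> a * ip f f \<le> ip (avg f) f)"
proof -
  define C where "C = real k * (4 ^ L * (\<Sum>i\<le>L. real k ^ i))"
  \<comment> \<open>The total energy is twice the form of 1 + P, whence 2 C; the summand 1 keeps 1/K
    - 1 in (-1, 0].\<close>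
  define K where "K = 2 * C + 1"
  have K0: "0 \<le> C" unfolding C_def by (intro mult_nonneg_nonneg sum_nonneg) auto
  then have K: "K \<ge> 1" by (simp add: K_def)
  have main: "ip f f \<le> K * (ip f f + ip (avg f) f)" if f: "fin_supp f" for f
  proof -
    have fin: "finite (supp f)" using f by (simp add: fin_supp_def)
    have Epow: "(nbr_sum ^^ i) (edge_energy f) x \<ge> 0" for i x by (rule nbr_sum_pow_nonneg) (rule edge_energy_nonneg)
    have pt: "(f x)\<^sup>2 \<le> 4 ^ L * (\<Sum>i\<le>L. (nbr_sum ^^ i) (edge_energy f) x)" if "x \<in> supp f" for x
    proof -
      have "x \<in> verts X" using f that by (auto simp: fin_supp_def)
      then obtain l where l: "l \<le> L" "odd l" "(adj X ^^ l) x x" using odd_walk by blast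
      have "(f x)\<^sup>2 \<le> 4 * (f x)\<^sup>2" by simp
      \<comment> \<open>Because \<open>l\<close> is odd, the two ends of the closed walk add up
        instead of cancelling.\<close>
      also have "\<dots> = (f x - (- 1) ^ l * f x)\<^sup>2" using l(2) by (simp add: power2_eq_square)
      also have "\<dots> \<le> 4 ^ l * (\<Sum>i\<le>l. (nbr_sum ^^ i) (edge_energy f) x)" by (rule walk_energy[OF l(3)])
      also have "\<dots> \<le> 4 ^ L * (\<Sum>i\<le>L. (nbr_sum ^^ i) (edge_energy f) x)"
        using l(1) by (intro mult_mono power_increasing sum_mono2 sum_nonneg Epow) auto
      finally show ?thesis .
    qed
    have "ip f f \<le> (\<Sum>x\<in>supp f. real k * (f x)\<^sup>2)" unfolding ip_def
    proof (rule sum_mono)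
      fix x assume "x \<in> supp f"
      then have "deg X x \<le> k" using f deg_le by (auto simp: fin_supp_def)
      then show "real (deg X x) * f x * f x \<le> real k * (f x)\<^sup>2"
        by (simp add: power2_eq_square mult.assoc mult_right_mono)
    qed
    also have "\<dots> \<le> (\<Sum>x\<in>supp f. real k * (4 ^ L * (\<Sum>i\<le>L. (nbr_sum ^^ i) (edge_energy f) x)))"
      by (intro sum_mono mult_left_mono pt) auto
    also have "\<dots> = real k * (4 ^ L * (\<Sum>i\<le>L. \<Sum>x\<in>supp f. (nbr_sum ^^ i) (edge_energy f) x))"
      by (subst sum.swap) (simp add: sum_distrib_left)
    also have "\<dots> \<le> real k * (4 ^ L * (\<Sum>i\<le>L. real k ^ i * total (edge_energy f)))"
    proof (intro mult_left_mono sum_mono)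
      fix i
      have "(\<Sum>x\<in>supp f. (nbr_sum ^^ i) (edge_energy f) x) \<le> total ((nbr_sum ^^ i) (edge_energy f))"
        by (rule sum_le_total[OF fin_supp_nbr_sum_pow[OF total_edge_energy(1)[OF f]] Epow fin])
      also have "\<dots> \<le> real k ^ i * total (edge_energy f)" by (rule total_nbr_sum_pow_le[OF total_edge_energy(1)[OF f] edge_energy_nonneg])
      finally show "(\<Sum>x\<in>supp f. (nbr_sum ^^ i) (edge_energy f) x) \<le> real k ^ i * total (edge_energy f)" .
    qed auto
    also have "\<dots> = (real k * (4 ^ L * (\<Sum>i\<le>L. real k ^ i))) * total (edge_energy f)"
      by (simp add: sum_distrib_right[symmetric])
    finally have "ip f f \<le> C * (2 * (ip f f + ip (avg f) f))"
      unfolding total_edge_energy(2)[OF f] C_def .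
    also have "\<dots> \<le> K * (ip f f + ip (avg f) f)"
      using edge_form_nonneg[OF f, of 1] by (simp add: K_def algebra_simps)
    finally show ?thesis .
  qed
  have "(1 / K - 1) * ip f f \<le> ip (avg f) f" if f: "fin_supp f" for f
  proof -
    have "ip f f / K \<le> ip f f + ip (avg f) f" using main[OF f] K by (simp add: divide_le_eq mult.commute)
    then show ?thesis by (simp add: left_diff_distrib)
  qed
  moreover have "- 1 < 1 / K - 1" "1 / K - 1 < 1" using K by (auto simp: divide_less_eq)
  ultimately show ?thesis by blast
qed

end

subsection \<open>Cells of self-similar graphs\<close>

lemma adj_induced: "adj (induced X S) x y \<longleftrightarrow> adj X x y \<and> x \<in> S \<and> y \<in> S"
  by (auto simp: adj_def induced_def)

lemma simple_induced: "simple_graph X \<Longrightarrow> simple_graph (induced X S)"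
  unfolding simple_graph_def induced_def by fastforce

lemma relpowp_mono:
  fixes R S :: "'b \<Rightarrow> 'b \<Rightarrow> bool"
  shows "(R ^^ n) x y \<Longrightarrow> (\<And>a b. R a b \<Longrightarrow> S a b) \<Longrightarrow> (S ^^ n) x y"
  by (induction n arbitrary: y) auto

lemma walk_rev: "(adj X ^^ n) x y \<Longrightarrow> (adj X ^^ n) y x"
proof (induction n arbitrary: y)
  case (Suc n)
  then obtain w where "(adj X ^^ n) x w" "adj X w y" by auto
  then have "adj X y w" "(adj X ^^ n) w x" using Suc.IH adj_sym by metis+
  then show ?case by (rule relpowp_Suc_I2)
qed simp

lemma walk_trans: "(adj X ^^ m) x y \<Longrightarrow> (adj X ^^ n) y z \<Longrightarrow> (adj X ^^ (m + n)) x z"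
  by (auto simp: relpowp_add)

lemma graph_iso_inverse:
  assumes "graph_iso Y Z \<alpha>"
  shows "graph_iso Z Y (inv_into (verts Y) \<alpha>)"
proof -
  have b: "bij_betw \<alpha> (verts Y) (verts Z)" using assms by (simp add: graph_iso_def)
  have "adj Z x y \<longleftrightarrow> adj Y (inv_into (verts Y) \<alpha> x) (inv_into (verts Y) \<alpha> y)"
    if "x \<in> verts Z" "y \<in> verts Z" for x y
    using assms that bij_betw_inv_into_right[OF b] bij_betw_apply[OF bij_betw_inv_into[OF b]]
    unfolding graph_iso_def by metis
  then show ?thesis using bij_betw_inv_into[OF b] unfolding graph_iso_def by blast
qed

lemma graph_iso_comp:
  assumes "graph_iso X Y f" "graph_iso Y Z g"
  shows "graph_iso X Z (g \<circ> f)"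
  using assms bij_betw_trans[of f "verts X" "verts Y" g "verts Z"] bij_betw_apply[of f "verts X" "verts Y"]
  unfolding graph_iso_def by auto

lemma graph_iso_walk:
  assumes "graph_iso Y Z \<alpha>" "simple_graph Y" "(adj Y ^^ n) x y"
  shows "(adj Z ^^ n) (\<alpha> x) (\<alpha> y)"
  using assms(3)
proof (induction n arbitrary: y)
  case (Suc n)
  then obtain w where w: "(adj Y ^^ n) x w" "adj Y w y" by auto
  then have "adj Z (\<alpha> w) (\<alpha> y)" using assms(1) adj_verts[OF assms(2) w(2)] unfolding graph_iso_def by blast
  then show ?case using Suc.IH[OF w(1)] by auto
qed simp

lemma bipartite_walk:
  assumes "\<And>x y. adj Y x y \<Longrightarrow> (x \<in> A \<longleftrightarrow> y \<notin> A)" "(adj Y ^^ n) x y"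
  shows "even n \<longleftrightarrow> (x \<in> A \<longleftrightarrow> y \<in> A)"
  using assms(2)
proof (induction n arbitrary: y)
  case (Suc n)
  then obtain w where "(adj Y ^^ n) x w" "adj Y w y" by auto
  then show ?case using Suc.IH assms(1) by (metis even_Suc)
qed simp

lemma bipartite_closed_walk: "bipartite Y \<Longrightarrow> (adj Y ^^ n) x x \<Longrightarrow> even n"
  unfolding bipartite_def using bipartite_walk by metis

text \<open>If all closed walks at \<open>x\<close> were even, the vertices reached from
  \<open>x\<close> by even walks would be one side of a bipartition.\<close>

lemma odd_closed_walk:
  assumes "simple_graph Y" "graph_connected Y" "\<not> bipartite Y" "x \<in> verts Y"
  shows "\<exists>n. odd n \<and> (adj Y ^^ n) x x"
proof (rule ccontr)
  assume no: "\<not> (\<exists>n. odd n \<and> (adj Y ^^ n) x x)"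
  define A where "A = {y \<in> verts Y. \<exists>n. even n \<and> (adj Y ^^ n) x y}"
  have "a \<in> A \<longleftrightarrow> b \<notin> A" if ab: "adj Y a b" for a b
  proof -
    have vs: "a \<in> verts Y" "b \<in> verts Y" using adj_verts[OF assms(1) ab] by auto
    then have "(adj Y)\<^sup>*\<^sup>* x a" "(adj Y)\<^sup>*\<^sup>* x b" using assms(2,4) unfolding graph_connected_def by auto
    then obtain m n where mn: "(adj Y ^^ m) x a" "(adj Y ^^ n) x b" by (meson rtranclp_power)
    have par: "even m' \<noteq> even n'" if "(adj Y ^^ m') x a" "(adj Y ^^ n') x b" for m' n'
    proof -
      have "(adj Y ^^ 1) a b" using ab by (simp only: relpowp_1)
      from walk_trans[OF walk_trans[OF that(1) this] walk_rev[OF that(2)]]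
      have "even (m' + 1 + n')" using no by blast
      then show ?thesis by auto
    qed
    show ?thesis unfolding A_def using vs mn par by blast
  qed
  moreover have "A \<subseteq> verts Y" by (auto simp: A_def)
  ultimately show False using assms(3) unfolding bipartite_def by blast
qed

section \<open>Isomorphisms between cells and the trace of a walk on the reduced graph\<close>

locale self_similar_walk =
  fixes X :: "'a graph" and F :: "'a set" and \<psi> :: "'a \<Rightarrow> 'a" and v :: 'a
  assumes SS: "symmetrically_self_similar X F \<psi>" and OV: "origin_vertex X \<psi> v"
begin

lemmas self_similar_conditions = SS[unfolded symmetrically_self_similar_def self_similar_def locally_finite_def]

lemma simple: "simple_graph X"
  using self_similar_conditions by (elim conjE) assumption

lemma conn: "graph_connected X"
  using self_similar_conditions by (elim conjE) assumption

lemma inf: "infinite (verts X)"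
  using self_similar_conditions by (elim conjE) assumption

lemma F_sub: "F \<subseteq> verts X"
  using self_similar_conditions by (elim conjE) assumption

lemma iso: "graph_iso X (reduced_graph X F) \<psi>"
  using self_similar_conditions by (elim conjE) assumption

lemma F_indep: "x \<in> F \<Longrightarrow> y \<in> F \<Longrightarrow> \<not> adj X x y"
  using self_similar_conditions by (elim conjE) simp

lemma lf: "x \<in> verts X \<Longrightarrow> finite (nbrs X x)"
  using self_similar_conditions by (elim conjE) simp

lemma cells_finite: "C \<in> cells X F \<Longrightarrow> finite C"
  using self_similar_conditions by (elim conjE) simp

lemma S1: "C \<in> cells X F \<Longrightarrow> D \<in> cells X F \<Longrightarrow> \<exists>\<alpha>. graph_iso (cell_graph X C) (cell_graph X D) \<alpha> \<and>
        \<alpha> ` vboundary X C = vboundary X D"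
  using self_similar_conditions by (elim conjE) blast

lemma S2: "C \<in> cells X F \<Longrightarrow> x \<in> vboundary X C \<Longrightarrow> y \<in> vboundary X C \<Longrightarrow> x' \<in> vboundary X C \<Longrightarrow> y' \<in> vboundary X C
   \<Longrightarrow> x \<noteq> y \<Longrightarrow> x' \<noteq> y' \<Longrightarrow> \<exists>\<alpha>. graph_iso (cell_graph X C) (cell_graph X C) \<alpha> \<and>
               \<alpha> ` vboundary X C = vboundary X C \<and> \<alpha> x = x' \<and> \<alpha> y = y'"
  using self_similar_conditions by (elim conjE) simp

lemma v_verts: "v \<in> verts X" and psi_v: "\<psi> v = v"
  using OV by (auto simp: origin_vertex_def)

lemma verts_reduced [simp]: "verts (reduced_graph X F) = F" by (simp add: reduced_graph_def)

lemma v_F: "v \<in> F"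
  using iso v_verts psi_v unfolding graph_iso_def by (metis bij_betw_apply verts_reduced)

lemma adj_reduced: "adj (reduced_graph X F) x y \<longleftrightarrow> x \<in> F \<and> y \<in> F \<and> x \<noteq> y \<and>
   (\<exists>C\<in>cells X F. x \<in> vboundary X C \<and> y \<in> vboundary X C)"
  unfolding adj_def reduced_graph_def by (auto simp: doubleton_eq_iff)

lemma ex_nbr: "x \<in> verts X \<Longrightarrow> \<exists>y. adj X x y"
proof -
  assume x: "x \<in> verts X"
  obtain y where y: "y \<in> verts X" "y \<noteq> x" using inf by (metis finite.emptyI finite.insertI finite_subset insertCI subsetI)
  then have "(adj X)\<^sup>*\<^sup>* x y" using conn x unfolding graph_connected_def by blast
  then show ?thesis using y(2) by (metis converse_rtranclpE)
qed

lemma deg_positive: "x \<in> verts X \<Longrightarrow> deg X x > 0"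
  using ex_nbr[of x] lf[of x] nbrs_iff[OF simple] unfolding deg_def by (metis card_gt_0_iff empty_iff)

lemma cell_sub: "C \<in> cells X F \<Longrightarrow> C \<subseteq> verts X - F"
  unfolding cells_def by auto

lemma cell_closed:
  assumes "C \<in> cells X F" "x \<in> C" "adj X x y" "y \<notin> F"
  shows "y \<in> C"
proof -
  let ?R = "adj (induced X (verts X - F))"
  obtain c where C: "C = {y \<in> verts X - F. ?R\<^sup>*\<^sup>* c y}" using assms(1) unfolding cells_def by blast
  have "y \<in> verts X" using adj_verts[OF simple assms(3)] by simp
  moreover have "?R x y" using assms cell_sub[OF assms(1)] calculation by (auto simp: adj_induced)
  ultimately show ?thesis using assms(2,4) unfolding C by (auto intro: rtranclp.rtrancl_into_rtrancl)
qed

lemma boundary_sub: "C \<in> cells X F \<Longrightarrow> vboundary X C \<subseteq> F"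
proof
  fix y assume C: "C \<in> cells X F" and "y \<in> vboundary X C"
  then obtain u where "u \<in> C" "adj X u y" "y \<notin> C" unfolding vboundary_def by auto
  with cell_closed[OF C] show "y \<in> F" by auto
qed

lemma boundary_I: "C \<in> cells X F \<Longrightarrow> x \<in> C \<Longrightarrow> adj X x y \<Longrightarrow> y \<in> F \<Longrightarrow> y \<in> vboundary X C"
  using cell_sub[of C] F_sub unfolding vboundary_def by auto

lemma ex_cell: "x \<in> verts X \<Longrightarrow> x \<notin> F \<Longrightarrow> \<exists>C\<in>cells X F. x \<in> C"
  unfolding cells_def by auto

lemma verts_cell_graph: "C \<in> cells X F \<Longrightarrow> verts (cell_graph X C) = C \<union> vboundary X C"
proof -
  assume C: "C \<in> cells X F"
  have "C \<union> vboundary X C \<subseteq> verts X" using cell_sub[OF C] boundary_sub[OF C] F_sub by auto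
  then show ?thesis by (auto simp: cell_graph_def induced_def)
qed

lemma adj_cell_graph: "adj (cell_graph X C) x y \<longleftrightarrow> adj X x y \<and> x \<in> C \<union> vboundary X C \<and> y \<in> C \<union> vboundary X C"
  unfolding cell_graph_def adj_induced ..

lemma simple_cell_graph: "simple_graph (cell_graph X C)"
  unfolding cell_graph_def by (rule simple_induced[OF simple])

lemma cell_walk: "(adj (cell_graph X C) ^^ n) x y \<Longrightarrow> (adj X ^^ n) x y"
  by (erule relpowp_mono) (simp add: adj_cell_graph)

lemma finite_cell_graph: "C \<in> cells X F \<Longrightarrow> finite (verts (cell_graph X C))"
proof -
  assume C: "C \<in> cells X F"
  have "vboundary X C \<subseteq> (\<Union>x\<in>C. nbrs X x)" unfolding vboundary_def nbrs_def by auto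
  moreover have "finite (\<Union>x\<in>C. nbrs X x)" using cells_finite[OF C] lf cell_sub[OF C] by auto
  ultimately show ?thesis using cells_finite[OF C] by (auto simp: verts_cell_graph[OF C] intro: finite_subset)
qed

lemma ex_cell_graph: "x \<in> verts X \<Longrightarrow> \<exists>C\<in>cells X F. x \<in> verts (cell_graph X C)"
proof (cases "x \<in> F")
  case True
  assume x: "x \<in> verts X"
  obtain y where y: "adj X x y" using ex_nbr[OF x] by blast
  then have "y \<notin> F" "y \<in> verts X" using F_indep[OF True] adj_verts[OF simple y] by auto
  then obtain C where C: "C \<in> cells X F" "y \<in> C" using ex_cell by blast
  then have "x \<in> vboundary X C" using boundary_I[OF C] y adj_sym True by metis
  then show ?thesis using C verts_cell_graph by blast
next
  case False
  then show "x \<in> verts X \<Longrightarrow> ?thesis" using ex_cell verts_cell_graph by blast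
qed

text \<open>\<open>\<psi>\<close> carries an edge at the origin to an edge of the reduced graph, and
  such an edge exists only inside the boundary of a cell.\<close>

lemma base_cell: "\<exists>C x y. C \<in> cells X F \<and> x \<in> vboundary X C \<and> y \<in> vboundary X C \<and> x \<noteq> y"
proof -
  obtain w where w: "adj X v w" using ex_nbr[OF v_verts] by blast
  then have "w \<in> verts X" using adj_verts[OF simple w] by simp
  then have "adj (reduced_graph X F) (\<psi> v) (\<psi> w)" using iso v_verts w unfolding graph_iso_def by blast
  then show ?thesis unfolding adj_reduced by blast
qed

lemma cell_graph_inj:
  assumes "graph_iso (cell_graph X C) Z \<alpha>" "C \<in> cells X F" "x \<in> vboundary X C" "y \<in> vboundary X C" "x \<noteq> y"
  shows "\<alpha> x \<noteq> \<alpha> y"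
  using assms verts_cell_graph[OF assms(2)] unfolding graph_iso_def bij_betw_def inj_on_def by blast

lemma two_boundary:
  assumes "C \<in> cells X F"
  shows "\<exists>x y. x \<in> vboundary X C \<and> y \<in> vboundary X C \<and> x \<noteq> y"
proof -
  obtain D x y where D: "D \<in> cells X F" "x \<in> vboundary X D" "y \<in> vboundary X D" "x \<noteq> y" using base_cell by blast
  obtain \<alpha> where a: "graph_iso (cell_graph X D) (cell_graph X C) \<alpha>" "\<alpha> ` vboundary X D = vboundary X C"
    using S1[OF D(1) assms] by blast
  show ?thesis using cell_graph_inj[OF a(1) D] a(2) D by blast
qed

lemma other_boundary: "C \<in> cells X F \<Longrightarrow> \<exists>y\<in>vboundary X C. y \<noteq> x"
proof -
  assume "C \<in> cells X F"
  from two_boundary[OF this] obtain a b where "a \<in> vboundary X C" "b \<in> vboundary X C" "a \<noteq> b" by blast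
  then show ?thesis by (cases "a = x") auto
qed

text \<open>An isomorphism between the cell graphs is corrected by an automorphism of the target
  that moves the image pair to the prescribed one.\<close>

lemma iso_pair:
  assumes C: "C \<in> cells X F" "x \<in> vboundary X C" "y \<in> vboundary X C" "x \<noteq> y"
    and D: "D \<in> cells X F" "x' \<in> vboundary X D" "y' \<in> vboundary X D" "x' \<noteq> y'"
  shows "\<exists>\<alpha>. graph_iso (cell_graph X C) (cell_graph X D) \<alpha> \<and> \<alpha> ` vboundary X C = vboundary X D \<and> \<alpha> x = x' \<and> \<alpha> y = y'"
proof -
  obtain \<beta> where b: "graph_iso (cell_graph X C) (cell_graph X D) \<beta>" "\<beta> ` vboundary X C = vboundary X D"
    using S1[OF C(1) D(1)] by blast
  have "\<beta> x \<in> vboundary X D" "\<beta> y \<in> vboundary X D"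
    using imageI[OF C(2), of \<beta>] imageI[OF C(3), of \<beta>] unfolding b(2) by this+
  from S2[OF D(1) this D(2,3) cell_graph_inj[OF b(1) C] D(4)]
  obtain \<gamma> where g: "graph_iso (cell_graph X D) (cell_graph X D) \<gamma>" "\<gamma> ` vboundary X D = vboundary X D" "\<gamma> (\<beta> x) = x'" "\<gamma> (\<beta> y) = y'"
    by blast
  have "(\<gamma> \<circ> \<beta>) ` vboundary X C = vboundary X D" by (simp only: image_comp[symmetric] b(2) g(2))
  with graph_iso_comp[OF b(1) g(1)] g(3,4) show ?thesis by (intro exI[of _ "\<gamma> \<circ> \<beta>"]) simp
qed

lemma iso_vertex:
  assumes "C \<in> cells X F" "x \<in> vboundary X C" "D \<in> cells X F" "x' \<in> vboundary X D"
  shows "\<exists>\<alpha>. graph_iso (cell_graph X C) (cell_graph X D) \<alpha> \<and> \<alpha> ` vboundary X C = vboundary X D \<and> \<alpha> x = x'"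
proof -
  obtain y y' where "y \<in> vboundary X C" "x \<noteq> y" "y' \<in> vboundary X D" "x' \<noteq> y'"
    using other_boundary[OF assms(1), of x] other_boundary[OF assms(3), of x'] by auto
  from iso_pair[OF assms(1,2) this(1,2) assms(3,4) this(3,4)] show ?thesis by blast
qed

lemma cell_graph_connected:
  assumes C: "C \<in> cells X F"
  shows "graph_connected (cell_graph X C)"
proof -
  let ?R = "adj (induced X (verts X - F))" and ?A = "adj (cell_graph X C)"
  have "\<exists>c. C = {y \<in> verts X - F. ?R\<^sup>*\<^sup>* c y} \<and> c \<in> verts X - F"
    using C unfolding cells_def mem_Collect_eq .
  then obtain c where c: "C = {y \<in> verts X - F. ?R\<^sup>*\<^sup>* c y}" "c \<in> verts X - F" by (elim exE conjE)
  have cC: "c \<in> C" unfolding c(1) using c(2) by simp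
  have "y \<in> C \<and> ?A\<^sup>*\<^sup>* c y" if "?R\<^sup>*\<^sup>* c y" for y
    using that
  proof induction
    case (step y z)
    then have "adj X y z" "z \<notin> F" by (auto simp: adj_induced)
    then have "z \<in> C" "?A y z" using cell_closed[OF C] step.IH by (auto simp: adj_cell_graph)
    then show ?case using step.IH by (meson rtranclp.rtrancl_into_rtrancl)
  qed (simp add: cC)
  then have inC: "?A\<^sup>*\<^sup>* c y" if "y \<in> C" for y using that unfolding c(1) by simp
  have all: "?A\<^sup>*\<^sup>* c y" if "y \<in> verts (cell_graph X C)" for y
  proof (cases "y \<in> C")
    case False
    then have "y \<in> vboundary X C" using that verts_cell_graph[OF C] by blast
    moreover then obtain u where "u \<in> C" "adj X u y" unfolding vboundary_def by blast
    ultimately show ?thesis using inC[of u] by (meson UnI1 UnI2 adj_cell_graph rtranclp.rtrancl_into_rtrancl)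
  qed (rule inC)
  have "symp ?A" by (simp add: symp_def adj_sym)
  then have "symp ?A\<^sup>*\<^sup>*" by (rule symp_rtranclp)
  then have "?A\<^sup>*\<^sup>* y c" if "y \<in> verts (cell_graph X C)" for y using all[OF that] by (meson sympD)
  then show ?thesis unfolding graph_connected_def using all by (meson rtranclp_trans)
qed

text \<open>A walk can leave a cell only through its boundary, so the walk is split at its first
  visit to \<open>F\<close>.\<close>

lemma first_return_inside:
  assumes "C \<in> cells X F" "u \<in> C" "y \<in> F" "(adj X ^^ n) u y"
  shows "\<exists>j z. 1 \<le> j \<and> j \<le> n \<and> z \<in> vboundary X C \<and> (adj (cell_graph X C) ^^ j) u z \<and> (adj X ^^ (n - j)) z y"
  using assms(2,4)
proof (induction n arbitrary: u)
  case 0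
  then show ?case using assms(1,3) cell_sub by auto
next
  case (Suc n)
  then obtain w where w: "adj X u w" "(adj X ^^ n) w y" by (metis relpowp_Suc_E2)
  show ?case
  proof (cases "w \<in> F")
    case True
    then have b: "w \<in> vboundary X C" using boundary_I[OF assms(1) Suc.prems(1) w(1)] by simp
    then have "(adj (cell_graph X C) ^^ 1) u w" unfolding relpowp_1 using w(1) Suc.prems(1) by (simp add: adj_cell_graph)
    then show ?thesis using b w(2) by (intro exI[of _ 1] exI[of _ w] conjI) simp_all
  next
    case False
    then have wC: "w \<in> C" using cell_closed[OF assms(1) Suc.prems(1) w(1)] by simp
    from Suc.IH[OF wC w(2)] obtain j z where
      jz: "1 \<le> j" "j \<le> n" "z \<in> vboundary X C" "(adj (cell_graph X C) ^^ j) w z" "(adj X ^^ (n - j)) z y" by blast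
    have "adj (cell_graph X C) u w" using w(1) Suc.prems(1) wC by (simp add: adj_cell_graph)
    then have "(adj (cell_graph X C) ^^ Suc j) u z" using jz(4) by (rule relpowp_Suc_I2)
    then show ?thesis using jz by (intro exI[of _ "Suc j"] exI[of _ z]) auto
  qed
qed

text \<open>The bound 2 <= j holds because no two vertices of \<open>F\<close> are adjacent. It is
  what makes the trace on the reduced graph strictly shorter.\<close>

lemma first_return:
  assumes "x \<in> F" "y \<in> F" "(adj X ^^ n) x y" "n > 0"
  shows "\<exists>C j z. C \<in> cells X F \<and> 2 \<le> j \<and> j \<le> n \<and> x \<in> vboundary X C \<and> z \<in> vboundary X C \<and>
    (adj (cell_graph X C) ^^ j) x z \<and> (adj X ^^ (n - j)) z y"
proof -
  obtain m where m: "n = Suc m" using assms(4) by (cases n) auto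
  obtain u where u: "adj X x u" "(adj X ^^ m) u y" using assms(3) unfolding m by (metis relpowp_Suc_E2)
  have "u \<notin> F" "u \<in> verts X" using F_indep[OF assms(1)] u(1) adj_verts[OF simple u(1)] by auto
  then obtain C where C: "C \<in> cells X F" "u \<in> C" using ex_cell by blast
  have ux: "adj X u x" using u(1) adj_sym by metis
  have x: "x \<in> vboundary X C" by (rule boundary_I[OF C ux assms(1)])
  obtain j z where jz: "1 \<le> j" "j \<le> m" "z \<in> vboundary X C" "(adj (cell_graph X C) ^^ j) u z" "(adj X ^^ (m - j)) z y"
    using first_return_inside[OF C assms(2) u(2)] by blast
  have "adj (cell_graph X C) x u" using u(1) x C by (simp add: adj_cell_graph)
  then have "(adj (cell_graph X C) ^^ Suc j) x z" using jz(4) by (rule relpowp_Suc_I2)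
  then show ?thesis using C x jz m by (intro exI[of _ C] exI[of _ "Suc j"] exI[of _ z]) auto
qed

text \<open>If the cells are bipartite, walks between different boundary vertices of a cell have a common
  parity. If it is even, all returns to \<open>v\<close> are even; if it is odd, an odd closed walk at \<open>v\<close> is
  traced by a shorter one in the reduced graph, and \<open>\<psi>\<close> leads to an infinite descent.\<close>

lemma cells_not_bipartite:
  assumes nb: "\<not> bipartite X" and C0: "C\<^sub>0 \<in> cells X F"
  shows "\<not> bipartite (cell_graph X C\<^sub>0)"
proof
  assume bip: "bipartite (cell_graph X C\<^sub>0)"
  obtain A where A: "\<And>x y. adj (cell_graph X C\<^sub>0) x y \<Longrightarrow> (x \<in> A \<longleftrightarrow> y \<notin> A)"
    using bip unfolding bipartite_def by blast
  obtain x0 y0 where x0: "x0 \<in> vboundary X C\<^sub>0" "y0 \<in> vboundary X C\<^sub>0" "x0 \<noteq> y0" using two_boundary[OF C0] by blast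
  \<comment> \<open>Records whether two different boundary vertices lie on the same side. By
    \<open>iso_pair\<close> the answer does not depend on the pair or on the cell.\<close>
  define same where "same \<longleftrightarrow> (x0 \<in> A \<longleftrightarrow> y0 \<in> A)"
  have parity: "even j \<longleftrightarrow> x = z \<or> same"
    if C: "C \<in> cells X F" "x \<in> vboundary X C" "z \<in> vboundary X C" and w: "(adj (cell_graph X C) ^^ j) x z" for C x z j
  proof (cases "x = z")
    case True
    obtain \<alpha> where "graph_iso (cell_graph X C) (cell_graph X C\<^sub>0) \<alpha>" using S1[OF C(1) C0] by blast
    from graph_iso_walk[OF this simple_cell_graph w] have "even j"
      using bipartite_closed_walk[OF bip] True by simp
    then show ?thesis using True by simp
  next
    case False
    obtain \<alpha> where a: "graph_iso (cell_graph X C) (cell_graph X C\<^sub>0) \<alpha>" "\<alpha> x = x0" "\<alpha> z = y0"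
      using iso_pair[OF C False C0 x0] by blast
    have "(adj (cell_graph X C\<^sub>0) ^^ j) x0 y0" using graph_iso_walk[OF a(1) simple_cell_graph w] a by simp
    from bipartite_walk[of "cell_graph X C\<^sub>0" A, OF _ this] A have "even j \<longleftrightarrow> same" unfolding same_def by blast
    then show ?thesis using False by simp
  qed
  \<comment> \<open>The walk is cut at its returns to \<open>F\<close>. A piece from a vertex back
    to itself is even and dropped; if \<open>same\<close> fails, a piece between different vertices
    is odd and becomes one reduced edge. Pieces have length at least 2, hence m < n unless n =
    0.\<close>
  have trace: "(same \<longrightarrow> even n) \<and> (\<not> same \<longrightarrow> (\<exists>m. (m < n \<or> n = 0) \<and> m \<le> n \<and> (even m \<longleftrightarrow> even n) \<and> (adj (reduced_graph X F) ^^ m) x y))"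
    if "x \<in> F" "y \<in> F" "(adj X ^^ n) x y" for x y n
    using that
  proof (induction n arbitrary: x rule: less_induct)
    case (less n)
    show ?case
    proof (cases "n = 0")
      case True
      then show ?thesis using less.prems by (auto intro!: exI[of _ 0])
    next
      case False
      then obtain C j z where C: "C \<in> cells X F" "2 \<le> j" "j \<le> n" "x \<in> vboundary X C" "z \<in> vboundary X C"
        "(adj (cell_graph X C) ^^ j) x z" "(adj X ^^ (n - j)) z y"
        using first_return[OF less.prems] by blast
      have zF: "z \<in> F" using boundary_sub[OF C(1)] C(5) by blast
      have lt: "n - j < n" using C(2,3) by simp
      note IH = less.IH[OF lt zF less.prems(2) C(7)]
      note par = parity[OF C(1,4,5,6)]
      show ?thesis
      proof (cases same)
        case True
        then have "even (n - j)" "even j" using conjunct1[OF IH] par by simp_all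
        then have "even n" using C(3) by (metis even_add le_add_diff_inverse)
        then show ?thesis using True by simp
      next
        case False
        with conjunct2[OF IH] obtain m where m: "m \<le> n - j" "even m \<longleftrightarrow> even (n - j)" "(adj (reduced_graph X F) ^^ m) z y" by auto
        have ev: "even n \<longleftrightarrow> (even (n - j) \<longleftrightarrow> even j)" using C(3) by (metis even_add le_add_diff_inverse)
        show ?thesis
        proof (cases "x = z")
          case True
          then have "even j" using par by simp
          then have "even m \<longleftrightarrow> even n" using m(2) ev by blast
          moreover have "m < n" using m(1) C(2,3) by linarith
          ultimately have "(m < n \<or> n = 0) \<and> m \<le> n \<and> (even m \<longleftrightarrow> even n) \<and> (adj (reduced_graph X F) ^^ m) x y"
            using m(3) True by simp
          then show ?thesis using False by blast
        next
          case xz: False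
          then have "odd j" using par False by simp
          have "adj (reduced_graph X F) x z" unfolding adj_reduced using C xz zF less.prems(1) by blast
          then have "(adj (reduced_graph X F) ^^ Suc m) x y" using m(3) by (rule relpowp_Suc_I2)
          moreover have "Suc m < n" using m(1) C(2,3) by linarith
          moreover have "even (Suc m) \<longleftrightarrow> even n" using m(2) ev \<open>odd j\<close> unfolding even_Suc by blast
          ultimately have "(Suc m < n \<or> n = 0) \<and> Suc m \<le> n \<and> (even (Suc m) \<longleftrightarrow> even n) \<and> (adj (reduced_graph X F) ^^ Suc m) x y"
            by simp
          then show ?thesis using False by blast
        qed
      qed
    qed
  qed
  have no_odd: "even n" if "(adj X ^^ n) v v" for n
    using that
  proof (induction n rule: less_induct)
    case (less n)
    show ?case
    proof (rule ccontr)
      assume o: "odd n"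
      then obtain m where m: "m < n" "even m \<longleftrightarrow> even n" "(adj (reduced_graph X F) ^^ m) v v"
        using trace[OF v_F v_F less.prems] by (metis even_zero)
      have "simple_graph (reduced_graph X F)" unfolding simple_graph_def reduced_graph_def by auto
      \<comment> \<open>As \<open>v\<close> is fixed by \<open>\<psi>\<close>, pulling back gives a
        shorter odd closed walk at the same vertex.\<close>
      from graph_iso_walk[OF graph_iso_inverse[OF iso] this m(3)]
      have "(adj X ^^ m) (inv_into (verts X) \<psi> v) (inv_into (verts X) \<psi> v)" .
      moreover have "inv_into (verts X) \<psi> v = v"
        using iso v_verts psi_v unfolding graph_iso_def bij_betw_def by (metis inv_into_f_f)
      ultimately show False using less.IH[OF m(1)] m(2) o by simp
    qed
  qed
  show False using odd_closed_walk[OF simple conn nb v_verts] no_odd by blast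
qed

text \<open>Up to isomorphism there is a single cell graph. It is finite, has an odd closed walk at
  each vertex, and every vertex of \<open>X\<close> lies in a copy, so a maximum over one cell
  serves all.\<close>

lemma uniform_odd_walk:
  assumes nb: "\<not> bipartite X"
  shows "\<exists>L. \<forall>x\<in>verts X. \<exists>l\<le>L. odd l \<and> (adj X ^^ l) x x"
proof -
  obtain C\<^sub>0 where C0: "C\<^sub>0 \<in> cells X F" using base_cell by blast
  let ?V = "verts (cell_graph X C\<^sub>0)"
  have "\<exists>l. odd l \<and> (adj (cell_graph X C\<^sub>0) ^^ l) x x" if "x \<in> ?V" for x
    by (rule odd_closed_walk[OF simple_cell_graph cell_graph_connected[OF C0] cells_not_bipartite[OF nb C0] that])
  then obtain l where l: "\<And>x. x \<in> ?V \<Longrightarrow> odd (l x) \<and> (adj (cell_graph X C\<^sub>0) ^^ (l x)) x x" by metis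
  have fin: "finite ?V" by (rule finite_cell_graph[OF C0])
  have "\<exists>l'\<le>Max (l ` ?V). odd l' \<and> (adj X ^^ l') x x" if x: "x \<in> verts X" for x
  proof -
    obtain C where C: "C \<in> cells X F" "x \<in> verts (cell_graph X C)" using ex_cell_graph[OF x] by blast
    obtain \<alpha> where a: "graph_iso (cell_graph X C) (cell_graph X C\<^sub>0) \<alpha>" using S1[OF C(1) C0] by blast
    have ax: "\<alpha> x \<in> ?V" using a C(2) unfolding graph_iso_def by (metis bij_betw_apply)
    have "inv_into (verts (cell_graph X C)) \<alpha> (\<alpha> x) = x"
      using a C(2) unfolding graph_iso_def bij_betw_def by (metis inv_into_f_f)
    then have "(adj (cell_graph X C) ^^ (l (\<alpha> x))) x x"
      using graph_iso_walk[OF graph_iso_inverse[OF a] simple_cell_graph] l[OF ax] by metis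
    then have "(adj X ^^ (l (\<alpha> x))) x x" by (rule cell_walk)
    moreover have "l (\<alpha> x) \<le> Max (l ` ?V)" using ax fin by (intro Max_ge) auto
    ultimately show ?thesis using l[OF ax] by blast
  qed
  then show ?thesis by blast
qed

end

subsection \<open>The time scaling factor\<close>

lemma inverse_on_eqI:
  assumes fin: "finite V" and out: "\<And>x y. x \<notin> V \<or> y \<notin> V \<Longrightarrow> M x y = 0"
    and right: "\<And>x y. x \<in> V \<Longrightarrow> y \<in> V \<Longrightarrow> (\<Sum>w\<in>V. A x w * M w y) = (if x = y then 1 else 0)"
    and left: "\<And>x y. x \<in> V \<Longrightarrow> y \<in> V \<Longrightarrow> (\<Sum>w\<in>V. M x w * A w y) = (if x = y then 1 else 0)"
  shows "inverse_on V A = M"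
  unfolding inverse_on_def
proof (rule the_equality)
  show "(\<forall>x y. x \<notin> V \<or> y \<notin> V \<longrightarrow> M x y = 0) \<and>
     (\<forall>x\<in>V. \<forall>y\<in>V. (\<Sum>w\<in>V. A x w * M w y) = (if x = y then 1 else 0)) \<and>
     (\<forall>x\<in>V. \<forall>y\<in>V. (\<Sum>w\<in>V. M x w * A w y) = (if x = y then 1 else 0))"
    using out right left by simp
next
  fix M'
  assume "(\<forall>x y. x \<notin> V \<or> y \<notin> V \<longrightarrow> M' x y = 0) \<and>
     (\<forall>x\<in>V. \<forall>y\<in>V. (\<Sum>w\<in>V. A x w * M' w y) = (if x = y then 1 else 0)) \<and>
     (\<forall>x\<in>V. \<forall>y\<in>V. (\<Sum>w\<in>V. M' x w * A w y) = (if x = y then 1 else 0))"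
  then have out': "\<And>x y. x \<notin> V \<or> y \<notin> V \<Longrightarrow> M' x y = 0"
    and left': "\<And>x y. x \<in> V \<Longrightarrow> y \<in> V \<Longrightarrow> (\<Sum>w\<in>V. M' x w * A w y) = (if x = y then 1 else 0)" by auto
  show "M' = M"
  proof (intro ext)
    fix x y
    show "M' x y = M x y"
    proof (cases "x \<in> V \<and> y \<in> V")
      case True
      have "M' x y = (\<Sum>w\<in>V. M' x w * (if w = y then 1 else 0))"
        using True fin by (simp add: if_distrib sum.delta cong: if_cong)
      also have "\<dots> = (\<Sum>w\<in>V. M' x w * (\<Sum>u\<in>V. A w u * M u y))"
        using True by (intro sum.cong refl) (simp add: right)
      also have "\<dots> = (\<Sum>u\<in>V. (\<Sum>w\<in>V. M' x w * A w u) * M u y)"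
        unfolding sum_distrib_left sum_distrib_right by (subst sum.swap) (simp add: mult.assoc)
      also have "\<dots> = (\<Sum>u\<in>V. (if x = u then 1 else 0) * M u y)"
        using True by (intro sum.cong refl) (simp add: left')
      also have "\<dots> = M x y" using True fin by (simp add: if_distrib[of "\<lambda>t. t * _"] sum.delta' cong: if_cong)
      finally show ?thesis .
    next
      case False
      then show ?thesis using out out' by auto
    qed
  qed
qed

section \<open>Absorbed random walk on a finite connected graph\<close>

locale absorbing =
  fixes Y :: "'a graph" and B :: "'a set"
  assumes simpleY: "simple_graph Y" and finY: "finite (verts Y)" and connY: "graph_connected Y"
    and B: "B \<subseteq> verts Y" "B \<noteq> {}"
begin

abbreviation "V \<equiv> verts Y"

definition q :: "'a \<Rightarrow> 'a \<Rightarrow> real" where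
  "q x y = (if x \<in> V - B \<and> y \<in> nbrs Y x then 1 / real (deg Y x) else 0)"

primrec qp :: "nat \<Rightarrow> 'a \<Rightarrow> 'a \<Rightarrow> real" where
  "qp 0 x y = (if x = y then 1 else 0)"
| "qp (Suc n) x y = (\<Sum>w\<in>V. q x w * qp n w y)"

text \<open>The rows of \<open>q\<close> in \<open>B\<close> are zero, so mass that has entered
  \<open>B\<close> disappears in the next step. Hence \<open>hit n\<close> is the probability that
  the first visit to \<open>B\<close> happens at time n exactly, and \<open>survival n\<close> that
  it has not happened by then.\<close>

definition survival :: "nat \<Rightarrow> 'a \<Rightarrow> real" where "survival n x = (\<Sum>y\<in>V - B. qp n x y)"
definition hit :: "nat \<Rightarrow> 'a \<Rightarrow> real" where "hit n x = (\<Sum>y\<in>B. qp n x y)"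

lemma absorbed_matrix_eq: "absorbed_matrix Y B x y = of_real (q x y)"
  by (simp add: absorbed_matrix_def q_def)

lemma q_nonneg: "q x y \<ge> 0" by (simp add: q_def)
lemma qp_nonneg: "qp n x y \<ge> 0"
  by (induction n arbitrary: x) (auto intro!: sum_nonneg mult_nonneg_nonneg q_nonneg)
lemma survival_nonneg: "survival n x \<ge> 0" unfolding survival_def by (intro sum_nonneg qp_nonneg)
lemma hit_nonneg: "hit n x \<ge> 0" unfolding hit_def by (intro sum_nonneg qp_nonneg)

lemma nbrs_sub: "nbrs Y x \<subseteq> V" by (auto simp: nbrs_def)

lemma deg_pos:
  assumes "x \<in> V - B"
  shows "deg Y x > 0"
proof -
  obtain b where "b \<in> B" using B by blast
  then have "(adj Y)\<^sup>*\<^sup>* x b" "x \<noteq> b" using connY B assms unfolding graph_connected_def by auto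
  then obtain w where "adj Y x w" by (metis converse_rtranclpE)
  then have "w \<in> nbrs Y x" using nbrs_iff[OF simpleY] by simp
  then show ?thesis unfolding deg_def using finite_subset[OF nbrs_sub finY] by (auto simp: card_gt_0_iff)
qed

lemma q_sum: "x \<in> V - B \<Longrightarrow> (\<Sum>y\<in>V. q x y) = 1"
proof -
  assume x: "x \<in> V - B"
  have "(\<Sum>y\<in>V. q x y) = (\<Sum>y\<in>nbrs Y x. 1 / real (deg Y x))"
    by (rule sum.mono_neutral_cong_right) (use x finY nbrs_sub in \<open>auto simp: q_def\<close>)
  also have "\<dots> = 1" using deg_pos[OF x] by (simp add: deg_def)
  finally show ?thesis .
qed

lemma q_B: "x \<notin> V - B \<Longrightarrow> q x y = 0" by (auto simp: q_def)

lemma qp_Suc': "y \<in> V \<Longrightarrow> x \<in> V \<Longrightarrow> qp (Suc n) x y = (\<Sum>w\<in>V. qp n x w * q w y)"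
proof (induction n arbitrary: x)
  case 0
  have "(\<Sum>w\<in>V. q x w * (if w = y then 1 else 0)) = q x y"
    using 0 finY by (simp add: if_distrib sum.delta cong: if_cong)
  moreover have "(\<Sum>w\<in>V. (if x = w then 1 else 0) * q w y) = q x y"
    using 0 finY by (simp add: if_distrib[of "\<lambda>t. t * _"] sum.delta' cong: if_cong)
  ultimately show ?case by simp
next
  case (Suc n)
  have "qp (Suc (Suc n)) x y = (\<Sum>u\<in>V. q x u * (\<Sum>w\<in>V. qp n u w * q w y))"
    unfolding qp.simps(2)[of "Suc n"] by (intro sum.cong refl) (simp only: Suc.IH[OF Suc.prems(1)])
  also have "\<dots> = (\<Sum>w\<in>V. (\<Sum>u\<in>V. q x u * qp n u w) * q w y)"
    unfolding sum_distrib_left sum_distrib_right by (subst sum.swap) (simp add: mult.assoc)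
  finally show ?case by simp
qed

lemma survival_Suc: "survival (Suc n) x = (\<Sum>w\<in>V. q x w * survival n w)"
  unfolding survival_def qp.simps sum_distrib_left by (rule sum.swap)

lemma survival_split: "x \<in> V \<Longrightarrow> survival n x = survival (Suc n) x + hit (Suc n) x"
proof -
  assume x: "x \<in> V"
  have "survival (Suc n) x + hit (Suc n) x = (\<Sum>y\<in>V. qp (Suc n) x y)"
    unfolding survival_def hit_def using B(1) finY by (simp add: sum.subset_diff)
  also have "\<dots> = (\<Sum>y\<in>V. \<Sum>w\<in>V. qp n x w * q w y)" using x by (intro sum.cong refl qp_Suc')
  also have "\<dots> = (\<Sum>w\<in>V. qp n x w * (\<Sum>y\<in>V. q w y))"
    unfolding sum_distrib_left by (rule sum.swap)
  also have "\<dots> = (\<Sum>w\<in>V - B. qp n x w)"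
    by (rule sum.mono_neutral_cong_right) (use finY q_sum q_B in auto)
  finally show ?thesis by (simp add: survival_def)
qed

lemma survival_antimono_Suc: "x \<in> V \<Longrightarrow> survival (Suc n) x \<le> survival n x"
  using survival_split[of x n] hit_nonneg[of "Suc n" x] by simp

lemma survival_antimono: "x \<in> V \<Longrightarrow> m \<le> n \<Longrightarrow> survival n x \<le> survival m x"
  by (rule lift_Suc_antimono_le[of "\<lambda>n. survival n x"]) (auto intro: survival_antimono_Suc)

lemma survival_0: "x \<in> V \<Longrightarrow> survival 0 x = (if x \<in> B then 0 else 1)"
  unfolding survival_def using finY by (simp add: sum.delta')

lemma survival_le_1: "x \<in> V \<Longrightarrow> survival n x \<le> 1"
  using survival_antimono[of x 0 n] survival_0[of x] by (simp split: if_splits)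

lemma survival_B: "x \<in> B \<Longrightarrow> survival n x = 0"
  using survival_antimono[of x 0 n] survival_0[of x] survival_nonneg[of n x] B by auto

lemma survival_less_1: "(adj Y ^^ n) x b \<Longrightarrow> b \<in> B \<Longrightarrow> x \<in> V \<Longrightarrow> survival n x < 1"
proof (induction n arbitrary: x)
  case 0
  then show ?case using survival_B[of b 0] by simp
next
  case (Suc n)
  show ?case
  proof (cases "x \<in> B")
    case True
    then show ?thesis using survival_B by simp
  next
    case False
    then have x: "x \<in> V - B" using Suc.prems by simp
    obtain w where w: "adj Y x w" "(adj Y ^^ n) w b" using Suc.prems(1) by (metis relpowp_Suc_E2)
    have wV: "w \<in> V" using adj_verts[OF simpleY w(1)] by simp
    have lt: "survival n w < 1" by (rule Suc.IH[OF w(2) Suc.prems(2) wV])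
    have qw: "q x w > 0" using x w(1) deg_pos[OF x] nbrs_iff[OF simpleY] by (simp add: q_def)
    have "survival (Suc n) x < (\<Sum>u\<in>V. q x u * 1)"
      unfolding survival_Suc
    proof (rule sum_strict_mono_ex1[OF finY])
      show "\<forall>u\<in>V. q x u * survival n u \<le> q x u * 1" by (intro ballI mult_left_mono survival_le_1 q_nonneg)
      show "\<exists>u\<in>V. q x u * survival n u < q x u * 1" using wV lt qw by (intro bexI[of _ w]) auto
    qed
    then show ?thesis using q_sum[OF x] by simp
  qed
qed

text \<open>From every vertex \<open>B\<close> is reached within \<open>N\<close> steps with
  positive probability, and there are finitely many vertices, so survival loses a fixed factor in
  every block of \<open>N\<close> steps.\<close>

lemma survival_geometric: "\<exists>K \<theta>. K \<ge> 0 \<and> 0 < \<theta> \<and> \<theta> < 1 \<and> (\<forall>n. \<forall>x\<in>V. survival n x \<le> K * \<theta> ^ n)"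
proof -
  obtain b where b: "b \<in> B" using B by blast
  have "\<exists>n. (adj Y ^^ n) x b" if "x \<in> V" for x
    using that b B connY unfolding graph_connected_def by (metis rtranclp_power subsetD)
  then obtain len where len: "\<And>x. x \<in> V \<Longrightarrow> (adj Y ^^ len x) x b" by metis
  define N where "N = Suc (Max (len ` V))"
  have lt: "survival N x < 1" if x: "x \<in> V" for x
  proof -
    have "len x \<le> N" using x finY by (simp add: N_def le_SucI)
    then have "survival N x \<le> survival (len x) x" by (rule survival_antimono[OF x])
    also have "\<dots> < 1" by (rule survival_less_1[OF len[OF x] b x])
    finally show ?thesis .
  qed
  have Vne: "V \<noteq> {}" using B by auto
  \<comment> \<open>The value 1/2 only keeps \<rho> positive, as its N-th root is taken
    below.\<close>
  define \<rho> where "\<rho> = max (1/2) (Max (survival N ` V))"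
  have \<rho>: "0 < \<rho>" "\<rho> < 1" "\<And>x. x \<in> V \<Longrightarrow> survival N x \<le> \<rho>"
    using lt finY Vne by (auto simp: \<rho>_def le_max_iff_disj)
  have step: "survival (m + N) x \<le> \<rho> * survival m x" if "x \<in> V" for m x
    using that
  proof (induction m arbitrary: x)
    case 0
    then show ?case using \<rho>(3) survival_0 survival_B by auto
  next
    case (Suc m)
    have "survival (Suc m + N) x = (\<Sum>w\<in>V. q x w * survival (m + N) w)" by (simp add: survival_Suc)
    also have "\<dots> \<le> (\<Sum>w\<in>V. q x w * (\<rho> * survival m w))" by (intro sum_mono mult_left_mono Suc.IH q_nonneg)
    also have "\<dots> = \<rho> * survival (Suc m) x" by (simp add: survival_Suc sum_distrib_left mult_ac)
    finally show ?case .
  qed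
  have mult: "survival (j * N) x \<le> \<rho> ^ j" if x: "x \<in> V" for j x
  proof (induction j)
    case 0 then show ?case using survival_le_1[OF x] by simp
  next
    case (Suc j)
    have "survival (Suc j * N) x \<le> \<rho> * survival (j * N) x" using step[OF x, of "j * N"] by (simp add: add.commute)
    also have "\<dots> \<le> \<rho> * \<rho> ^ j" using Suc \<rho> by (intro mult_left_mono) auto
    finally show ?case by simp
  qed
  define \<theta> where "\<theta> = \<rho> powr (1 / real N)"
  have N: "real N > 0" by (simp add: N_def)
  have "\<theta> < \<rho> powr 0" unfolding \<theta>_def using \<rho> N by (intro powr_less_mono') auto
  then have \<theta>: "0 < \<theta>" "\<theta> < 1" using \<rho> by (auto simp: \<theta>_def)
  \<comment> \<open>The factor 1 / \<rho> pays for rounding n / N down to a whole number of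
    blocks.\<close>
  have "survival n x \<le> (1 / \<rho>) * \<theta> ^ n" if x: "x \<in> V" for n x
  proof -
    define j where "j = n div N"
    have "n < (j + 1) * N" using N by (simp add: j_def dividend_less_div_times)
    then have "real n \<le> (real j + 1) * real N" by (metis less_imp_le of_nat_1 of_nat_add of_nat_le_iff of_nat_mult)
    then have nj: "real n / real N \<le> real j + 1" using N by (simp add: pos_divide_le_eq)
    have "survival n x \<le> survival (j * N) x" by (rule survival_antimono[OF x]) (simp add: j_def)
    also have "\<dots> \<le> \<rho> ^ j" by (rule mult[OF x])
    also have "\<dots> = (1 / \<rho>) * \<rho> powr (real j + 1)" using \<rho> by (simp add: powr_add powr_realpow)
    also have "\<dots> \<le> (1 / \<rho>) * \<rho> powr (real n / real N)" using \<rho> nj by (intro mult_left_mono powr_mono') auto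
    also have "\<rho> powr (real n / real N) = \<theta> ^ n" using \<theta> by (simp add: \<theta>_def powr_powr flip: powr_realpow)
    finally show ?thesis .
  qed
  moreover have "1 / \<rho> \<ge> 0" using \<rho> by simp
  ultimately show ?thesis using \<theta> by blast
qed

lemma qp_le_survival: "x \<in> V \<Longrightarrow> y \<in> V \<Longrightarrow> qp (Suc n) x y \<le> survival n x"
proof -
  assume x: "x \<in> V" and y: "y \<in> V"
  have "qp (Suc n) x y \<le> (\<Sum>y\<in>V. qp (Suc n) x y)" by (rule member_le_sum[OF y qp_nonneg finY])
  also have "\<dots> = survival (Suc n) x + hit (Suc n) x"
    unfolding survival_def hit_def using B(1) finY by (simp add: sum.subset_diff)
  finally show ?thesis using survival_split[OF x, of n] by linarith
qed

lemma qp_geometric: "\<exists>K \<theta>. K \<ge> 0 \<and> 0 < \<theta> \<and> \<theta> < 1 \<and> (\<forall>n. \<forall>x\<in>V. \<forall>y\<in>V. qp n x y \<le> K * \<theta> ^ n)"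
proof -
  obtain K \<theta> where K: "K \<ge> 0" "0 < \<theta>" "\<theta> < 1" "\<And>n x. x \<in> V \<Longrightarrow> survival n x \<le> K * \<theta> ^ n"
    using survival_geometric by blast
  have "qp n x y \<le> (1 + K / \<theta>) * \<theta> ^ n" if "x \<in> V" "y \<in> V" for n x y
  proof (cases n)
    case 0
    then show ?thesis using K by (simp add: add_nonneg_nonneg)
  next
    case (Suc k)
    have "qp n x y \<le> K * \<theta> ^ k" unfolding Suc using qp_le_survival[OF that, of k] K(4)[OF that(1), of k] by linarith
    also have "\<dots> = K / \<theta> * \<theta> ^ n" using K by (simp add: Suc)
    also have "\<dots> \<le> (1 + K / \<theta>) * \<theta> ^ n" using K by (intro mult_right_mono) auto
    finally show ?thesis .
  qed
  moreover have "1 + K / \<theta> \<ge> 0" using K by simp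
  ultimately show ?thesis using K(2,3) by blast
qed

definition G :: "complex \<Rightarrow> 'a \<Rightarrow> 'a \<Rightarrow> complex" where
  "G z x y = (if x \<in> V \<and> y \<in> V then (\<Sum>n. of_real (qp n x y) * z ^ n) else 0)"

definition A :: "complex \<Rightarrow> 'a \<Rightarrow> 'a \<Rightarrow> complex" where
  "A z x y = (if x = y then 1 else 0) - z * absorbed_matrix Y B x y"

text \<open>Geometric decay pushes the radius of convergence beyond 1. This is essential, since the
  time scaling factor is a derivative at the point 1.\<close>

lemma neumann_series:
  "\<exists>R>1. \<forall>z. cmod z < R \<longrightarrow>
     (\<forall>x\<in>V. \<forall>y\<in>V. (\<lambda>n. of_real (qp n x y) * z ^ n) sums G z x y) \<and>
     (\<forall>x\<in>V. \<forall>y\<in>V. (\<Sum>w\<in>V. A z x w * G z w y) = (if x = y then 1 else 0)) \<and>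
     (\<forall>x\<in>V. \<forall>y\<in>V. (\<Sum>w\<in>V. G z x w * A z w y) = (if x = y then 1 else 0))"
proof -
  obtain K \<theta> where K: "K \<ge> 0" "0 < \<theta>" "\<theta> < 1" "\<And>n x y. x \<in> V \<Longrightarrow> y \<in> V \<Longrightarrow> qp n x y \<le> K * \<theta> ^ n"
    using qp_geometric by blast
  have main: "(\<forall>x\<in>V. \<forall>y\<in>V. (\<lambda>n. of_real (qp n x y) * z ^ n) sums G z x y) \<and>
     (\<forall>x\<in>V. \<forall>y\<in>V. (\<Sum>w\<in>V. A z x w * G z w y) = (if x = y then 1 else 0)) \<and>
     (\<forall>x\<in>V. \<forall>y\<in>V. (\<Sum>w\<in>V. G z x w * A z w y) = (if x = y then 1 else 0))"
    if z: "cmod z < 1 / \<theta>" for z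
  proof -
    have tz: "\<theta> * cmod z < 1" using z K by (simp add: pos_less_divide_eq mult.commute)
    have sums: "(\<lambda>n. of_real (qp n x y) * z ^ n) sums G z x y" if xy: "x \<in> V" "y \<in> V" for x y
    proof -
      have "summable (\<lambda>n. K * (\<theta> * cmod z) ^ n)" using tz K by (intro summable_mult summable_geometric) simp
      then have "summable (\<lambda>n. complex_of_real (qp n x y) * z ^ n)"
      proof (rule summable_comparison_test'[where N = 0])
        fix n
        have "qp n x y * cmod z ^ n \<le> K * \<theta> ^ n * cmod z ^ n" by (intro mult_right_mono K xy) simp
        then show "cmod (of_real (qp n x y) * z ^ n) \<le> K * (\<theta> * cmod z) ^ n"
          by (simp add: norm_mult norm_power power_mult_distrib qp_nonneg mult.assoc)
      qed
      then show ?thesis using xy by (simp add: G_def summable_sums)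
    qed
    have shift: "(\<lambda>n. of_real (qp (Suc n) x y) * z ^ Suc n) sums (G z x y - (if x = y then 1 else 0))"
      if "x \<in> V" "y \<in> V" for x y
      using sums[OF that] sums_Suc_iff[of "\<lambda>n. of_real (qp n x y) * z ^ n" "G z x y - (if x = y then 1 else 0)"]
      by (cases "x = y") (simp_all del: qp.simps(2))
    have right: "(\<Sum>w\<in>V. A z x w * G z w y) = (if x = y then 1 else 0)" if xy: "x \<in> V" "y \<in> V" for x y
    proof -
      have "(\<lambda>n. z * (\<Sum>w\<in>V. of_real (q x w) * (of_real (qp n w y) * z ^ n))) sums (z * (\<Sum>w\<in>V. of_real (q x w) * G z w y))"
        using xy by (intro sums_mult sums_sum sums) auto
      moreover have "z * (\<Sum>w\<in>V. of_real (q x w) * (of_real (qp n w y) * z ^ n)) = of_real (qp (Suc n) x y) * z ^ Suc n" for n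
        by (simp add: sum_distrib_left sum_distrib_right mult_ac)
      ultimately have e: "z * (\<Sum>w\<in>V. of_real (q x w) * G z w y) = G z x y - (if x = y then 1 else 0)"
        using sums_unique2[OF shift[OF xy]] by simp
      have "(\<Sum>w\<in>V. A z x w * G z w y) = (\<Sum>w\<in>V. (if x = w then G z w y else 0)) - z * (\<Sum>w\<in>V. of_real (q x w) * G z w y)"
        unfolding A_def absorbed_matrix_eq sum_distrib_left sum_subtractf[symmetric]
        by (intro sum.cong refl) (simp add: algebra_simps)
      also have "(\<Sum>w\<in>V. (if x = w then G z w y else 0)) = G z x y" using xy finY by (simp add: sum.delta')
      finally show ?thesis unfolding e by simp
    qed
    have left: "(\<Sum>w\<in>V. G z x w * A z w y) = (if x = y then 1 else 0)" if xy: "x \<in> V" "y \<in> V" for x y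
    proof -
      have "(\<lambda>n. z * (\<Sum>w\<in>V. of_real (q w y) * (of_real (qp n x w) * z ^ n))) sums (z * (\<Sum>w\<in>V. of_real (q w y) * G z x w))"
        using xy by (intro sums_mult sums_sum sums) auto
      moreover have "z * (\<Sum>w\<in>V. of_real (q w y) * (of_real (qp n x w) * z ^ n)) = of_real (qp (Suc n) x y) * z ^ Suc n" for n
        unfolding qp_Suc'[OF xy(2,1)] by (simp add: sum_distrib_left sum_distrib_right mult_ac)
      ultimately have e: "z * (\<Sum>w\<in>V. of_real (q w y) * G z x w) = G z x y - (if x = y then 1 else 0)"
        using sums_unique2[OF shift[OF xy]] by simp
      have "(\<Sum>w\<in>V. G z x w * A z w y) = (\<Sum>w\<in>V. (if w = y then G z x w else 0)) - z * (\<Sum>w\<in>V. of_real (q w y) * G z x w)"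
        unfolding A_def absorbed_matrix_eq sum_distrib_left sum_subtractf[symmetric]
        by (intro sum.cong refl) (simp add: algebra_simps)
      also have "(\<Sum>w\<in>V. (if w = y then G z x w else 0)) = G z x y" using xy finY by (simp add: sum.delta)
      finally show ?thesis unfolding e by simp
    qed
    show ?thesis using sums right left by blast
  qed
  show ?thesis by (rule exI[of _ "1 / \<theta>"]) (use main K in simp)
qed

lemma hit_sums_1:
  assumes v: "v \<in> V - B"
  shows "(\<lambda>n. hit n v) sums 1"
proof -
  have "(\<Sum>n<Suc N. hit n v) = 1 - survival N v" for N
  proof (induction N)
    case 0
    have "hit 0 v = 0" unfolding hit_def using v by (intro sum.neutral) auto
    then show ?case using survival_0[of v] v by simp
  next
    case (Suc N)
    then show ?case using survival_split[of v N] v by simp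
  qed
  moreover have "(\<lambda>N. survival N v) \<longlonglongrightarrow> 0"
  proof -
    obtain K \<theta> where K: "K \<ge> 0" "0 < \<theta>" "\<theta> < 1" "\<And>n x. x \<in> V \<Longrightarrow> survival n x \<le> K * \<theta> ^ n"
      using survival_geometric by blast
    have "(\<lambda>n. K * \<theta> ^ n) \<longlonglongrightarrow> 0" using K by (intro tendsto_mult_right_zero LIMSEQ_power_zero) auto
    then show ?thesis
      by (rule Lim_null_comparison[rotated]) (use K(4)[of v] v survival_nonneg in \<open>auto intro!: always_eventually\<close>)
  qed
  then have "(\<lambda>N. 1 - survival N v) \<longlonglongrightarrow> 1 - 0" by (intro tendsto_intros)
  ultimately have "(\<lambda>N. \<Sum>n<Suc N. hit n v) \<longlonglongrightarrow> 1" by simp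
  then show ?thesis unfolding sums_def by (rule LIMSEQ_imp_Suc)
qed

end

section \<open>Transport of the absorbed Green function along isomorphisms\<close>

lemma graph_iso_deg:
  assumes iso: "graph_iso Y Z \<alpha>" and x: "x \<in> verts Y"
  shows "nbrs Z (\<alpha> x) = \<alpha> ` nbrs Y x" "deg Z (\<alpha> x) = deg Y x"
proof -
  have b: "bij_betw \<alpha> (verts Y) (verts Z)" and a: "\<And>y. y \<in> verts Y \<Longrightarrow> adj Y x y \<longleftrightarrow> adj Z (\<alpha> x) (\<alpha> y)"
    using iso x unfolding graph_iso_def by auto
  show n: "nbrs Z (\<alpha> x) = \<alpha> ` nbrs Y x"
  proof (intro equalityI subsetI)
    fix u assume "u \<in> nbrs Z (\<alpha> x)"
    then have u: "u \<in> verts Z" "adj Z (\<alpha> x) u" by (auto simp: nbrs_def)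
    then obtain y where "y \<in> verts Y" "u = \<alpha> y" using b unfolding bij_betw_def by blast
    then show "u \<in> \<alpha> ` nbrs Y x" using u a by (auto simp: nbrs_def)
  next
    fix u assume "u \<in> \<alpha> ` nbrs Y x"
    then obtain y where "y \<in> verts Y" "adj Y x y" "u = \<alpha> y" by (auto simp: nbrs_def)
    then show "u \<in> nbrs Z (\<alpha> x)" using a bij_betw_apply[OF b] by (auto simp: nbrs_def)
  qed
  have "inj_on \<alpha> (nbrs Y x)" using b unfolding bij_betw_def nbrs_def by (auto intro: inj_on_subset)
  then show "deg Z (\<alpha> x) = deg Y x" unfolding deg_def n by (rule card_image)
qed

lemma absorbed_matrix_iso:
  assumes iso: "graph_iso Y Z \<alpha>" and xy: "x \<in> verts Y" "y \<in> verts Y" and B: "B \<subseteq> verts Y"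
  shows "absorbed_matrix Z (\<alpha> ` B) (\<alpha> x) (\<alpha> y) = absorbed_matrix Y B x y"
proof -
  have b: "bij_betw \<alpha> (verts Y) (verts Z)" using iso by (simp add: graph_iso_def)
  then have inj: "inj_on \<alpha> (verts Y)" by (simp add: bij_betw_def)
  have "\<alpha> x \<in> verts Z" using bij_betw_apply[OF b xy(1)] .
  moreover have "\<alpha> x \<in> \<alpha> ` B \<longleftrightarrow> x \<in> B" using inj_on_image_mem_iff[OF inj xy(1) B] .
  moreover have "\<alpha> y \<in> \<alpha> ` nbrs Y x \<longleftrightarrow> y \<in> nbrs Y x"
    by (rule inj_on_image_mem_iff[OF inj xy(2)]) (auto simp: nbrs_def)
  ultimately show ?thesis using xy
    unfolding absorbed_matrix_def graph_iso_deg[OF iso xy(1)] by simp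
qed

text \<open>\<open>inverse_on\<close> is a definite description, so an inverse must be exhibited
  before anything can be said about it. The inverse \<open>M\<close> on the source graph is
  therefore given, and its transported copy is shown to be the inverse on the target.\<close>

lemma absorbed_green_iso:
  assumes iso: "graph_iso Y Z \<alpha>" and B: "B \<subseteq> verts Y" and fin: "finite (verts Y)"
    and out: "\<And>x y. x \<notin> verts Y \<or> y \<notin> verts Y \<Longrightarrow> M x y = 0"
    and right: "\<And>x y. x \<in> verts Y \<Longrightarrow> y \<in> verts Y \<Longrightarrow>
      (\<Sum>w\<in>verts Y. ((if x = w then 1 else 0) - z * absorbed_matrix Y B x w) * M w y) = (if x = y then 1 else 0)"
    and left: "\<And>x y. x \<in> verts Y \<Longrightarrow> y \<in> verts Y \<Longrightarrow>
      (\<Sum>w\<in>verts Y. M x w * ((if w = y then 1 else 0) - z * absorbed_matrix Y B w y)) = (if x = y then 1 else 0)"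
    and xy: "x \<in> verts Y" "y \<in> verts Y"
  shows "absorbed_green Z (\<alpha> ` B) z (\<alpha> x) (\<alpha> y) = M x y"
proof -
  have b: "bij_betw \<alpha> (verts Y) (verts Z)" using iso by (simp add: graph_iso_def)
  then have inj: "inj_on \<alpha> (verts Y)" and im: "\<alpha> ` verts Y = verts Z" by (simp_all add: bij_betw_def)
  let ?i = "inv_into (verts Y) \<alpha>"
  have i: "?i (\<alpha> u) = u" if "u \<in> verts Y" for u using inv_into_f_f[OF inj that] .
  define M' where "M' u w = (if u \<in> verts Z \<and> w \<in> verts Z then M (?i u) (?i w) else 0)" for u w
  have M': "M' (\<alpha> u) (\<alpha> w) = M u w" if "u \<in> verts Y" "w \<in> verts Y" for u w
    using that i im unfolding M'_def by auto
  have eq: "\<alpha> u = \<alpha> w \<longleftrightarrow> u = w" if "u \<in> verts Y" "w \<in> verts Y" for u w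
    using inj_on_eq_iff[OF inj that] .
  have "inverse_on (verts Z) (\<lambda>x y. (if x = y then 1 else 0) - z * absorbed_matrix Z (\<alpha> ` B) x y) = M'"
  proof (rule inverse_on_eqI)
    show "finite (verts Z)" using fin im by (metis finite_imageI)
    show "M' u w = 0" if "u \<notin> verts Z \<or> w \<notin> verts Z" for u w using that by (auto simp: M'_def)
    fix u' w' assume "u' \<in> verts Z" "w' \<in> verts Z"
    then obtain u w where u: "u \<in> verts Y" "u' = \<alpha> u" and w: "w \<in> verts Y" "w' = \<alpha> w" using im by blast
    show "(\<Sum>t\<in>verts Z. ((if u' = t then 1 else 0) - z * absorbed_matrix Z (\<alpha> ` B) u' t) * M' t w') = (if u' = w' then 1 else 0)"
      unfolding u(2) w(2) sum.reindex_bij_betw[OF b, symmetric] eq[OF u(1) w(1)] right[OF u(1) w(1), symmetric]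
      by (intro sum.cong refl) (simp add: eq u w M' absorbed_matrix_iso[OF iso _ _ B])
    show "(\<Sum>t\<in>verts Z. M' u' t * ((if t = w' then 1 else 0) - z * absorbed_matrix Z (\<alpha> ` B) t w')) = (if u' = w' then 1 else 0)"
      unfolding u(2) w(2) sum.reindex_bij_betw[OF b, symmetric] eq[OF u(1) w(1)] left[OF u(1) w(1), symmetric]
      by (intro sum.cong refl) (simp add: eq u w M' absorbed_matrix_iso[OF iso _ _ B])
  qed
  then show ?thesis unfolding absorbed_green_def using M'[OF xy] by simp
qed

context self_similar_walk
begin

text \<open>\<open>a n\<close> is the probability that the walk on a cell graph, started at a
  boundary vertex, first meets another boundary vertex at time n. Absorption is certain, so the sum
  is 1; two boundary vertices are neither equal nor adjacent, so the terms at 0 and 1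
  vanish.\<close>

lemma transition_series:
  "\<exists>R a. R > 1 \<and> (\<forall>n. a n \<ge> (0::real)) \<and> a 0 = 0 \<and> a 1 = 0 \<and> a sums 1 \<and>
    (\<forall>z. cmod z < R \<longrightarrow> (\<lambda>n. of_real (a n) * z ^ n) sums transition_function X F z)"
proof -
  obtain C v0 v1 where C: "C \<in> cells X F" "v0 \<in> vboundary X C" "v1 \<in> vboundary X C" "v0 \<noteq> v1"
    using base_cell by blast
  let ?Y = "cell_graph X C" and ?B = "vboundary X C - {v0}"
  have BV: "vboundary X C \<subseteq> verts ?Y" using verts_cell_graph[OF C(1)] by blast
  interpret absorbing ?Y ?B
    by unfold_locales (use simple_cell_graph finite_cell_graph[OF C(1)] cell_graph_connected[OF C(1)] BV C in auto)
  have v0: "v0 \<in> V - ?B" using BV C by auto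
  obtain R where R: "R > 1" "\<And>z x y. cmod z < R \<Longrightarrow> x \<in> V \<Longrightarrow> y \<in> V \<Longrightarrow> (\<lambda>n. of_real (qp n x y) * z ^ n) sums G z x y"
    "\<And>z x y. cmod z < R \<Longrightarrow> x \<in> V \<Longrightarrow> y \<in> V \<Longrightarrow> (\<Sum>w\<in>V. A z x w * G z w y) = (if x = y then 1 else 0)"
    "\<And>z x y. cmod z < R \<Longrightarrow> x \<in> V \<Longrightarrow> y \<in> V \<Longrightarrow> (\<Sum>w\<in>V. G z x w * A z w y) = (if x = y then 1 else 0)"
    using neumann_series by blast
  have Bs: "?B \<subseteq> V" using BV by auto
  \<comment> \<open>An isomorphism taking \<open>v0\<close> to \<open>w\<close> and boundary to
    boundary takes one absorbing set to the other. This independence of cell and vertex is what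
    gives the definite description of \<open>transition_function\<close> its value.\<close>
  have trans: "cell_transition X D w z = (\<Sum>y\<in>?B. G z v0 y)"
    if z: "cmod z < R" and D: "D \<in> cells X F" "w \<in> vboundary X D" for D w z
  proof -
    obtain \<alpha> where a: "graph_iso ?Y (cell_graph X D) \<alpha>" "\<alpha> ` vboundary X C = vboundary X D" "\<alpha> v0 = w"
      using iso_vertex[OF C(1,2) D] by blast
    have inj: "inj_on \<alpha> V" using a(1) by (simp add: graph_iso_def bij_betw_def)
    have im: "\<alpha> ` ?B = vboundary X D - {w}"
      using inj_on_image_set_diff[OF inj, of "vboundary X C" "{v0}"] a(2,3) BV v0 by auto
    have g: "absorbed_green (cell_graph X D) (vboundary X D - {w}) z w (\<alpha> y) = G z v0 y" if y: "y \<in> ?B" for y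
    proof -
      have "absorbed_green (cell_graph X D) (\<alpha> ` ?B) z (\<alpha> v0) (\<alpha> y) = G z v0 y"
      proof (rule absorbed_green_iso[OF a(1) Bs finY, where M = "G z"])
        show "G z x y = 0" if "x \<notin> V \<or> y \<notin> V" for x y using that by (auto simp: G_def)
      qed (use R(3,4)[OF z] v0 y Bs in \<open>auto simp: A_def\<close>)
      then show ?thesis unfolding im a(3) .
    qed
    have "cell_transition X D w z = (\<Sum>u\<in>\<alpha> ` ?B. absorbed_green (cell_graph X D) (vboundary X D - {w}) z w u)"
      unfolding cell_transition_def im ..
    also have "\<dots> = (\<Sum>y\<in>?B. absorbed_green (cell_graph X D) (vboundary X D - {w}) z w (\<alpha> y))"
      by (rule sum.reindex[OF inj_on_subset[OF inj Bs], unfolded o_def])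
    also have "\<dots> = (\<Sum>y\<in>?B. G z v0 y)" by (intro sum.cong refl g)
    finally show ?thesis .
  qed
  have tf: "transition_function X F z = (\<Sum>y\<in>?B. G z v0 y)" if z: "cmod z < R" for z
    unfolding transition_function_def
  proof (rule the_equality)
    show "\<forall>D\<in>cells X F. \<forall>w\<in>vboundary X D. cell_transition X D w z = (\<Sum>y\<in>?B. G z v0 y)" using trans[OF z] by blast
    show "c = (\<Sum>y\<in>?B. G z v0 y)" if "\<forall>D\<in>cells X F. \<forall>w\<in>vboundary X D. cell_transition X D w z = c" for c
      using that trans[OF z C(1,2)] C(1,2) by auto
  qed
  have "(\<lambda>n. of_real (hit n v0) * z ^ n) sums transition_function X F z" if z: "cmod z < R" for z
  proof -
    have "(\<lambda>n. \<Sum>y\<in>?B. of_real (qp n v0 y) * z ^ n) sums (\<Sum>y\<in>?B. G z v0 y)"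
      using v0 Bs by (intro sums_sum R(2)[OF z]) auto
    then show ?thesis unfolding tf[OF z] hit_def by (simp add: sum_distrib_right)
  qed
  moreover have "hit 0 v0 = 0" unfolding hit_def by (intro sum.neutral) auto
  moreover have "hit 1 v0 = 0"
  proof -
    have "q v0 y = 0" if "y \<in> ?B" for y
    proof -
      have "\<not> adj X v0 y" using F_indep boundary_sub[OF C(1)] C(2) that by blast
      then have "y \<notin> nbrs ?Y v0" unfolding nbrs_iff[OF simple_cell_graph] adj_cell_graph by simp
      then show ?thesis by (simp add: q_def)
    qed
    moreover have "qp 1 v0 y = q v0 y" if "y \<in> V" for y
      using that finY by (simp add: if_distrib sum.delta cong: if_cong)
    ultimately have "qp 1 v0 y = 0" if "y \<in> ?B" for y using that Bs by (metis subsetD)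
    then show ?thesis unfolding hit_def by (rule sum.neutral[OF ballI])
  qed
  ultimately show ?thesis using R(1) hit_nonneg hit_sums_1[OF v0]
    by (intro exI[of _ R] exI[of _ "\<lambda>n. hit n v0"] conjI allI impI)
qed

text \<open>Termwise differentiation at 1 gives the sum of n a(n), a mean over a distribution
  concentrated on n >= 2. It makes log \<tau> positive.\<close>

theorem time_scaling_ge_2: "time_scaling X F \<ge> 2"
proof -
  obtain R a where R: "R > 1" and a: "\<And>n. a n \<ge> (0::real)" "a 0 = 0" "a 1 = 0" "a sums 1"
    and s: "\<And>z. cmod z < R \<Longrightarrow> (\<lambda>n. of_real (a n) * z ^ n) sums transition_function X F z"
    using transition_series by blast
  let ?d = "\<lambda>z. \<Sum>n. complex_of_real (a n) * z ^ n"
  define r where "r = (1 + R) / 2"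
  have r: "1 < r" "r < R" using R by (auto simp: r_def)
  have sr: "summable (\<lambda>n. complex_of_real (a n) * of_real r ^ n)"
    using s[of "of_real r"] r by (auto intro: sums_summable)
  have D: "(?d has_field_derivative (\<Sum>n. diffs (\<lambda>n. complex_of_real (a n)) n * 1 ^ n)) (at 1)"
    by (rule termdiffs_strong[OF sr]) (use r in simp)
  have "(transition_function X F has_field_derivative (\<Sum>n. diffs (\<lambda>n. complex_of_real (a n)) n * 1 ^ n)) (at 1)"
  proof (rule has_field_derivative_transform_within_open[OF D, of "ball 0 R"])
    show "?d z = transition_function X F z" if "z \<in> ball 0 R" for z
      using sums_unique[OF s[of z]] that by simp
  qed (use R in auto)
  then have t: "deriv (transition_function X F) 1 = (\<Sum>n. diffs (\<lambda>n. complex_of_real (a n)) n)"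
    using DERIV_imp_deriv by fastforce
  have sd: "summable (\<lambda>n. diffs (\<lambda>n. complex_of_real (a n)) n * 1 ^ n)"
    by (rule termdiff_converges[of _ R]) (use R s in \<open>auto intro: sums_summable\<close>)
  have e: "diffs (\<lambda>n. complex_of_real (a n)) n = of_real (real (Suc n) * a (Suc n))" for n by (simp add: diffs_def)
  have sd': "summable (\<lambda>n. real (Suc n) * a (Suc n))" using sd unfolding e by (simp only: power_one mult_1_right summable_of_real_iff)
  have "time_scaling X F = (\<Sum>n. real (Suc n) * a (Suc n))"
    unfolding time_scaling_def t e by (simp only: suminf_of_real[OF sd', symmetric] Re_complex_of_real)
  moreover have "(\<lambda>n. 2 * a (Suc n)) sums (2 * (1 - a 0))"
    using a(4) by (intro sums_mult) (simp add: sums_Suc_iff)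
  moreover have "2 * a (Suc n) \<le> real (Suc n) * a (Suc n)" for n
    using a(1)[of "Suc n"] a(3) by (cases n) (auto intro: mult_right_mono)
  ultimately show ?thesis using sums_le[of "\<lambda>n. 2 * a (Suc n)" "\<lambda>n. real (Suc n) * a (Suc n)"] sd' a(2)
    by (metis diff_zero mult.right_neutral summable_sums)
qed

end

subsection \<open>Asymptotics of the return probabilities\<close>

lemma green_domain_iff: "z \<in> green_domain \<longleftrightarrow> Im z \<noteq> 0 \<or> \<bar>Re z\<bar> < 1"
  by (auto simp: green_domain_def complex_is_Real_iff image_iff complex_eq_iff abs_less_iff intro!: bexI[of _ "Re z"])

lemma open_green_domain: "open green_domain"
proof -
  have e: "green_domain = {z. Im z \<noteq> 0} \<union> {z. \<bar>Re z\<bar> < 1}" by (auto simp: green_domain_iff)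
  show ?thesis unfolding e by (intro open_Un open_Collect_neq open_Collect_less continuous_intros)
qed

lemma connected_green_domain: "connected green_domain"
proof (rule starlike_imp_connected)
  have "closed_segment 0 z \<subseteq> green_domain" if z: "z \<in> green_domain" for z
  proof
    fix u assume "u \<in> closed_segment 0 z"
    then obtain t where t: "0 \<le> t" "t \<le> 1" "u = t *\<^sub>R z" by (auto simp: closed_segment_def)
    have "\<bar>t * Re z\<bar> \<le> \<bar>Re z\<bar>" using t by (simp add: abs_mult mult_left_le_one_le)
    then show "u \<in> green_domain" using z t by (auto simp: green_domain_iff)
  qed
  then show "starlike green_domain" unfolding starlike_def
    by (intro bexI[of _ 0]) (auto simp: green_domain_iff)
qed

lemma disc_green_domain: "cball 0 1 - {1, -1} \<subseteq> green_domain"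
proof
  fix z :: complex assume z: "z \<in> cball 0 1 - {1, -1}"
  then have "\<bar>Re z\<bar> \<le> 1" using abs_Re_le_cmod[of z] by auto
  moreover have "z = 1 \<or> z = -1" if "Im z = 0" "\<bar>Re z\<bar> = 1" using that by (auto simp: complex_eq_iff abs_if split: if_splits)
  ultimately show "z \<in> green_domain" using z unfolding green_domain_iff by force
qed

lemma ball_green_domain: "ball 0 1 \<subseteq> green_domain"
proof
  fix z :: complex assume "z \<in> ball 0 1"
  then have "z \<in> cball 0 1 - {1, -1}" by auto
  then show "z \<in> green_domain" using disc_green_domain by blast
qed

lemma green_domain_uminus: "z \<in> green_domain \<Longrightarrow> - z \<in> green_domain"
  by (simp add: green_domain_iff)

lemma green_domain_cut: "z \<in> green_domain \<Longrightarrow> 1 - z \<notin> \<real>\<^sub>\<le>\<^sub>0"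
  by (auto simp: green_domain_iff complex_nonpos_Reals_iff)

lemma sector_green_domain:
  assumes "\<rho> \<le> 1" "\<delta> < pi"
  shows "sector \<delta> 1 \<rho> \<subseteq> green_domain"
proof
  fix z assume z: "z \<in> sector \<delta> 1 \<rho>"
  show "z \<in> green_domain"
  proof (cases "Im z = 0")
    case True
    have "\<bar>Re (z - 1)\<bar> < 1" using z assms abs_Re_le_cmod[of "z - 1"] by (auto simp: sector_def)
    then have "Re z > 0" by auto
    moreover have "Re z < 1"
    proof (rule ccontr)
      assume "\<not> Re z < 1"
      moreover have "Re z \<noteq> 1" using z True by (auto simp: sector_def complex_eq_iff)
      ultimately have "Arg (1 - z) = pi" using True by (simp add: Arg_eq_pi)
      then show False using z assms by (auto simp: sector_def)
    qed
    ultimately show ?thesis by (simp add: green_domain_iff)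
  qed (simp add: green_domain_iff)
qed

lemma taylor_coeff_sums:
  assumes "\<And>z. cmod z < 1 \<Longrightarrow> (\<lambda>n. a n * z ^ n) sums f z"
  shows "(deriv ^^ n) f 0 / fact n = a n"
proof -
  have "eventually (\<lambda>z. z \<in> ball 0 1) (nhds (0::complex))" by (intro eventually_nhds_in_open) auto
  then have "\<forall>\<^sub>F z in nhds 0. (\<lambda>n. fps_nth (Abs_fps a) n * z ^ n) sums f z"
    by eventually_elim (simp add: assms)
  then have "f has_fps_expansion Abs_fps a" by (rule has_fps_expansionI)
  from fps_nth_fps_expansion[OF this, of n] show ?thesis by simp
qed

lemma walk_prob_walk: "walk_prob X n x y \<noteq> 0 \<Longrightarrow> (adj X ^^ n) x y"
proof (induction n arbitrary: x)
  case (Suc n)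
  then obtain w where "w \<in> nbrs X x" "walk_prob X n w y \<noteq> 0"
    by (metis (no_types, lifting) walk_prob.simps(2) mult_zero_right sum.neutral)
  then have "adj X x w" "(adj X ^^ n) w y" using Suc.IH by (auto simp: nbrs_def)
  then show ?case by (rule relpowp_Suc_I2)
qed (simp split: if_splits)

lemma real_inverse_cases:
  assumes "z * complex_of_real t = 1"
  shows "t \<noteq> 0" "z = of_real (1 / t)"
  using assms by (auto simp: eq_divide_eq)

lemma (in moment_seq) green_domain_resolvent_dom: "green_domain \<subseteq> resolvent_dom"
proof
  fix z assume z: "z \<in> green_domain"
  have "1 - z * complex_of_real t \<noteq> 0" if t: "a \<le> t" "t \<le> 1" for t
  proof
    assume "1 - z * complex_of_real t = 0"
    then have e: "z * complex_of_real t = 1" by simp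
    have "\<bar>t\<bar> \<le> 1" using t a by auto
    then have "\<bar>1 / t\<bar> \<ge> 1" using real_inverse_cases(1)[OF e] by (simp add: abs_divide)
    then show False using z unfolding green_domain_iff real_inverse_cases(2)[OF e] by (simp only: Re_complex_of_real Im_complex_of_real) linarith
  qed
  then show "z \<in> resolvent_dom" by (simp add: resolvent_dom_def)
qed

text \<open>The excluded points are 1/t with a <= t <= 1, and |1/t + 1| = |1 + t| / |t| >= 1 +
  a.\<close>

lemma (in moment_seq) ball_resolvent_dom: "ball (-1) (1 + a) \<subseteq> resolvent_dom"
proof
  fix z :: complex assume z: "z \<in> ball (-1) (1 + a)"
  have "1 - z * complex_of_real t \<noteq> 0" if t: "a \<le> t" "t \<le> 1" for t
  proof
    assume "1 - z * complex_of_real t = 0"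
    then have e: "z * complex_of_real t = 1" by simp
    note t0 = real_inverse_cases[OF e]
    have t1: "\<bar>t\<bar> \<le> 1" using t a by auto
    have "z - (-1) = of_real ((1 + t) / t)" using t0 by (simp add: field_simps)
    then have "cmod (z - (-1)) = \<bar>(1 + t) / t\<bar>" by (simp only: norm_of_real)
    also have "\<dots> = \<bar>1 + t\<bar> / \<bar>t\<bar>" by (rule abs_divide)
    also have "\<dots> \<ge> \<bar>1 + t\<bar> / 1" using t0 t1 by (intro divide_left_mono) auto
    finally have "cmod (z - (-1)) \<ge> 1 + a" using t by simp
    then show False using z by (simp add: dist_norm norm_minus_commute)
  qed
  then show "z \<in> resolvent_dom" by (simp add: resolvent_dom_def)
qed

section \<open>From the expansion of the Green function at 1 to the return probabilities\<close>

locale green_asymp = self_similar_walk X F \<psi> v for X :: "'a graph" and F \<psi> v +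
  fixes \<omega> :: "complex \<Rightarrow> complex"
  assumes BG: "bounded_geometry X" and GP: "green_periodic X F \<psi> v \<omega>"
begin

definition degree_bound where "degree_bound = (SOME k. \<forall>x\<in>verts X. finite (nbrs X x) \<and> deg X x \<le> k)"

sublocale bounded_graph X degree_bound
proof
  have "\<forall>x\<in>verts X. finite (nbrs X x) \<and> deg X x \<le> degree_bound"
    unfolding degree_bound_def by (rule someI_ex) (use BG in \<open>simp add: bounded_geometry_def\<close>)
  then show "\<And>x. x \<in> verts X \<Longrightarrow> deg X x \<le> degree_bound" by blast
qed (rule simple lf deg_positive; assumption?)+

abbreviation p where "p n \<equiv> walk_prob X n v v"
abbreviation g where "g \<equiv> green_function X v"
definition b where "b = ln (time_scaling X F)"
definition \<gamma> where "\<gamma> = spectral_dim X F \<psi> / 2"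

lemma b_pos: "b > 0" using time_scaling_ge_2 by (simp add: b_def)

lemma strip_eq: "strip (time_scaling X F) = hstrip (pi / b)" by (simp add: strip_def hstrip_def b_def)
lemma strip2_eq: "strip ((time_scaling X F)\<^sup>2) = hstrip (pi / (2 * b))"
  using time_scaling_ge_2 by (simp add: strip_def hstrip_def b_def ln_realpow)

text \<open>\<gamma> - 1 is the exponent of 1 - z in the expansion of the Green function, so
  \<open>lead\<close> becomes its leading term.\<close>

sublocale log_periodic \<omega> b "\<gamma> - 1"
  by unfold_locales (use GP b_pos in \<open>auto simp: green_periodic_def strip_eq\<close>)

lemma no_gap_moments: "moment_seq p (-1)"
  by (rule walk_moment_seq[OF v_verts]) (use no_gap in auto)

text \<open>\<open>green_function\<close> is chosen by \<open>SOME\<close>; the continued resolvent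
  with a = -1 shows that a function with the required properties exists.\<close>

lemma green: "g holomorphic_on green_domain" "\<And>z. cmod z < 1 \<Longrightarrow> (\<lambda>n. of_real (p n) * z ^ n) sums g z"
proof -
  interpret M: moment_seq p "-1" by (rule no_gap_moments)
  have "\<exists>f. f holomorphic_on green_domain \<and> (\<forall>z. cmod z < 1 \<longrightarrow> (\<lambda>n. of_real (p n) * z ^ n) sums f z)"
    using holomorphic_on_subset[OF M.resolvent_ext_holomorphic M.green_domain_resolvent_dom] M.resolvent_ext_sums by blast
  then have "g holomorphic_on green_domain \<and> (\<forall>z. cmod z < 1 \<longrightarrow> (\<lambda>n. of_real (p n) * z ^ n) sums g z)"
    unfolding green_function_def by (rule someI_ex)
  then show "g holomorphic_on green_domain" "\<And>z. cmod z < 1 \<Longrightarrow> (\<lambda>n. of_real (p n) * z ^ n) sums g z" by blast+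
qed

lemma identity_on_green_domain:
  assumes "f holomorphic_on green_domain" "f' holomorphic_on green_domain" "\<And>z. cmod z < 1 \<Longrightarrow> f z = f' z"
    and "z \<in> green_domain"
  shows "f z = f' z"
proof (rule analytic_continuation_open[of "ball 0 1" green_domain f f'])
qed (use assms ball_green_domain open_green_domain connected_green_domain in auto)

lemma lead_green_domain: "lead holomorphic_on green_domain"
  by (rule holomorphic_on_subset[OF lead_holomorphic]) (use green_domain_cut in auto)

text \<open>One angle beyond pi / 2 is enough: 2 pi / 3 leaves room for the Cauchy discs of
  \<open>tame_at_sector\<close>. The restriction \<rho> <= 1 keeps the sector away from the cut at
  -1.\<close>

lemma near_one: "\<exists>\<rho> K. 0 < \<rho> \<and> \<rho> \<le> 1 \<and> (\<forall>z\<in>sector (2 * pi / 3) 1 \<rho>. cmod (g z - lead z) \<le> K * cmod (z - 1) powr \<gamma>)"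
proof -
  obtain r where r: "r > 0" and R: "\<And>\<delta>. 0 < \<delta> \<Longrightarrow> \<delta> < pi \<Longrightarrow>
        (\<exists>K err. \<forall>z\<in>sector \<delta> 1 r. cmod (err z) \<le> K * cmod (z - 1) \<and>
           g z = (1 - z) powr complex_of_real (spectral_dim X F \<psi> / 2 - 1) *
             (\<omega> (Ln (1 - z) / complex_of_real (ln (time_scaling X F))) + err z))"
    using GP unfolding green_periodic_def by blast
  obtain K err where K: "\<And>z. z \<in> sector (2 * pi / 3) 1 r \<Longrightarrow> cmod (err z) \<le> K * cmod (z - 1) \<and>
           g z = (1 - z) powr complex_of_real (spectral_dim X F \<psi> / 2 - 1) *
             (\<omega> (Ln (1 - z) / complex_of_real (ln (time_scaling X F))) + err z)"
    using R[of "2 * pi / 3"] by auto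
  have "cmod (g z - lead z) \<le> K * cmod (z - 1) powr \<gamma>" if z: "z \<in> sector (2 * pi / 3) 1 (min r 1)" for z
  proof -
    have z': "z \<in> sector (2 * pi / 3) 1 r" using z by (auto simp: sector_def)
    have nz: "cmod (z - 1) > 0" using z by (auto simp: sector_def)
    have "g z - lead z = (1 - z) powr complex_of_real (\<gamma> - 1) * err z"
    proof -
      have "lead z = (1 - z) powr complex_of_real (spectral_dim X F \<psi> / 2 - 1) * \<omega> (Ln (1 - z) / complex_of_real (ln (time_scaling X F)))"
        unfolding lead_def unfolding \<gamma>_def b_def ..
      then show ?thesis using conjunct2[OF K[OF z']] by (simp only: \<gamma>_def distrib_left) simp
    qed
    then have "cmod (g z - lead z) = cmod (z - 1) powr (\<gamma> - 1) * cmod (err z)"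
      using norm_powr_real_powr'[of "of_real (\<gamma> - 1)" "1 - z"] by (simp add: norm_mult norm_minus_commute)
    also have "\<dots> \<le> cmod (z - 1) powr (\<gamma> - 1) * (K * cmod (z - 1))"
      using K[OF z'] by (intro mult_left_mono) auto
    also have "\<dots> = K * (cmod (z - 1) * cmod (z - 1) powr (\<gamma> - 1))" by simp
    also have "cmod (z - 1) * cmod (z - 1) powr (\<gamma> - 1) = cmod (z - 1) powr \<gamma>"
      using nz powr_mult_base[of "cmod (z - 1)" "\<gamma> - 1"] by simp
    finally show ?thesis .
  qed
  then show ?thesis using r by (intro exI[of _ "min r 1"] exI[of _ K]) auto
qed

text \<open>The least number of derivatives for which the Poisson kernel estimate applies to an
  error of order \<gamma>.\<close>

definition diff_order where "diff_order = nat \<lceil>\<gamma> + 2\<rceil>"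

lemma diff_order_ge: "real diff_order - \<gamma> \<ge> 2" unfolding diff_order_def by linarith

lemma tame_one:
  assumes U: "open U" "green_domain \<subseteq> U" and G: "G holomorphic_on U" "\<And>z. z \<in> green_domain \<Longrightarrow> G z = g z - lead z"
  shows "tame_at G diff_order (real diff_order - \<gamma>) 1"
proof -
  obtain \<rho> K where \<rho>: "0 < \<rho>" "\<rho> \<le> 1" "\<And>z. z \<in> sector (2 * pi / 3) 1 \<rho> \<Longrightarrow> cmod (g z - lead z) \<le> K * cmod (z - 1) powr \<gamma>"
    using near_one by blast
  have s: "sector (2 * pi / 3) 1 \<rho> \<subseteq> green_domain" by (rule sector_green_domain) (use \<rho> in auto)
  show ?thesis
  proof (rule tame_at_sector[OF G(1) U(1) _ \<rho>(1)])
    show "sector (2 * pi / 3) 1 \<rho> \<subseteq> U" using s U by blast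
    show "cmod (G z) \<le> K * cmod (z - 1) powr \<gamma>" if "z \<in> sector (2 * pi / 3) 1 \<rho>" for z
      using \<rho>(3)[OF that] G(2) s that by auto
  qed
qed

text \<open>With a > -1 the continued resolvent is also holomorphic on a disc about -1, so the
  remainder is tame there for trivial reasons. On the slit plane it agrees with \<open>g\<close> by
  the identity theorem, so the expansion at 1 applies to it.\<close>

lemma coeff_not_bipartite:
  assumes nb: "\<not> bipartite X"
  shows "\<exists>C. \<forall>n\<ge>1. cmod (of_real (p n) - (deriv ^^ n) lead 0 / fact n) \<le> C * real n powr (- \<gamma> - 1)"
proof -
  obtain L where L: "\<And>x. x \<in> verts X \<Longrightarrow> \<exists>l\<le>L. odd l \<and> (adj X ^^ l) x x" using uniform_odd_walk[OF nb] by blast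
  obtain a where a: "- 1 < a" "a < 1" "\<And>f. fin_supp f \<Longrightarrow> a * ip f f \<le> ip (avg f) f" using spectral_gap[OF L] by blast
  interpret M: moment_seq p a by (rule walk_moment_seq[OF v_verts]) (use a in auto)
  let ?U = "green_domain \<union> ball (-1) (1 + a)"
  have U: "open ?U" "?U \<subseteq> M.resolvent_dom" using open_green_domain M.green_domain_resolvent_dom M.ball_resolvent_dom by auto
  \<comment> \<open>The disc about -1 has radius below 2 and therefore misses the cut of
    \<open>lead\<close> on [1, \<infinity>).\<close>
  have cut: "1 - z \<notin> \<real>\<^sub>\<le>\<^sub>0" if "z \<in> ?U" for z
  proof (cases "z \<in> green_domain")
    case False
    then have "cmod (z - (-1)) < 2" using that a by (auto simp: dist_norm norm_minus_commute)
    then have "Re (z - (-1)) < 2" using complex_Re_le_cmod[of "z - (-1)"] by linarith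
    then show ?thesis by (auto simp: complex_nonpos_Reals_iff)
  qed (rule green_domain_cut)
  let ?R = "\<lambda>z. M.resolvent_ext z - lead z"
  have leadU: "lead holomorphic_on ?U" by (rule holomorphic_on_subset[OF lead_holomorphic]) (use cut in auto)
  have extU: "M.resolvent_ext holomorphic_on ?U" by (rule holomorphic_on_subset[OF M.resolvent_ext_holomorphic U(2)])
  have R: "?R holomorphic_on ?U" by (intro holomorphic_intros leadU extU)
  have eq: "M.resolvent_ext z = g z" if "z \<in> green_domain" for z
  proof (rule identity_on_green_domain[OF _ green(1) _ that])
    show "M.resolvent_ext holomorphic_on green_domain" using holomorphic_on_subset[OF extU] by blast
    show "M.resolvent_ext z = g z" if "cmod z < 1" for z using M.resolvent_ext_sums[OF that] green(2)[OF that] by (rule sums_unique2)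
  qed
  have b1: "ball 0 1 \<subseteq> ?U" "cball 0 1 - {1, -1} \<subseteq> ?U" using ball_green_domain disc_green_domain by auto
  have t1: "tame_at ?R diff_order (real diff_order - \<gamma>) 1" by (rule tame_one[OF U(1) _ R]) (use eq in auto)
  have t2: "tame_at ?R diff_order (real diff_order - \<gamma>) (-1)"
    by (rule tame_at_holomorphic[of _ _ "1 + a"]) (use a diff_order_ge holomorphic_on_subset[OF R, of "ball (-1) (1 + a)"] in auto)
  have "(deriv ^^ n) ?R 0 / fact n = of_real (p n) - (deriv ^^ n) lead 0 / fact n" for n
  proof -
    have "(deriv ^^ n) ?R 0 = (deriv ^^ n) M.resolvent_ext 0 - (deriv ^^ n) lead 0"
      by (rule higher_deriv_diff[OF extU leadU U(1)]) (simp add: green_domain_iff)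
    moreover have "(deriv ^^ n) M.resolvent_ext 0 / fact n = of_real (p n)" by (rule taylor_coeff_sums) (rule M.resolvent_ext_sums)
    ultimately show ?thesis by (simp add: diff_divide_distrib)
  qed
  then show ?thesis using big_O_transfer[OF R U(1) b1 diff_order_ge t1 t2] by simp
qed

lemma odd_walk_prob: "bipartite X \<Longrightarrow> odd n \<Longrightarrow> p n = 0"
  using walk_prob_walk[of X n v v] bipartite_closed_walk[of X n v] by blast

text \<open>Subtracting both lead (z) and lead (-z) leaves an even remainder, so its bound at 1 is
  reflected to -1. Near 1 the term lead (-z) is holomorphic and does not disturb that bound.\<close>

lemma coeff_bipartite:
  assumes bip: "bipartite X"
  shows "\<exists>C. \<forall>n\<ge>1. cmod (of_real (p n) - (1 + (- 1) ^ n) * ((deriv ^^ n) lead 0 / fact n)) \<le> C * real n powr (- \<gamma> - 1)"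
proof -
  let ?R = "\<lambda>z. (g z - lead z) + - lead (- z)"
  have neg: "(\<lambda>z. lead (- z)) holomorphic_on green_domain"
    by (rule holomorphic_on_compose_gen[unfolded o_def, OF _ lead_green_domain])
       (auto intro!: holomorphic_intros green_domain_uminus)
  have R1: "(\<lambda>z. g z - lead z) holomorphic_on green_domain" by (intro holomorphic_intros green(1) lead_green_domain)
  have R: "?R holomorphic_on green_domain" by (intro holomorphic_intros R1 neg)
  note sub = holomorphic_on_subset[OF _ ball_green_domain]
  have even: "g (- z) = g z" if "z \<in> green_domain" for z
  proof (rule identity_on_green_domain[OF _ green(1) _ that])
    show "(\<lambda>z. g (- z)) holomorphic_on green_domain"
      by (rule holomorphic_on_compose_gen[unfolded o_def, OF _ green(1)])
         (auto intro!: holomorphic_intros green_domain_uminus)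
    show "g (- z) = g z" if z: "cmod z < 1" for z
    proof (rule sums_unique2)
      show "(\<lambda>n. of_real (p n) * z ^ n) sums g z" by (rule green(2)[OF z])
      have "of_real (p n) * (- z) ^ n = of_real (p n) * z ^ n" for n
        using odd_walk_prob[OF bip, of n] by (cases "even n") auto
      moreover have "(\<lambda>n. of_real (p n) * (- z) ^ n) sums g (- z)" using z by (intro green(2)) simp
      ultimately show "(\<lambda>n. of_real (p n) * z ^ n) sums g (- z)" by (simp only:)
    qed
  qed
  have t1: "tame_at ?R diff_order (real diff_order - \<gamma>) 1"
  proof (rule tame_at_add)
    show "(\<lambda>z. g z - lead z) holomorphic_on ball 0 1" by (rule sub[OF R1])
    show "(\<lambda>z. - lead (- z)) holomorphic_on ball 0 1" by (intro holomorphic_intros sub[OF neg])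
    show "tame_at (\<lambda>z. g z - lead z) diff_order (real diff_order - \<gamma>) 1" by (rule tame_one[OF open_green_domain _ R1]) auto
    show "tame_at (\<lambda>z. - lead (- z)) diff_order (real diff_order - \<gamma>) 1"
    proof (rule tame_at_holomorphic[of _ _ 1])
      have "(\<lambda>z. lead (- z)) holomorphic_on ball 1 1"
      proof (rule holomorphic_on_compose_gen[unfolded o_def, OF _ lead_holomorphic])
        show "uminus ` ball (1 :: complex) 1 \<subseteq> {z. 1 - z \<notin> \<real>\<^sub>\<le>\<^sub>0}"
        proof clarify
          fix z :: complex assume z: "z \<in> ball 1 1" "1 - (- z) \<in> \<real>\<^sub>\<le>\<^sub>0"
          have "cmod (1 - z) < 1" using z by (simp add: dist_norm)
          then have "Re (1 - z) < 1" using complex_Re_le_cmod[of "1 - z"] by linarith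
          then show False using z by (auto simp: complex_nonpos_Reals_iff)
        qed
      qed (auto intro!: holomorphic_intros)
      then show "(\<lambda>z. - lead (- z)) holomorphic_on ball 1 1" by (intro holomorphic_intros)
    qed (use diff_order_ge in auto)
  qed
  have t2: "tame_at ?R diff_order (real diff_order - \<gamma>) (-1)"
  proof (rule tame_at_cong[OF _ _ tame_at_reflect[OF sub[OF R] t1]])
    have sym: "?R (- z) = ?R z" if "z \<in> green_domain" for z using even[OF that] by simp
    show "?R (- z) = ?R z" if "cmod z < 1" for z
      by (rule sym) (use ball_green_domain that in auto)
    show "(\<lambda>z. ?R (- z)) holomorphic_on ball 0 1"
      by (rule holomorphic_transform[OF sub[OF R]]) (use ball_green_domain sym in \<open>auto simp: subset_iff\<close>)
  qed
  have "(deriv ^^ n) ?R 0 / fact n = of_real (p n) - (1 + (- 1) ^ n) * ((deriv ^^ n) lead 0 / fact n)" for n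
  proof -
    have z0: "0 \<in> green_domain" by (simp add: green_domain_iff)
    have "(deriv ^^ n) ?R 0 = (deriv ^^ n) (\<lambda>z. g z - lead z) 0 + (deriv ^^ n) (\<lambda>z. - lead (- z)) 0"
      by (rule higher_deriv_add[OF R1 _ open_green_domain z0]) (intro holomorphic_intros neg)
    also have "(deriv ^^ n) (\<lambda>z. g z - lead z) 0 = (deriv ^^ n) g 0 - (deriv ^^ n) lead 0"
      by (rule higher_deriv_diff[OF green(1) lead_green_domain open_green_domain z0])
    also have "(deriv ^^ n) (\<lambda>z. - lead (- z)) 0 = - (deriv ^^ n) (\<lambda>z. lead (- z)) 0"
      by (rule higher_deriv_uminus[OF neg open_green_domain z0])
    also have "(deriv ^^ n) (\<lambda>z. lead (- z)) 0 = (- 1) ^ n * (deriv ^^ n) lead 0"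
      using higher_deriv_compose_linear[OF lead_green_domain open_green_domain open_green_domain z0, of "-1" n] green_domain_uminus by simp
    finally have "(deriv ^^ n) ?R 0 / fact n = (deriv ^^ n) g 0 / fact n - (1 + (- 1) ^ n) * ((deriv ^^ n) lead 0 / fact n)"
      by (simp add: field_simps)
    also have "(deriv ^^ n) g 0 / fact n = of_real (p n)" by (rule taylor_coeff_sums) (rule green(2))
    finally show ?thesis .
  qed
  then show ?thesis using big_O_transfer[OF R open_green_domain ball_green_domain disc_green_domain diff_order_ge t1 t2] by simp
qed

text \<open>At a pole Gamma has the default value 0, so the quotient is 0, which is also the value
  of \<open>rGamma\<close> there; the two forms agree for every index.\<close>

lemma profile_term:
  "fourier_coeff \<omega> (- j) /
      Gamma (1 - (complex_of_real (ln (real (mass_scaling X F \<psi>))) - 2 * of_int j * complex_of_real pi * \<i>)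
                 / complex_of_real (ln (time_scaling X F))) *
      exp (2 * of_int j * complex_of_real pi * \<i> * z) = coef j * rGamma (expo j) * per j z"
proof -
  have "expo j = 1 - (complex_of_real (ln (real (mass_scaling X F \<psi>))) - 2 * of_int j * complex_of_real pi * \<i>)
                 / complex_of_real (ln (time_scaling X F))"
  proof -
    have "\<gamma> = ln (real (mass_scaling X F \<psi>)) / b" by (simp add: \<gamma>_def spectral_dim_def b_def)
    then show ?thesis using b_pos unfolding expo_def ord_def b_def[symmetric]
      by (simp add: complex_eq_iff Re_divide_of_real Im_divide_of_real)
  qed
  then show ?thesis unfolding rGamma_inverse_Gamma coef_def per_def by (simp add: divide_inverse)
qed

text \<open>A nonzero factor \<open>s n\<close> has modulus at least 1, so dividing by it does not
  enlarge the error.\<close>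

lemma error_term:
  assumes "\<And>n. n \<ge> 1 \<Longrightarrow> cmod (x n - s n * of_real (real n powr (- \<gamma>)) * y n) \<le> C * real n powr (- \<gamma> - 1)"
    and "\<And>n. s n = 0 \<or> s n = 1 \<or> s n = (2::complex)"
  shows "\<And>n. n \<ge> 1 \<Longrightarrow> s n \<noteq> 0 \<Longrightarrow> cmod (x n * of_real (real n powr \<gamma>) / s n - y n) \<le> C / real n"
proof -
  fix n :: nat assume n: "n \<ge> 1" and s: "s n \<noteq> 0"
  have one: "real n powr (- \<gamma>) * real n powr \<gamma> = 1" using n by (simp flip: powr_add)
  then have one': "complex_of_real (real n powr (- \<gamma>)) * of_real (real n powr \<gamma>) = 1" by (metis of_real_1 of_real_mult)
  have "x n * of_real (real n powr \<gamma>) / s n - y n = (x n - s n * of_real (real n powr (- \<gamma>)) * y n) * of_real (real n powr \<gamma>) / s n"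
    using s one' by (simp add: field_simps)
  then have "cmod (x n * of_real (real n powr \<gamma>) / s n - y n) = cmod (x n - s n * of_real (real n powr (- \<gamma>)) * y n) * real n powr \<gamma> / cmod (s n)"
    by (simp add: norm_mult norm_divide)
  also have "\<dots> \<le> cmod (x n - s n * of_real (real n powr (- \<gamma>)) * y n) * real n powr \<gamma> / 1"
    using assms(2)[of n] s by (intro divide_left_mono) auto
  also have "\<dots> \<le> C * real n powr (- \<gamma> - 1) * real n powr \<gamma>"
    unfolding div_by_1 by (rule mult_right_mono[OF assms(1)[OF n]]) simp
  also have "\<dots> = C / real n"
  proof -
    have "real n powr (- \<gamma> - 1) * real n powr \<gamma> = real n powr (- 1)" by (simp flip: powr_add)
    then show ?thesis using n by (simp add: powr_minus divide_inverse mult.assoc)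
  qed
  finally show "cmod (x n * of_real (real n powr \<gamma>) / s n - y n) \<le> C / real n" .
qed

text \<open>The factor \<open>s\<close> treats both cases at once: it is constantly 1 if the graph
  is not bipartite and 1 + (-1)^n if it is.\<close>

lemma asymptotics:
  assumes s: "\<And>n. s n = 0 \<or> s n = 1 \<or> s n = (2::complex)"
    and C: "\<exists>C. \<forall>n\<ge>1. cmod (of_real (p n) - s n * ((deriv ^^ n) lead 0 / fact n)) \<le> C * real n powr (- \<gamma> - 1)"
  shows "\<exists>C. \<forall>n\<ge>1. s n \<noteq> 0 \<longrightarrow> cmod (of_real (p n) * of_real (real n powr \<gamma>) / s n - profile (of_real (ln (real n) / b))) \<le> C / real n"
proof -
  obtain C1 where C1: "\<And>n. n \<ge> 1 \<Longrightarrow> cmod (of_real (p n) - s n * ((deriv ^^ n) lead 0 / fact n)) \<le> C1 * real n powr (- \<gamma> - 1)"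
    using C by blast
  obtain C2 where C2: "\<And>n. n \<ge> 1 \<Longrightarrow> cmod ((deriv ^^ n) lead 0 / fact n - of_real (real n powr (- (\<gamma> - 1) - 1)) * profile (of_real (ln (real n) / b)))
     \<le> C2 * real n powr (- (\<gamma> - 1) - 2)"
    using lead_coeff_asymp by blast
  have "cmod (of_real (p n) - s n * of_real (real n powr (- \<gamma>)) * profile (of_real (ln (real n) / b))) \<le> (C1 + 2 * \<bar>C2\<bar>) * real n powr (- \<gamma> - 1)"
    if n: "n \<ge> 1" for n
  proof -
    let ?A = "(deriv ^^ n) lead 0 / fact n" and ?B = "of_real (real n powr (- \<gamma>)) * profile (of_real (ln (real n) / b))"
    have ex: "- (\<gamma> - 1) - 1 = - \<gamma>" "- (\<gamma> - 1) - 2 = - \<gamma> - 1" by simp_all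
    have 2: "cmod (?A - ?B) \<le> \<bar>C2\<bar> * real n powr (- \<gamma> - 1)"
      by (rule order_trans[OF C2[OF n, unfolded ex]]) (intro mult_right_mono; simp)
    have "of_real (p n) - s n * ?B = (of_real (p n) - s n * ?A) + s n * (?A - ?B)" by (simp add: right_diff_distrib)
    then have "cmod (of_real (p n) - s n * ?B) \<le> cmod (of_real (p n) - s n * ?A) + cmod (s n) * cmod (?A - ?B)"
      using norm_triangle_ineq[of "of_real (p n) - s n * ?A" "s n * (?A - ?B)"] by (simp only: norm_mult)
    also have "cmod (s n) * cmod (?A - ?B) \<le> 2 * (\<bar>C2\<bar> * real n powr (- \<gamma> - 1))"
      by (intro mult_mono 2) (use s[of n] in auto)
    finally show ?thesis using C1[OF n] by (simp add: distrib_right mult.assoc)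
  qed
  from error_term[of "\<lambda>n. of_real (p n)" s "\<lambda>n. profile (of_real (ln (real n) / b))", OF this s] show ?thesis by blast
qed

lemma error_bigo:
  fixes e :: "nat \<Rightarrow> complex"
  assumes "\<And>n. n \<ge> 1 \<Longrightarrow> cmod (e n) \<le> C / real n"
  shows "e \<in> O(\<lambda>n. 1 / of_nat n)"
  by (rule bigoI[of _ C]) (use assms in \<open>auto intro!: eventually_at_top_linorderI[of 1] simp: norm_divide\<close>)

lemma powr_cancel: "n \<ge> 1 \<Longrightarrow> complex_of_real (real n powr (- \<gamma>)) * of_real (real n powr \<gamma>) = 1"
proof -
  assume "n \<ge> 1"
  then have "real n powr (- \<gamma>) * real n powr \<gamma> = 1" by (simp flip: powr_add)
  then show ?thesis by (metis of_real_1 of_real_mult)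
qed

end

theorem theorem6:
  fixes X :: "'a graph" and F :: "'a set" and \<psi> :: "'a \<Rightarrow> 'a" and v :: 'a
    and \<omega> :: "complex \<Rightarrow> complex" and \<mu> \<tau> ds :: real
  assumes "symmetrically_self_similar X F \<psi>"
    and "bounded_geometry X"
    and "origin_vertex X \<psi> v"
    and "green_periodic X F \<psi> v \<omega>"
  defines "\<mu> \<equiv> real (mass_scaling X F \<psi>)"
    and "\<tau> \<equiv> time_scaling X F"
    and "ds \<equiv> spectral_dim X F \<psi>"
  shows "\<exists>\<sigma> :: complex \<Rightarrow> complex.
    \<sigma> holomorphic_on strip (\<tau>\<^sup>2) \<and>
    (\<forall>z\<in>strip (\<tau>\<^sup>2). \<sigma> (z + 1) = \<sigma> z) \<and>
    (\<forall>z\<in>strip (\<tau>\<^sup>2).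
      ((\<lambda>k::int. fourier_coeff \<omega> (- k) /
          Gamma (1 - (complex_of_real (ln \<mu>) - 2 * of_int k * complex_of_real pi * \<i>)
                     / complex_of_real (ln \<tau>)) *
          exp (2 * of_int k * complex_of_real pi * \<i> * z)) has_sum \<sigma> z) UNIV) \<and>
    (\<not> bipartite X \<longrightarrow>
      (\<exists>err :: nat \<Rightarrow> complex. err \<in> O(\<lambda>n. 1 / of_nat n) \<and>
        (\<forall>n\<ge>1. complex_of_real (walk_prob X n v v) =
           complex_of_real (real n powr (- ds / 2)) *
           (\<sigma> (complex_of_real (ln (real n) / ln \<tau>)) + err n)))) \<and>
    (bipartite X \<longrightarrow>
      (\<forall>n. walk_prob X (2 * n + 1) v v = 0) \<and>
      (\<exists>err :: nat \<Rightarrow> complex. err \<in> O(\<lambda>n. 1 / of_nat n) \<and>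
        (\<forall>n\<ge>1. complex_of_real (walk_prob X (2 * n) v v) =
           2 * complex_of_real (real (2 * n) powr (- ds / 2)) *
           (\<sigma> (complex_of_real (ln (real (2 * n)) / ln \<tau>)) + err n))))"
proof -
  interpret green_asymp X F \<psi> v \<omega> by unfold_locales (fact assms)+
  have ds: "- ds / 2 = - \<gamma>" by (simp add: ds_def \<gamma>_def)
  have b: "ln \<tau> = b" by (simp add: \<tau>_def b_def)
  let ?x = "\<lambda>n. complex_of_real (ln (real n) / b)"
  show ?thesis
    unfolding \<mu>_def \<tau>_def profile_term unfolding \<tau>_def[symmetric] ds b
  proof (intro exI[of _ profile] conjI ballI impI allI)
    show "profile holomorphic_on strip (\<tau>\<^sup>2)" unfolding \<tau>_def strip2_eq by (rule profile_holomorphic)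
    show "profile (z + 1) = profile z" for z by (rule profile_plus_1)
    show "((\<lambda>k. coef k * rGamma (expo k) * per k z) has_sum profile z) UNIV" if "z \<in> strip (\<tau>\<^sup>2)" for z
      using that unfolding \<tau>_def strip2_eq by (rule profile_has_sum)
  next
    assume nb: "\<not> bipartite X"
    \<comment> \<open>The error is obtained by solving the claimed equation for it, so only its size
      has to be checked.\<close>
    let ?e = "\<lambda>n. of_real (p n) * of_real (real n powr \<gamma>) - profile (?x n)"
    obtain C where C: "\<And>n. n \<ge> 1 \<Longrightarrow> cmod (?e n) \<le> C / real n"
      using asymptotics[of "\<lambda>_. 1"] coeff_not_bipartite[OF nb] by auto
    show "\<exists>err :: nat \<Rightarrow> complex. err \<in> O(\<lambda>n. 1 / of_nat n) \<and>
        (\<forall>n\<ge>1. of_real (p n) = of_real (real n powr (- \<gamma>)) * (profile (?x n) + err n))"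
    proof (intro exI[of _ ?e] conjI allI impI error_bigo[OF C])
      fix n :: nat assume n: "n \<ge> 1"
      have "of_real (real n powr (- \<gamma>)) * (profile (?x n) + ?e n) = of_real (p n) * (of_real (real n powr (- \<gamma>)) * of_real (real n powr \<gamma>))"
        by simp
      then show "of_real (p n) = of_real (real n powr (- \<gamma>)) * (profile (?x n) + ?e n)"
        unfolding powr_cancel[OF n] by simp
    qed
  next
    assume bip: "bipartite X"
    show "walk_prob X (2 * n + 1) v v = 0" for n by (rule odd_walk_prob[OF bip]) simp
    let ?e = "\<lambda>n. of_real (p (2 * n)) * of_real (real (2 * n) powr \<gamma>) / 2 - profile (?x (2 * n))"
    have s: "1 + (- 1) ^ n = (0::complex) \<or> 1 + (- 1) ^ n = (1::complex) \<or> 1 + (- 1) ^ n = (2::complex)" for n :: nat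
      by (cases "even n") auto
    obtain C where C: "\<And>n. n \<ge> 1 \<Longrightarrow> 1 + (- 1) ^ n \<noteq> (0::complex) \<Longrightarrow>
        cmod (of_real (p n) * of_real (real n powr \<gamma>) / (1 + (- 1) ^ n) - profile (?x n)) \<le> C / real n"
      using asymptotics[of "\<lambda>n. 1 + (- 1) ^ n", OF s coeff_bipartite[OF bip]] by blast
    \<comment> \<open>The estimate is used at index 2n, where C / (2n) = (C / 2) / n.\<close>
    have C': "cmod (?e n) \<le> (C / 2) / real n" if n: "n \<ge> 1" for n
      using C[of "2 * n"] n by simp
    show "\<exists>err :: nat \<Rightarrow> complex. err \<in> O(\<lambda>n. 1 / of_nat n) \<and>
        (\<forall>n\<ge>1. of_real (p (2 * n)) = 2 * of_real (real (2 * n) powr (- \<gamma>)) * (profile (?x (2 * n)) + err n))"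
    proof (intro exI[of _ ?e] conjI allI impI error_bigo[OF C'])
      fix n :: nat assume n: "n \<ge> 1"
      have "2 * of_real (real (2 * n) powr (- \<gamma>)) * (profile (?x (2 * n)) + ?e n) =
          of_real (p (2 * n)) * (of_real (real (2 * n) powr (- \<gamma>)) * of_real (real (2 * n) powr \<gamma>))"
        by simp
      then show "of_real (p (2 * n)) = 2 * of_real (real (2 * n) powr (- \<gamma>)) * (profile (?x (2 * n)) + ?e n)"
        using powr_cancel[of "2 * n"] n by simp
    qed
  qed
qed

end
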